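(* Assume $T$ is $\mathrm{NIP}$. Let $A$ be a small set of parameters. Let $p$ be a global $A$-definable type and let $(f_b)_b$ be an $A$-definable family of functions such that, for all $b\in M$ and all $a\models p\restriction_A$, we have $f_b(a)\in \mathrm{St}_{Aa}(M)$. Let $\Theta$ be the $A$-definable set of all germs $[f_m]_p$. Then $\Theta$ is stable and stably embedded. In particular, $[f_b]_p\in \mathrm{St}_A(M)$ for every $b$.
   Context: $T$ is a complete first-order theory that eliminates imaginaries, $M$ is its monster model, parameter sets are small, and a global type is a complete type over $M$. For a small set $C$, $\mathrm{St}_C$ is the multi-sorted structure whose sorts are the $C$-definable, stable, stably embedded sets (imaginary sorts included), with all $C$-definable relations on finite products of sorts; $e\in\mathrm{St}_C(M)$ means that $e$ belongs to such a set. A definable set is stable if its induced structure is stable; it is stably embedded if every $M$-definable subset of one of its powers is definable with parameters from the set together with the parameters defining it. Germs: for a global $A$-definable type $p$ and an $A$-definable family of functions $(f_c)_c$ defined on $p$, let $E(c_1,c_2)$ hold iff the formula $f_{c_1}(x)=f_{c_2}(x)$ belongs to $p(x)$. This is an $A$-definable equivalence relation, and the class $c/E$ is the $p$-germ of $f_c$, denoted $[f_c]_p$ (an element of $M$, by elimination of imaginaries). *)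

theory Defs
  imports Main
begin

unbundle cardinal_syntax

section \<open>Many-sorted first-order logic\<close>

text \<open>
  Variables are de Bruijn indices.  A formula is read in a context, the list of sorts of its free
  variables; index \<open>i\<close> is the \<open>i\<close>-th variable of the context, and a quantifier extends the
  context at the front.  A formula in context \<open>ss @ ts\<close> is thus a partitioned formula
  \<open>\<phi>(x;y)\<close>, and finite tuples of elements are lists.
\<close>

datatype 'f fo_term = Var nat | App 'f "'f fo_term list"

datatype ('s, 'f, 'r) formula =
    Falsum
  | Equal "'f fo_term" "'f fo_term"
  | Rel 'r "'f fo_term list"
  | Neg "('s, 'f, 'r) formula"
  | Conj "('s, 'f, 'r) formula" "('s, 'f, 'r) formula"
  | Exists 's "('s, 'f, 'r) formula"

record ('s, 'f, 'r) language =
  funs :: "'f set"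
  fargs :: "'f \<Rightarrow> 's list"
  fres :: "'f \<Rightarrow> 's"
  rels :: "'r set"
  rargs :: "'r \<Rightarrow> 's list"

inductive term_sort :: "('s, 'f, 'r) language \<Rightarrow> 's list \<Rightarrow> 'f fo_term \<Rightarrow> 's \<Rightarrow> bool"
  for L :: "('s, 'f, 'r) language" and ss :: "'s list" where
  term_sort_Var: "i < length ss \<Longrightarrow> term_sort L ss (Var i) (ss ! i)"
| term_sort_App: "f \<in> funs L \<Longrightarrow> list_all2 (term_sort L ss) ts (fargs L f)
    \<Longrightarrow> term_sort L ss (App f ts) (fres L f)"

primrec wff :: "('s, 'f, 'r) language \<Rightarrow> 's list \<Rightarrow> ('s, 'f, 'r) formula \<Rightarrow> bool" where
  "wff L ss Falsum \<longleftrightarrow> True"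
| "wff L ss (Equal t u) \<longleftrightarrow> (\<exists>s. term_sort L ss t s \<and> term_sort L ss u s)"
| "wff L ss (Rel r ts) \<longleftrightarrow> r \<in> rels L \<and> list_all2 (term_sort L ss) ts (rargs L r)"
| "wff L ss (Neg \<phi>) \<longleftrightarrow> wff L ss \<phi>"
| "wff L ss (Conj \<phi> \<psi>) \<longleftrightarrow> wff L ss \<phi> \<and> wff L ss \<psi>"
| "wff L ss (Exists s \<phi>) \<longleftrightarrow> wff L (s # ss) \<phi>"

record ('s, 'f, 'r, 'm) struct =
  dom_of :: "'s \<Rightarrow> 'm set"
  fint :: "'f \<Rightarrow> 'm list \<Rightarrow> 'm"
  rint :: "'r \<Rightarrow> 'm list set"

definition tuples :: "('s, 'f, 'r, 'm) struct \<Rightarrow> 's list \<Rightarrow> 'm list set" where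
  "tuples M ss = {xs. list_all2 (\<lambda>x s. x \<in> dom_of M s) xs ss}"

definition points :: "('s, 'f, 'r, 'm) struct \<Rightarrow> 'm set" where
  "points M = (\<Union>s. dom_of M s)"

text \<open>Distinct sorts are disjoint, so that a set of parameters can be given as a set of elements.\<close>

definition is_structure :: "('s, 'f, 'r) language \<Rightarrow> ('s, 'f, 'r, 'm) struct \<Rightarrow> bool" where
  "is_structure L M \<longleftrightarrow>
     (\<forall>s t. s \<noteq> t \<longrightarrow> dom_of M s \<inter> dom_of M t = {}) \<and>
     (\<forall>f\<in>funs L. \<forall>xs\<in>tuples M (fargs L f). fint M f xs \<in> dom_of M (fres L f)) \<and>
     (\<forall>r\<in>rels L. rint M r \<subseteq> tuples M (rargs L r))"

primrec eval_term :: "('s, 'f, 'r, 'm) struct \<Rightarrow> 'm list \<Rightarrow> 'f fo_term \<Rightarrow> 'm" where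
  "eval_term M xs (Var i) = xs ! i"
| "eval_term M xs (App f ts) = fint M f (map (eval_term M xs) ts)"

primrec sat :: "('s, 'f, 'r, 'm) struct \<Rightarrow> 'm list \<Rightarrow> ('s, 'f, 'r) formula \<Rightarrow> bool" where
  "sat M xs Falsum \<longleftrightarrow> False"
| "sat M xs (Equal t u) \<longleftrightarrow> eval_term M xs t = eval_term M xs u"
| "sat M xs (Rel r ts) \<longleftrightarrow> map (eval_term M xs) ts \<in> rint M r"
| "sat M xs (Neg \<phi>) \<longleftrightarrow> \<not> sat M xs \<phi>"
| "sat M xs (Conj \<phi> \<psi>) \<longleftrightarrow> sat M xs \<phi> \<and> sat M xs \<psi>"
| "sat M xs (Exists s \<phi>) \<longleftrightarrow> (\<exists>x\<in>dom_of M s. sat M (x # xs) \<phi>)"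

text \<open>A complete theory is taken to be deductively closed, hence decides each sentence by
  membership; having a model makes it consistent.\<close>

definition complete_theory :: "('s, 'f, 'r) language \<Rightarrow> ('s, 'f, 'r) formula set \<Rightarrow> bool" where
  "complete_theory L T \<longleftrightarrow>
     (\<forall>\<phi>\<in>T. wff L [] \<phi>) \<and> (\<forall>\<phi>. wff L [] \<phi> \<longrightarrow> (\<phi> \<in> T \<longleftrightarrow> Neg \<phi> \<notin> T))"

definition models :: "('s, 'f, 'r, 'm) struct \<Rightarrow> ('s, 'f, 'r) formula set \<Rightarrow> bool" where
  "models M T \<longleftrightarrow> (\<forall>\<phi>\<in>T. sat M [] \<phi>)"

definition solutions ::
  "('s, 'f, 'r, 'm) struct \<Rightarrow> 's list \<Rightarrow> ('s, 'f, 'r) formula \<Rightarrow> 'm list \<Rightarrow> 'm list set" where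
  "solutions M ss \<phi> cs = {xs \<in> tuples M ss. sat M (xs @ cs) \<phi>}"

text \<open>Formulas in variables of sorts \<open>ss\<close> with parameters in \<open>C\<close>: \<open>(\<phi>, cs)\<close> stands for
  \<open>\<phi>(x, cs)\<close>.\<close>

definition formulas_over ::
  "('s, 'f, 'r) language \<Rightarrow> ('s, 'f, 'r, 'm) struct \<Rightarrow> 'm set \<Rightarrow> 's list
    \<Rightarrow> (('s, 'f, 'r) formula \<times> 'm list) set" where
  "formulas_over L M C ss =
     {(\<phi>, cs). set cs \<subseteq> C \<and> (\<exists>ts. cs \<in> tuples M ts \<and> wff L (ss @ ts) \<phi>)}"

definition definable ::
  "('s, 'f, 'r) language \<Rightarrow> ('s, 'f, 'r, 'm) struct \<Rightarrow> 'm set \<Rightarrow> 's list \<Rightarrow> 'm list set \<Rightarrow> bool" where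
  "definable L M C ss X \<longleftrightarrow> (\<exists>(\<phi>, cs)\<in>formulas_over L M C ss. X = solutions M ss \<phi> cs)"

definition definable2 ::
  "('s, 'f, 'r) language \<Rightarrow> ('s, 'f, 'r, 'm) struct \<Rightarrow> 'm set \<Rightarrow> 's list
    \<Rightarrow> ('m list \<times> 'm list) set \<Rightarrow> bool" where
  "definable2 L M C ss E \<longleftrightarrow>
     E \<subseteq> tuples M ss \<times> tuples M ss \<and> definable L M C (ss @ ss) {x @ y | x y. (x, y) \<in> E}"


section \<open>Types\<close>

definition complete_type ::
  "('s, 'f, 'r) language \<Rightarrow> ('s, 'f, 'r, 'm) struct \<Rightarrow> 'm set \<Rightarrow> 's list
    \<Rightarrow> (('s, 'f, 'r) formula \<times> 'm list) set \<Rightarrow> bool" where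
  "complete_type L M C ss p \<longleftrightarrow>
     p \<subseteq> formulas_over L M C ss \<and>
     (\<forall>q\<subseteq>p. finite q \<longrightarrow> (\<exists>x\<in>tuples M ss. \<forall>(\<phi>, cs)\<in>q. sat M (x @ cs) \<phi>)) \<and>
     (\<forall>(\<phi>, cs)\<in>formulas_over L M C ss. (\<phi>, cs) \<in> p \<or> (Neg \<phi>, cs) \<in> p)"

abbreviation global_type ::
  "('s, 'f, 'r) language \<Rightarrow> ('s, 'f, 'r, 'm) struct \<Rightarrow> 's list
    \<Rightarrow> (('s, 'f, 'r) formula \<times> 'm list) set \<Rightarrow> bool" where
  "global_type L M ss p \<equiv> complete_type L M (points M) ss p"

definition restrict_type ::
  "(('s, 'f, 'r) formula \<times> 'm list) set \<Rightarrow> 'm set \<Rightarrow> (('s, 'f, 'r) formula \<times> 'm list) set" where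
  "restrict_type p A = {(\<phi>, cs) \<in> p. set cs \<subseteq> A}"

definition realizes ::
  "('s, 'f, 'r, 'm) struct \<Rightarrow> 's list \<Rightarrow> 'm list \<Rightarrow> (('s, 'f, 'r) formula \<times> 'm list) set \<Rightarrow> bool" where
  "realizes M ss a p \<longleftrightarrow> a \<in> tuples M ss \<and> (\<forall>(\<phi>, cs)\<in>p. sat M (a @ cs) \<phi>)"

definition definable_type ::
  "('s, 'f, 'r) language \<Rightarrow> ('s, 'f, 'r, 'm) struct \<Rightarrow> 'm set \<Rightarrow> 's list
    \<Rightarrow> (('s, 'f, 'r) formula \<times> 'm list) set \<Rightarrow> bool" where
  "definable_type L M A ss p \<longleftrightarrow>
     (\<forall>ts \<phi>. wff L (ss @ ts) \<phi> \<longrightarrow> definable L M A ts {cs \<in> tuples M ts. (\<phi>, cs) \<in> p})"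

text \<open>The definable sets \<open>X\<close> such that the formula \<open>x \<in> X\<close> belongs to \<open>p(x)\<close>.\<close>

definition type_sets ::
  "('s, 'f, 'r, 'm) struct \<Rightarrow> 's list \<Rightarrow> (('s, 'f, 'r) formula \<times> 'm list) set \<Rightarrow> 'm list set set" where
  "type_sets M ss p = {solutions M ss \<phi> cs | \<phi> cs. (\<phi>, cs) \<in> p}"


section \<open>Monster models\<close>

definition small :: "'k rel \<Rightarrow> 'm set \<Rightarrow> bool" where
  "small \<kappa> A \<longleftrightarrow> |A| <o \<kappa>"

definition saturated ::
  "'k rel \<Rightarrow> ('s, 'f, 'r) language \<Rightarrow> ('s, 'f, 'r, 'm) struct \<Rightarrow> bool" where
  "saturated \<kappa> L M \<longleftrightarrow>
     (\<forall>A ss p. A \<subseteq> points M \<and> small \<kappa> A \<and> complete_type L M A ss p \<longrightarrow> (\<exists>a. realizes M ss a p))"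

definition partial_elementary ::
  "('s, 'f, 'r) language \<Rightarrow> ('s, 'f, 'r, 'm) struct \<Rightarrow> 'm set \<Rightarrow> ('m \<Rightarrow> 'm) \<Rightarrow> bool" where
  "partial_elementary L M A g \<longleftrightarrow>
     (\<forall>ss. \<forall>xs\<in>tuples M ss. set xs \<subseteq> A \<longrightarrow>
        map g xs \<in> tuples M ss \<and>
        (\<forall>\<phi>. wff L ss \<phi> \<longrightarrow> (sat M xs \<phi> \<longleftrightarrow> sat M (map g xs) \<phi>)))"

definition automorphism ::
  "('s, 'f, 'r) language \<Rightarrow> ('s, 'f, 'r, 'm) struct \<Rightarrow> ('m \<Rightarrow> 'm) \<Rightarrow> bool" where
  "automorphism L M h \<longleftrightarrow>
     (\<forall>s. bij_betw h (dom_of M s) (dom_of M s)) \<and>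
     (\<forall>f\<in>funs L. \<forall>xs\<in>tuples M (fargs L f). h (fint M f xs) = fint M f (map h xs)) \<and>
     (\<forall>r\<in>rels L. \<forall>xs\<in>tuples M (rargs L r). xs \<in> rint M r \<longleftrightarrow> map h xs \<in> rint M r)"

definition strongly_homogeneous ::
  "'k rel \<Rightarrow> ('s, 'f, 'r) language \<Rightarrow> ('s, 'f, 'r, 'm) struct \<Rightarrow> bool" where
  "strongly_homogeneous \<kappa> L M \<longleftrightarrow>
     (\<forall>A g. A \<subseteq> points M \<and> small \<kappa> A \<and> partial_elementary L M A g \<longrightarrow>
        (\<exists>h. automorphism L M h \<and> (\<forall>a\<in>A. h a = g a)))"

text \<open>The cardinal \<open>\<kappa>\<close> bounding the small sets exceeds the number of formulas; in particular it is
  uncountable.\<close>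

definition monster_model ::
  "'k rel \<Rightarrow> ('s, 'f, 'r) language \<Rightarrow> ('s, 'f, 'r) formula set \<Rightarrow> ('s, 'f, 'r, 'm) struct \<Rightarrow> bool" where
  "monster_model \<kappa> L T M \<longleftrightarrow>
     is_structure L M \<and> models M T \<and>
     Card_order \<kappa> \<and> |{\<phi>. \<exists>ss. wff L ss \<phi>}| <o \<kappa> \<and>
     saturated \<kappa> L M \<and> strongly_homogeneous \<kappa> L M"


section \<open>Properties of the theory\<close>

text \<open>These are properties of the complete theory of \<open>M\<close>, expressed in \<open>M\<close>: NIP and stability
  by finite configurations, which are first-order; elimination of imaginaries by codes for classes,
  which depends only on the theory by compactness when \<open>M\<close> is a monster model.\<close>

definition NIP :: "('s, 'f, 'r) language \<Rightarrow> ('s, 'f, 'r, 'm) struct \<Rightarrow> bool" where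
  "NIP L M \<longleftrightarrow>
     (\<forall>ss ts \<phi>. wff L (ss @ ts) \<phi> \<longrightarrow>
        (\<exists>n::nat. \<not> (\<exists>a b.
           (\<forall>i<n. a i \<in> tuples M ss) \<and> (\<forall>I\<subseteq>{..<n}. b I \<in> tuples M ts) \<and>
           (\<forall>i<n. \<forall>I\<subseteq>{..<n}. sat M (a i @ b I) \<phi> \<longleftrightarrow> i \<in> I))))"

definition stable_structure :: "('s, 'f, 'r) language \<Rightarrow> ('s, 'f, 'r, 'm) struct \<Rightarrow> bool" where
  "stable_structure L M \<longleftrightarrow>
     (\<forall>ss ts \<phi>. wff L (ss @ ts) \<phi> \<longrightarrow>
        (\<exists>n::nat. \<not> (\<exists>a b.
           (\<forall>i<n. a i \<in> tuples M ss \<and> b i \<in> tuples M ts) \<and>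
           (\<forall>i<n. \<forall>j<n. sat M (a i @ b j) \<phi> \<longleftrightarrow> i < j))))"

definition eliminates_imaginaries ::
  "('s, 'f, 'r) language \<Rightarrow> ('s, 'f, 'r, 'm) struct \<Rightarrow> bool" where
  "eliminates_imaginaries L M \<longleftrightarrow>
     (\<forall>ss E. equiv (tuples M ss) E \<and> definable2 L M {} ss E \<longrightarrow>
        (\<forall>e\<in>tuples M ss // E. \<exists>ts \<phi>. wff L (ss @ ts) \<phi> \<and>
           (\<exists>!d. d \<in> tuples M ts \<and> e = solutions M ss \<phi> d)))"


section \<open>Imaginary definable sets, and stable stably embedded sets\<close>

text \<open>
  Definable sets in imaginary sorts are represented as quotients \<open>D // E\<close>, so an element is a
  set of tuples, and a tuple \<open>a\<close> of elements of \<open>M\<close> is identified with its class \<open>{a}\<close> for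
  equality.
\<close>

definition imaginary_set ::
  "('s, 'f, 'r) language \<Rightarrow> ('s, 'f, 'r, 'm) struct \<Rightarrow> 'm set \<Rightarrow> 'm list set set \<Rightarrow> bool" where
  "imaginary_set L M C X \<longleftrightarrow>
     (\<exists>ss D E. definable L M C ss D \<and> definable2 L M C ss E \<and> equiv D E \<and> X = D // E)"

definition power_set :: "'a set \<Rightarrow> nat \<Rightarrow> 'a list set" where
  "power_set X n = {ks. length ks = n \<and> set ks \<subseteq> X}"

text \<open>A relation between imaginaries is definable if its preimage in \<open>M\<close> is.  The sorts need not
  be recorded: they are determined by the preimage unless it is empty.\<close>

definition definable_relation ::
  "('s, 'f, 'r) language \<Rightarrow> ('s, 'f, 'r, 'm) struct \<Rightarrow> 'm set \<Rightarrow> 'm list set list set \<Rightarrow> bool" where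
  "definable_relation L M C R \<longleftrightarrow>
     (\<exists>ss. definable L M C ss {concat xs | xs ks. ks \<in> R \<and> list_all2 (\<in>) xs ks})"

text \<open>The structure induced on a \<open>C\<close>-definable set \<open>X\<close>: one relation symbol \<open>(n, R)\<close>, naming
  \<open>R\<close>, for each \<open>C\<close>-definable \<open>R \<subseteq> X\<^sup>n\<close>.\<close>

definition induced_language ::
  "('s, 'f, 'r) language \<Rightarrow> ('s, 'f, 'r, 'm) struct \<Rightarrow> 'm set \<Rightarrow> 'm list set set
    \<Rightarrow> (unit, unit, nat \<times> 'm list set list set) language" where
  "induced_language L M C X =
     \<lparr> funs = {}, fargs = (\<lambda>_. []), fres = (\<lambda>_. ()),
       rels = {(n, R). R \<subseteq> power_set X n \<and> definable_relation L M C R},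
       rargs = (\<lambda>(n, R). replicate n ()) \<rparr>"

definition induced_structure ::
  "'m list set set \<Rightarrow> (unit, unit, nat \<times> 'm list set list set, 'm list set) struct" where
  "induced_structure X = \<lparr> dom_of = (\<lambda>_. X), fint = (\<lambda>_ _. undefined), rint = (\<lambda>(n, R). R) \<rparr>"

definition stable_set ::
  "('s, 'f, 'r) language \<Rightarrow> ('s, 'f, 'r, 'm) struct \<Rightarrow> 'm set \<Rightarrow> 'm list set set \<Rightarrow> bool" where
  "stable_set L M C X \<longleftrightarrow> stable_structure (induced_language L M C X) (induced_structure X)"

text \<open>A relation is definable with parameters from \<open>X\<close> and \<open>C\<close> iff it is a fibre, over a tuple
  \<open>ks\<close> from \<open>X\<close>, of a \<open>C\<close>-definable relation.\<close>

definition stably_embedded ::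
  "('s, 'f, 'r) language \<Rightarrow> ('s, 'f, 'r, 'm) struct \<Rightarrow> 'm set \<Rightarrow> 'm list set set \<Rightarrow> bool" where
  "stably_embedded L M C X \<longleftrightarrow>
     (\<forall>n R. R \<subseteq> power_set X n \<and> definable_relation L M (points M) R \<longrightarrow>
        (\<exists>m. \<exists>ks\<in>power_set X m. \<exists>S\<subseteq>power_set X (n + m).
           definable_relation L M C S \<and> R = {rs \<in> power_set X n. rs @ ks \<in> S}))"

text \<open>The set of elements of the structure \<open>St\<^sub>C(M)\<close>.\<close>

definition St ::
  "('s, 'f, 'r) language \<Rightarrow> ('s, 'f, 'r, 'm) struct \<Rightarrow> 'm set \<Rightarrow> 'm list set set" where
  "St L M C = \<Union>{X. imaginary_set L M C X \<and> stable_set L M C X \<and> stably_embedded L M C X}"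


section \<open>Definable families of functions and germs\<close>

text \<open>An \<open>A\<close>-definable family, indexed by the set \<open>B\<close> of tuples of sorts \<open>us\<close>, of partial functions
  from tuples of sorts \<open>ss\<close> to tuples of sorts \<open>ts\<close>, each of which is defined on \<open>p\<close>.\<close>

definition definable_family_on ::
  "('s, 'f, 'r) language \<Rightarrow> ('s, 'f, 'r, 'm) struct \<Rightarrow> 'm set \<Rightarrow> 's list \<Rightarrow> 's list \<Rightarrow> 's list
    \<Rightarrow> (('s, 'f, 'r) formula \<times> 'm list) set \<Rightarrow> 'm list set \<Rightarrow> ('m list \<Rightarrow> 'm list \<rightharpoonup> 'm list) \<Rightarrow> bool" where
  "definable_family_on L M A us ss ts p B f \<longleftrightarrow>
     definable L M A us B \<and>
     (\<forall>b\<in>B. dom (f b) \<subseteq> tuples M ss \<and> ran (f b) \<subseteq> tuples M ts) \<and>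
     definable L M A (us @ ss @ ts) {b @ x @ y | b x y. b \<in> B \<and> f b x = Some y} \<and>
     (\<forall>b\<in>B. dom (f b) \<in> type_sets M ss p)"

definition germ_rel ::
  "('s, 'f, 'r, 'm) struct \<Rightarrow> 's list \<Rightarrow> (('s, 'f, 'r) formula \<times> 'm list) set
    \<Rightarrow> 'm list set \<Rightarrow> ('m list \<Rightarrow> 'm list \<rightharpoonup> 'm list) \<Rightarrow> ('m list \<times> 'm list) set" where
  "germ_rel M ss p B f =
     {(c1, c2) \<in> B \<times> B.
        {x \<in> tuples M ss. \<exists>y. f c1 x = Some y \<and> f c2 x = Some y} \<in> type_sets M ss p}"

definition germ ::
  "('s, 'f, 'r, 'm) struct \<Rightarrow> 's list \<Rightarrow> (('s, 'f, 'r) formula \<times> 'm list) set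
    \<Rightarrow> 'm list set \<Rightarrow> ('m list \<Rightarrow> 'm list \<rightharpoonup> 'm list) \<Rightarrow> 'm list \<Rightarrow> 'm list set" where
  "germ M ss p B f b = germ_rel M ss p B f `` {b}"

end

theory Submission
  imports Defs "HOL-Library.Ramsey"
begin

text \<open>
  Stability and stable embeddedness of \<open>\<Theta>\<close> are both read off from one finiteness property.  For a
  relation \<open>\<phi>(y, z)\<close>, consider binary trees whose nodes are arbitrary tuples \<open>z\<close> of the monster model
  and whose branches are realized by elements \<open>y\<close> of a set \<open>X\<close>.  If the height of such trees is
  bounded, then \<open>\<phi>\<close> has no long half graph on \<open>X\<close>, and each set \<open>{y \<in> X. \<phi>(y, z)}\<close> is definable
  with finitely many parameters from \<open>X\<close> (\<open>trace_definable\<close>, applied to the dual relation).  So it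
  is enough to bound the trees of every relation \<open>\<phi>(b, z)\<close> that depends on \<open>b\<close> only through the germ
  of \<open>f\<^sub>b\<close>, or on several such \<open>b\<close>: this is \<open>germ_trees_bounded\<close>.

  In a theory with NIP a stable set has bounded trees for all relations with tuples of the whole
  model, although stability speaks about the induced structure only (\<open>stable_set_imp_tree_bounded\<close>,
  by Ramsey's theorem).  Sets with this property are closed under finite unions and products
  (\<open>tree_bounded_prod\<close>).  For \<open>a\<close> realizing \<open>p\<close> over \<open>A\<close>, all values \<open>f\<^sub>b(a)\<close> lie in one such set, a
  finite union of stable sets found by compactness (\<open>value_set_tree_bounded\<close>).

  It remains to recover the germ of \<open>f\<^sub>b\<close> from finitely many values \<open>f\<^sub>b(a\<^sub>1), \<dots>, f\<^sub>b(a\<^sub>n)\<close> on a Morley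
  sequence of \<open>p\<close> over \<open>A b\<close>.  By NIP, in a long enough sequence the value at some place is fixed,
  given the type of \<open>b\<close> over the sequence, by the values at the other places
  (\<open>NIP_moving_bound\<close>).  If the values on an arbitrarily long sequence could agree without equality
  of germs, a Morley sequence could change from agreement to disagreement at any prescribed place;
  combined with the first fact this gives long half graphs between tuples of values and elements,
  contradicting the bound on trees (\<open>germ_determined\<close>).  By compactness finitely many \<open>n\<close>,
  together with finitely many formulas that single out the type of \<open>b\<close>, serve for all \<open>b\<close>
  (\<open>finite_determining_family\<close>).  A finite tree of \<open>\<phi>(b, z)\<close> is now carried, by evaluation on one
  Morley sequence over all the \<open>b\<close> that occur, to a tree on a product of sets of values, and these
  have bounded height.
\<close>

section \<open>Binary trees of a relation\<close>

text \<open>In \<open>tree h Z \<phi> V\<close> the inner nodes of a full binary tree of height \<open>h\<close> are labelled by elements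
  of \<open>Z\<close>, and each of its \<open>2\<^sup>h\<close> branches is realized by some \<open>y \<in> V\<close>, which satisfies \<open>\<phi> y z\<close> at a node
  \<open>z\<close> exactly if the branch takes the first turn there.  The least height without a tree is a local
  rank in the sense of Shelah.\<close>

primrec tree :: "nat \<Rightarrow> 'z set \<Rightarrow> ('y \<Rightarrow> 'z \<Rightarrow> bool) \<Rightarrow> 'y set \<Rightarrow> bool" where
  "tree 0 Z \<phi> V \<longleftrightarrow> V \<noteq> {}"
| "tree (Suc h) Z \<phi> V \<longleftrightarrow>
     (\<exists>z\<in>Z. tree h Z \<phi> {y \<in> V. \<phi> y z} \<and> tree h Z \<phi> {y \<in> V. \<not> \<phi> y z})"

lemma tree_transport:
  assumes "tree h Z \<phi> V" "\<And>y. y \<in> V \<Longrightarrow> g y \<in> V'" "\<And>z. z \<in> Z \<Longrightarrow> k z \<in> Z'"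
    and "\<And>y z. y \<in> V \<Longrightarrow> z \<in> Z \<Longrightarrow> \<psi> (g y) (k z) \<longleftrightarrow> \<phi> y z"
  shows "tree h Z' \<psi> V'"
  using assms
proof (induction h arbitrary: V V')
  case 0
  then show ?case by auto
next
  case (Suc h)
  from Suc.prems(1) obtain z where z: "z \<in> Z" "tree h Z \<phi> {y \<in> V. \<phi> y z}"
    "tree h Z \<phi> {y \<in> V. \<not> \<phi> y z}" by auto
  have "tree h Z' \<psi> {y \<in> V'. \<psi> y (k z)}"
    by (rule Suc.IH[OF z(2)]) (use Suc.prems z(1) in auto)
  moreover have "tree h Z' \<psi> {y \<in> V'. \<not> \<psi> y (k z)}"
    by (rule Suc.IH[OF z(3)]) (use Suc.prems z(1) in auto)
  ultimately show ?case using Suc.prems(3) z(1) by auto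
qed

lemma tree_mono: "tree h Z \<phi> V \<Longrightarrow> V \<subseteq> V' \<Longrightarrow> Z \<subseteq> Z' \<Longrightarrow> tree h Z' \<phi> V'"
  using tree_transport[of h Z \<phi> V "\<lambda>y. y" V' "\<lambda>z. z" Z' \<phi>] by blast

lemma tree_Suc_le: "tree (Suc h) Z \<phi> V \<Longrightarrow> tree h Z \<phi> V"
  by (auto intro: tree_mono)

lemma tree_le: "tree h Z \<phi> V \<Longrightarrow> k \<le> h \<Longrightarrow> tree k Z \<phi> V"
  by (induction h) (auto simp: le_Suc_eq simp del: tree.simps dest: tree_Suc_le)

lemma tree_nonempty: "tree h Z \<phi> V \<Longrightarrow> V \<noteq> {}"
  using tree_le[of h Z \<phi> V 0] by simp

lemma tree_finite: "tree h Z \<phi> V \<Longrightarrow> \<exists>V0\<subseteq>V. finite V0 \<and> tree h Z \<phi> V0"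
proof (induction h arbitrary: V)
  case 0
  then obtain y where "y \<in> V" by auto
  then show ?case by (intro exI[of _ "{y}"]) auto
next
  case (Suc h)
  from Suc.prems obtain z where z: "z \<in> Z" "tree h Z \<phi> {y \<in> V. \<phi> y z}"
    "tree h Z \<phi> {y \<in> V. \<not> \<phi> y z}" by auto
  from Suc.IH[OF z(2)] Suc.IH[OF z(3)] obtain V1 V2 where
    V: "V1 \<subseteq> {y \<in> V. \<phi> y z}" "finite V1" "tree h Z \<phi> V1"
       "V2 \<subseteq> {y \<in> V. \<not> \<phi> y z}" "finite V2" "tree h Z \<phi> V2" by blast
  have "tree h Z \<phi> {y \<in> V1 \<union> V2. \<phi> y z}" "tree h Z \<phi> {y \<in> V1 \<union> V2. \<not> \<phi> y z}"
    using V by (auto intro: tree_mono)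
  with V z(1) show ?case by (intro exI[of _ "V1 \<union> V2"]) auto
qed

text \<open>The root belongs to one of the two sets of nodes, and is put below the trees that the induction
  hypothesis finds in its two subtrees, unless one of these is already of the other kind.\<close>

lemma tree_split_nodes:
  "tree (m + k) (Z1 \<union> Z2) \<phi> V \<Longrightarrow> tree m Z1 \<phi> V \<or> tree k Z2 \<phi> V"
proof (induction "m + k" arbitrary: m k V)
  case 0
  then show ?case by auto
next
  case (Suc n)
  show ?case
  proof (cases "m = 0 \<or> k = 0")
    case True
    then show ?thesis using tree_nonempty[OF Suc.prems] by auto
  next
    case False
    then obtain m' k' where mk: "m = Suc m'" "k = Suc k'" by (metis not0_implies_Suc)
    with Suc.hyps(2) have n: "n = m' + k" "n = m + k'" by auto
    from Suc.prems Suc.hyps(2)[symmetric] obtain z where z: "z \<in> Z1 \<union> Z2"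
      "tree n (Z1 \<union> Z2) \<phi> {y \<in> V. \<phi> y z}" "tree n (Z1 \<union> Z2) \<phi> {y \<in> V. \<not> \<phi> y z}" by auto
    have sub: "tree h Z \<phi> {y \<in> V. P y} \<Longrightarrow> tree h Z \<phi> V" for h Z P
      by (auto intro: tree_mono)
    from z(1) show ?thesis
    proof
      assume "z \<in> Z1"
      with Suc.hyps(1)[OF n(1) z(2)[unfolded n(1)]] Suc.hyps(1)[OF n(1) z(3)[unfolded n(1)]]
      show ?thesis unfolding mk(1) using sub by auto
    next
      assume "z \<in> Z2"
      with Suc.hyps(1)[OF n(2) z(2)[unfolded n(2)]] Suc.hyps(1)[OF n(2) z(3)[unfolded n(2)]]
      show ?thesis unfolding mk(2) using sub by auto
    qed
  qed
qed

lemma tree_split_leaves: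
  "tree (m + k) Z \<phi> (V1 \<union> V2) \<Longrightarrow> tree m Z \<phi> V1 \<or> tree k Z \<phi> V2"
proof (induction "m + k" arbitrary: m k V1 V2)
  case 0
  then show ?case by auto
next
  case (Suc n)
  have un: "{y \<in> V1 \<union> V2. P y} = {y \<in> V1. P y} \<union> {y \<in> V2. P y}" for P by auto
  have "tree (Suc n) Z \<phi> (V1 \<union> V2)" using Suc.prems Suc.hyps(2) by (simp only:)
  then obtain z where z: "z \<in> Z" "tree n Z \<phi> ({y \<in> V1. \<phi> y z} \<union> {y \<in> V2. \<phi> y z})"
    "tree n Z \<phi> ({y \<in> V1. \<not> \<phi> y z} \<union> {y \<in> V2. \<not> \<phi> y z})"
    by (auto simp only: tree.simps un)
  have sub: "tree h Z \<phi> {y \<in> V. P y} \<Longrightarrow> tree h Z \<phi> V" for h P V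
    by (auto intro: tree_mono)
  show ?case
  proof (cases m)
    case (Suc m')
    with Suc.hyps(2) have n: "n = m' + k" by auto
    from Suc.hyps(1)[OF n z(2)[unfolded n]] Suc.hyps(1)[OF n z(3)[unfolded n]]
    show ?thesis unfolding Suc using sub z(1) by auto
  next
    case 0
    show ?thesis
    proof (cases "V1 = {}")
      case True
      with 0 Suc.prems show ?thesis by auto
    qed (use 0 in auto)
  qed
qed

lemma tree_finite_Union:
  assumes "finite I" "\<And>i. i \<in> I \<Longrightarrow> \<exists>h. \<not> tree h Z \<phi> (V i)"
  shows "\<exists>h. \<not> tree h Z \<phi> (\<Union>i\<in>I. V i)"
  using assms
proof (induction I rule: finite_induct)
  case empty
  then show ?case by (intro exI[of _ 0]) simp
next
  case (insert i I)
  then obtain m k where "\<not> tree m Z \<phi> (V i)" "\<not> tree k Z \<phi> (\<Union>i\<in>I. V i)" by blast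
  then have "\<not> tree (m + k) Z \<phi> (V i \<union> (\<Union>i\<in>I. V i))" using tree_split_leaves by blast
  then show ?case by auto
qed

text \<open>A half graph gives a tree by binary search.\<close>

lemma ladder_imp_tree:
  fixes y :: "nat \<Rightarrow> 'y" and z :: "nat \<Rightarrow> 'z"
  assumes "\<And>i. i < 2 ^ h \<Longrightarrow> y i \<in> V \<and> z i \<in> Z"
    and "\<And>i j. i < 2 ^ h \<Longrightarrow> j < 2 ^ h \<Longrightarrow> \<phi> (y i) (z j) \<longleftrightarrow> i < j"
  shows "tree h Z \<phi> V"
  using assms
proof (induction h arbitrary: y z V)
  case 0
  then show ?case using "0.prems"(1)[of 0] by auto
next
  case (Suc h)
  let ?r = "2 ^ h :: nat"
  have "tree h Z \<phi> {v \<in> V. \<phi> v (z ?r)}"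
    by (rule Suc.IH[of y _ z]) (use Suc.prems in auto)
  moreover have "tree h Z \<phi> {v \<in> V. \<not> \<phi> v (z ?r)}"
    by (rule Suc.IH[of "\<lambda>i. y (i + ?r)" _ "\<lambda>i. z (i + ?r)"]) (use Suc.prems in auto)
  ultimately show ?case using Suc.prems(1)[of ?r] by auto
qed

text \<open>For the converse, pick a leaf \<open>y\<close>, keep the nodes on which \<open>\<phi> y\<close> is constant, and go to the
  side of the next root on which \<open>\<phi>\<close> takes the other value: then \<open>y\<close> and that root are the first,
  or the last, rung.  Splitting the nodes into two sets halves the height, and the root costs one more
  level.\<close>

primrec ladder_height :: "nat \<Rightarrow> nat" where
  "ladder_height 0 = 0"
| "ladder_height (Suc n) = 2 * ladder_height n + 2"

lemma tree_imp_ladder_off_diagonal: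
  assumes "tree (ladder_height n) Z \<phi> V"
  shows "\<exists>y z. (\<forall>i<n. y i \<in> V \<and> z i \<in> Z) \<and>
    (\<forall>i<n. \<forall>j<n. i \<noteq> j \<longrightarrow> (\<phi> (y i) (z j) \<longleftrightarrow> i < j))"
  using assms
proof (induction n arbitrary: Z V)
  case 0
  then show ?case by auto
next
  case (Suc n)
  let ?h = "ladder_height n"
  from tree_nonempty[OF Suc.prems] obtain y0 where y0: "y0 \<in> V" by auto
  have "ladder_height (Suc n) = Suc ?h + Suc ?h" by simp
  with Suc.prems have "tree (Suc ?h + Suc ?h) Z \<phi> V" by (simp only:)
  then have "tree (Suc ?h + Suc ?h) ({z \<in> Z. \<phi> y0 z} \<union> {z \<in> Z. \<not> \<phi> y0 z}) \<phi> V"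
    by (rule tree_mono) auto
  from tree_split_nodes[OF this] show ?case
  proof
    assume "tree (Suc ?h) {z \<in> Z. \<phi> y0 z} \<phi> V"
    then obtain z0 where z0: "z0 \<in> Z" "\<phi> y0 z0"
      "tree ?h {z \<in> Z. \<phi> y0 z} \<phi> {y \<in> V. \<not> \<phi> y z0}" by auto
    from Suc.IH[OF z0(3)] obtain y z where
      yz: "\<forall>i<n. y i \<in> V \<and> \<not> \<phi> (y i) z0 \<and> z i \<in> Z \<and> \<phi> y0 (z i)"
        "\<forall>i<n. \<forall>j<n. i \<noteq> j \<longrightarrow> (\<phi> (y i) (z j) \<longleftrightarrow> i < j)" by auto
    show ?thesis
      by (rule exI[of _ "case_nat y0 y"], rule exI[of _ "case_nat z0 z"])
         (use yz y0 z0 in \<open>auto split: nat.splits\<close>)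
  next
    assume "tree (Suc ?h) {z \<in> Z. \<not> \<phi> y0 z} \<phi> V"
    then obtain z0 where z0: "z0 \<in> Z" "\<not> \<phi> y0 z0"
      "tree ?h {z \<in> Z. \<not> \<phi> y0 z} \<phi> {y \<in> V. \<phi> y z0}" by auto
    from Suc.IH[OF z0(3)] obtain y z where
      yz: "\<forall>i<n. y i \<in> V \<and> \<phi> (y i) z0 \<and> z i \<in> Z \<and> \<not> \<phi> y0 (z i)"
        "\<forall>i<n. \<forall>j<n. i \<noteq> j \<longrightarrow> (\<phi> (y i) (z j) \<longleftrightarrow> i < j)" by auto
    show ?thesis
      by (rule exI[of _ "y(n := y0)"], rule exI[of _ "z(n := z0)"])
         (use yz y0 z0 in \<open>auto simp: less_Suc_eq\<close>)
  qed
qed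

text \<open>Places \<open>2 i + 1\<close> on one side and \<open>2 j\<close> on the other never coincide, so the half graph off the
  diagonal contains a genuine one of half its length.\<close>

lemma tree_imp_ladder:
  assumes "tree (ladder_height (2 * n)) Z \<phi> V"
  shows "\<exists>y z. (\<forall>i<n. y i \<in> V \<and> z i \<in> Z) \<and> (\<forall>i<n. \<forall>j<n. \<phi> (y i) (z j) \<longleftrightarrow> i < j)"
proof -
  from tree_imp_ladder_off_diagonal[OF assms] obtain y z where
    yz: "\<forall>i<2*n. y i \<in> V \<and> z i \<in> Z"
        "\<forall>i<2*n. \<forall>j<2*n. i \<noteq> j \<longrightarrow> (\<phi> (y i) (z j) \<longleftrightarrow> i < j)" by blast
  have "\<phi> (y (2 * i + 1)) (z (2 * j)) \<longleftrightarrow> i < j" if "i < n" "j < n" for i j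
  proof -
    have "2 * i + 1 < 2 * n" "2 * j < 2 * n" "2 * i + 1 \<noteq> 2 * j" using that by presburger+
    with yz(2) have "\<phi> (y (2 * i + 1)) (z (2 * j)) \<longleftrightarrow> 2 * i + 1 < 2 * j" by blast
    then show ?thesis by presburger
  qed
  then show ?thesis using yz(1)
    by (intro exI[of _ "\<lambda>i. y (2 * i + 1)"] exI[of _ "\<lambda>j. z (2 * j)"]) auto
qed

text \<open>Bounded trees are a symmetric condition on the two sides of a relation, since reversing
  and shifting a half graph gives a half graph of the dual relation.\<close>

lemma tree_dual:
  assumes "\<not> tree h Z \<phi> V"
  shows "\<exists>k. \<not> tree k V (\<lambda>z y. \<phi> y z) Z"
proof (rule ccontr)
  assume "\<not> ?thesis"
  then have "tree (ladder_height (2 * (2 ^ h + 1))) V (\<lambda>z y. \<phi> y z) Z" by blast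
  from tree_imp_ladder[OF this] obtain z y where
    zy: "\<forall>i<2^h+1::nat. z i \<in> Z \<and> y i \<in> V"
        "\<forall>i<2^h+1::nat. \<forall>j<2^h+1::nat. \<phi> (y j) (z i) \<longleftrightarrow> i < j" by blast
  have "tree h Z \<phi> V"
  proof (rule ladder_imp_tree)
    fix i :: nat assume "i < 2 ^ h"
    then show "y (2 ^ h - i) \<in> V \<and> z (2 ^ h - i) \<in> Z" using zy(1) by auto
  next
    fix i j :: nat assume "i < 2 ^ h" "j < 2 ^ h"
    then show "\<phi> (y (2 ^ h - i)) (z (2 ^ h - j)) \<longleftrightarrow> i < j" using zy(2) by auto
  qed
  with assms show False by blast
qed

text \<open>Definability of types: among the finite conditions satisfied by \<open>y\<close> choose one that cuts out
  a set of leaves whose trees are as small as possible.\<close>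

lemma trace_definable:
  assumes "\<not> tree h Z \<phi> V" "y \<in> V" "Z' \<subseteq> Z"
  shows "\<exists>qs k. fst ` set qs \<subseteq> Z' \<and>
    (\<forall>z\<in>Z'. \<phi> y z \<longleftrightarrow> tree k Z \<phi> {y' \<in> V. (\<forall>(q, s)\<in>set qs. \<phi> y' q \<longleftrightarrow> s) \<and> \<phi> y' z})"
proof -
  let ?W = "\<lambda>qs. {y' \<in> V. \<forall>(q, s)\<in>set qs. \<phi> y' q \<longleftrightarrow> s}"
  let ?ok = "\<lambda>qs. fst ` set qs \<subseteq> Z' \<and> (\<forall>(q, s)\<in>set qs. \<phi> y q \<longleftrightarrow> s)"
  let ?P = "\<lambda>k. \<exists>qs. ?ok qs \<and> \<not> tree (Suc k) Z \<phi> (?W qs)"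
  define k where "k = Least ?P"
  have "?P h" using assms(1) tree_Suc_le[of h Z \<phi> V] by (intro exI[of _ "[]"]) auto
  then have "?P k" unfolding k_def by (rule LeastI)
  then obtain qs where qs: "?ok qs" "\<not> tree (Suc k) Z \<phi> (?W qs)" by blast
  have full: "tree k Z \<phi> (?W qs')" if "?ok qs'" for qs'
  proof (cases k)
    case 0
    have "y \<in> ?W qs'" using that assms(2) by auto
    with 0 show ?thesis by auto
  next
    case (Suc k')
    then have "k' < Least ?P" unfolding k_def by simp
    then have "\<not> ?P k'" by (rule not_less_Least)
    with that Suc show ?thesis by blast
  qed
  have "\<phi> y z \<longleftrightarrow> tree k Z \<phi> {y' \<in> V. (\<forall>(q, s)\<in>set qs. \<phi> y' q \<longleftrightarrow> s) \<and> \<phi> y' z}"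
    if "z \<in> Z'" for z
  proof -
    have "?ok ((z, \<phi> y z) # qs)" using qs(1) that by auto
    from full[OF this]
    have t: "tree k Z \<phi> {y' \<in> ?W qs. \<phi> y' z \<longleftrightarrow> \<phi> y z}"
      by (rule tree_mono) auto
    have no: "\<not> (tree k Z \<phi> {y' \<in> ?W qs. \<phi> y' z} \<and> tree k Z \<phi> {y' \<in> ?W qs. \<not> \<phi> y' z})"
      using qs(2) that assms(3) by auto
    have e: "{y' \<in> V. (\<forall>(q, s)\<in>set qs. \<phi> y' q \<longleftrightarrow> s) \<and> \<phi> y' z} = {y' \<in> ?W qs. \<phi> y' z}"
      by auto
    show ?thesis unfolding e using t no by (cases "\<phi> y z") auto
  qed
  with qs(1) show ?thesis by blast
qed

section \<open>A calculus of definable predicates\<close>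

lemma tuples_length: "xs \<in> tuples M ss \<Longrightarrow> length xs = length ss"
  by (auto simp: tuples_def list_all2_lengthD)

lemma tuples_nth: "xs \<in> tuples M ss \<Longrightarrow> i < length ss \<Longrightarrow> xs ! i \<in> dom_of M (ss ! i)"
  by (auto simp: tuples_def list_all2_conv_all_nth)

lemma tuples_Nil [simp]: "xs \<in> tuples M [] \<longleftrightarrow> xs = []"
  by (auto simp: tuples_def)

lemma tuples_Cons [simp]: "x # xs \<in> tuples M (s # ss) \<longleftrightarrow> x \<in> dom_of M s \<and> xs \<in> tuples M ss"
  by (auto simp: tuples_def)

lemma tuples_append: "xs \<in> tuples M ss \<Longrightarrow> ys \<in> tuples M ts \<Longrightarrow> xs @ ys \<in> tuples M (ss @ ts)"
  by (auto simp: tuples_def intro: list_all2_appendI)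

lemma tuples_take: "zs \<in> tuples M (ss @ ts) \<Longrightarrow> take (length ss) zs \<in> tuples M ss"
  by (auto simp: tuples_def list_all2_append2 list_all2_lengthD)

lemma tuples_drop: "zs \<in> tuples M (ss @ ts) \<Longrightarrow> drop (length ss) zs \<in> tuples M ts"
  by (auto simp: tuples_def list_all2_append2 list_all2_lengthD)

lemma tuples_subset_points:
  assumes "xs \<in> tuples M ss"
  shows "set xs \<subseteq> points M"
proof
  fix x assume "x \<in> set xs"
  then obtain i where "i < length ss" "x = xs ! i"
    using tuples_length[OF assms] by (auto simp: in_set_conv_nth)
  with tuples_nth[OF assms] show "x \<in> points M" by (auto simp: points_def)
qed

lemma tuples_concat:
  assumes "\<And>i. i < n \<Longrightarrow> t i \<in> tuples M (u i)"
  shows "concat (map t [0..<n]) \<in> tuples M (concat (map u [0..<n]))"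
  using assms by (induction n) (auto intro: tuples_append)

primrec ren_term :: "(nat \<Rightarrow> nat) \<Rightarrow> 'f fo_term \<Rightarrow> 'f fo_term" where
  "ren_term r (Var i) = Var (r i)"
| "ren_term r (App f ts) = App f (map (ren_term r) ts)"

primrec ren :: "(nat \<Rightarrow> nat) \<Rightarrow> ('s, 'f, 'r) formula \<Rightarrow> ('s, 'f, 'r) formula" where
  "ren r Falsum = Falsum"
| "ren r (Equal t u) = Equal (ren_term r t) (ren_term r u)"
| "ren r (Rel R ts) = Rel R (map (ren_term r) ts)"
| "ren r (Neg \<phi>) = Neg (ren r \<phi>)"
| "ren r (Conj \<phi> \<psi>) = Conj (ren r \<phi>) (ren r \<psi>)"
| "ren r (Exists s \<phi>) = Exists s (ren (case_nat 0 (\<lambda>i. Suc (r i))) \<phi>)"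

lemma term_sort_ren:
  assumes "term_sort L ss t s" "\<And>i. i < length ss \<Longrightarrow> r i < length ss' \<and> ss' ! r i = ss ! i"
  shows "term_sort L ss' (ren_term r t) s"
  using assms(1)
proof (induction rule: term_sort.induct)
  case (term_sort_Var i)
  then show ?case using assms(2)[of i] term_sort.term_sort_Var[of "r i" ss' L] by simp
next
  case (term_sort_App f ts)
  then show ?case
    by (auto intro!: term_sort.term_sort_App simp: list_all2_conv_all_nth)
qed

lemma eval_ren:
  assumes "term_sort L ss t s" "\<And>i. i < length ss \<Longrightarrow> xs' ! r i = xs ! i"
  shows "eval_term M xs' (ren_term r t) = eval_term M xs t"
  using assms(1)
proof (induction rule: term_sort.induct)
  case (term_sort_App f ts)
  then have "map (eval_term M xs' \<circ> ren_term r) ts = map (eval_term M xs) ts"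
    by (auto simp: list_all2_conv_all_nth in_set_conv_nth)
  then show ?case by (simp del: map_eq_conv)
qed (use assms(2) in auto)

lemma wff_ren:
  assumes "wff L ss \<phi>" "\<And>i. i < length ss \<Longrightarrow> r i < length ss' \<and> ss' ! r i = ss ! i"
  shows "wff L ss' (ren r \<phi>)"
  using assms
proof (induction \<phi> arbitrary: ss ss' r)
  case (Equal t u)
  then show ?case by (auto intro: term_sort_ren)
next
  case (Rel R ts)
  have "term_sort L ss' (ren_term r t) s" if "term_sort L ss t s" for t s
    using that Rel.prems(2) by (rule term_sort_ren)
  with Rel.prems(1) show ?case by (auto simp: list_all2_conv_all_nth)
next
  case (Exists s \<phi>)
  have "wff L (s # ss') (ren (case_nat 0 (\<lambda>i. Suc (r i))) \<phi>)"
    by (rule Exists.IH[of "s # ss"]) (use Exists.prems in \<open>auto split: nat.splits\<close>)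
  then show ?case by simp
qed auto

lemma sat_ren:
  assumes "wff L ss \<phi>" "\<And>i. i < length ss \<Longrightarrow> xs' ! r i = xs ! i"
  shows "sat M xs' (ren r \<phi>) \<longleftrightarrow> sat M xs \<phi>"
  using assms
proof (induction \<phi> arbitrary: ss xs xs' r)
  case (Equal t u)
  then show ?case using eval_ren[of L ss _ _ xs' r xs M] by auto
next
  case (Rel R ts)
  have "eval_term M xs' (ren_term r t) = eval_term M xs t" if "term_sort L ss t s" for t s
    using that Rel.prems(2) by (rule eval_ren)
  then have "map (eval_term M xs' \<circ> ren_term r) ts = map (eval_term M xs) ts"
    using Rel.prems(1) by (fastforce simp: list_all2_conv_all_nth in_set_conv_nth)
  then show ?case by (simp del: map_eq_conv)
next
  case (Neg \<phi>)
  then show ?case by auto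
next
  case (Conj \<phi> \<psi>)
  then show ?case by (metis ren.simps(5) sat.simps(5) wff.simps(5))
next
  case (Exists s \<phi>)
  have "sat M (x # xs') (ren (case_nat 0 (\<lambda>i. Suc (r i))) \<phi>) \<longleftrightarrow> sat M (x # xs) \<phi>" for x
    by (rule Exists.IH[of "s # ss"]) (use Exists.prems in \<open>auto split: nat.splits\<close>)
  then show ?case by simp
qed auto

primrec exs :: "'s list \<Rightarrow> ('s, 'f, 'r) formula \<Rightarrow> ('s, 'f, 'r) formula" where
  "exs [] \<phi> = \<phi>"
| "exs (s # ss) \<phi> = exs ss (Exists s \<phi>)"

lemma wff_exs: "wff L (ts @ ss) \<phi> \<Longrightarrow> wff L ss (exs ts \<phi>)"
  by (induction ts arbitrary: \<phi>) auto

lemma sat_exs: "sat M xs (exs ts \<phi>) \<longleftrightarrow> (\<exists>ys\<in>tuples M ts. sat M (ys @ xs) \<phi>)"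
proof (induction ts arbitrary: \<phi>)
  case (Cons t ts)
  have "(\<exists>ys\<in>tuples M (t # ts). P ys) \<longleftrightarrow> (\<exists>ys\<in>tuples M ts. \<exists>y\<in>dom_of M t. P (y # ys))" for P
    by (auto simp: tuples_def list_all2_Cons2)
  with Cons show ?case by simp
qed simp

locale fo_structure =
  fixes L :: "('s, 'f, 'r) language" and M :: "('s, 'f, 'r, 'm) struct"
  assumes struct: "is_structure L M"
begin

lemma sort_unique: "x \<in> dom_of M s \<Longrightarrow> x \<in> dom_of M t \<Longrightarrow> s = t"
  using struct unfolding is_structure_def by blast

lemma tuples_unique: "xs \<in> tuples M ss \<Longrightarrow> xs \<in> tuples M ts \<Longrightarrow> ss = ts"
  by (rule nth_equalityI) (metis tuples_length, metis tuples_length tuples_nth sort_unique)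

text \<open>Definability is a property of predicates here, not of sets or formulas, so that it can be read off
  from the logical form of \<open>P\<close>, considered on tuples of sorts \<open>ss\<close>.\<close>

definition dfn :: "'m set \<Rightarrow> 's list \<Rightarrow> ('m list \<Rightarrow> bool) \<Rightarrow> bool" where
  "dfn C ss P \<longleftrightarrow> (\<exists>\<phi> cs ts. set cs \<subseteq> C \<and> cs \<in> tuples M ts \<and> wff L (ss @ ts) \<phi> \<and>
     (\<forall>xs\<in>tuples M ss. P xs \<longleftrightarrow> sat M (xs @ cs) \<phi>))"

lemma dfnI:
  "set cs \<subseteq> C \<Longrightarrow> cs \<in> tuples M ts \<Longrightarrow> wff L (ss @ ts) \<phi> \<Longrightarrow>
    (\<And>xs. xs \<in> tuples M ss \<Longrightarrow> P xs \<longleftrightarrow> sat M (xs @ cs) \<phi>) \<Longrightarrow> dfn C ss P"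
  unfolding dfn_def by blast

lemma dfnE:
  assumes "dfn C ss P"
  obtains \<phi> cs ts where "set cs \<subseteq> C" "cs \<in> tuples M ts" "wff L (ss @ ts) \<phi>"
    "\<And>xs. xs \<in> tuples M ss \<Longrightarrow> P xs \<longleftrightarrow> sat M (xs @ cs) \<phi>"
  using assms unfolding dfn_def by blast

lemma definable_iff_dfn:
  "definable L M C ss X \<longleftrightarrow> X \<subseteq> tuples M ss \<and> dfn C ss (\<lambda>x. x \<in> X)"
  unfolding definable_def formulas_over_def dfn_def solutions_def by blast

lemma dfn_imp_definable: "dfn C ss P \<Longrightarrow> definable L M C ss {x \<in> tuples M ss. P x}"
  unfolding definable_iff_dfn dfn_def by auto

lemma dfn_cong:
  assumes "dfn C ss P" "\<And>x. x \<in> tuples M ss \<Longrightarrow> P x \<longleftrightarrow> Q x"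
  shows "dfn C ss Q"
  using assms unfolding dfn_def by metis

lemma dfn_mono: "dfn C ss P \<Longrightarrow> C \<subseteq> D \<Longrightarrow> dfn D ss P"
  unfolding dfn_def by blast

lemma dfn_params:
  assumes "dfn C (ss @ ts) P" "cs \<in> tuples M ts" "set cs \<subseteq> C"
  shows "dfn C ss (\<lambda>x. P (x @ cs))"
proof -
  from assms(1) obtain \<phi> ds us where "set ds \<subseteq> C" "ds \<in> tuples M us" "wff L ((ss @ ts) @ us) \<phi>"
    "\<forall>xs\<in>tuples M (ss @ ts). P xs \<longleftrightarrow> sat M (xs @ ds) \<phi>" unfolding dfn_def by blast
  moreover have "P (x @ cs) \<longleftrightarrow> sat M (x @ cs @ ds) \<phi>" if "x \<in> tuples M ss" for x
    using calculation(4) tuples_append[OF that assms(2)] by simp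
  ultimately show ?thesis using assms(2,3)
    by (intro dfnI[of "cs @ ds" C "ts @ us" ss \<phi>]) (simp_all add: tuples_append)
qed

lemma dfn_finite_params:
  assumes "dfn C ss P"
  shows "\<exists>Q ts cs. set cs \<subseteq> C \<and> cs \<in> tuples M ts \<and> dfn {} (ss @ ts) Q \<and>
    (\<forall>x\<in>tuples M ss. P x \<longleftrightarrow> Q (x @ cs))"
proof -
  from assms obtain \<phi> cs ts where "set cs \<subseteq> C" "cs \<in> tuples M ts" "wff L (ss @ ts) \<phi>"
    "\<forall>xs\<in>tuples M ss. P xs \<longleftrightarrow> sat M (xs @ cs) \<phi>" unfolding dfn_def by blast
  moreover have "dfn {} (ss @ ts) (\<lambda>e. sat M e \<phi>)"
    by (rule dfnI[of "[]" _ "[]" _ \<phi>]) (use calculation in auto)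
  ultimately show ?thesis by blast
qed

lemma dfn_vars:
  assumes "dfn C us P" "length js = length us"
    "\<And>j. j < length us \<Longrightarrow> js ! j < length ss \<and> ss ! (js ! j) = us ! j"
  shows "dfn C ss (\<lambda>xs. P (map ((!) xs) js))"
proof -
  from assms(1) obtain \<phi> cs ts where p: "set cs \<subseteq> C" "cs \<in> tuples M ts" "wff L (us @ ts) \<phi>"
    "\<forall>xs\<in>tuples M us. P xs \<longleftrightarrow> sat M (xs @ cs) \<phi>" unfolding dfn_def by blast
  define r where "r i = (if i < length us then js ! i else i - length us + length ss)" for i
  have w: "wff L (ss @ ts) (ren r \<phi>)"
    by (rule wff_ren[OF p(3)]) (use assms(2,3) in \<open>auto simp: r_def nth_append trans_less_add1\<close>)
  have "P (map ((!) xs) js) \<longleftrightarrow> sat M (xs @ cs) (ren r \<phi>)" if xs: "xs \<in> tuples M ss" for xs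
  proof -
    have t: "map ((!) xs) js \<in> tuples M us"
      using assms(2,3) tuples_nth[OF xs] unfolding tuples_def
      by (auto simp: list_all2_conv_all_nth) metis
    have "sat M (xs @ cs) (ren r \<phi>) \<longleftrightarrow> sat M (map ((!) xs) js @ cs) \<phi>"
      by (rule sat_ren[OF p(3)])
         (use assms(2,3) tuples_length[OF xs] tuples_length[OF p(2)] in
           \<open>auto simp: r_def nth_append\<close>)
    with p(4) t show ?thesis by simp
  qed
  then show ?thesis by (rule dfnI[OF p(1,2) w])
qed

lemma dfn_conj:
  assumes "dfn C ss P" "dfn C ss Q"
  shows "dfn C ss (\<lambda>x. P x \<and> Q x)"
proof -
  from assms(1) obtain \<phi> cs ts where p: "set cs \<subseteq> C" "cs \<in> tuples M ts" "wff L (ss @ ts) \<phi>"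
    "\<forall>xs\<in>tuples M ss. P xs \<longleftrightarrow> sat M (xs @ cs) \<phi>" unfolding dfn_def by blast
  from assms(2) obtain \<psi> ds us where q: "set ds \<subseteq> C" "ds \<in> tuples M us" "wff L (ss @ us) \<psi>"
    "\<forall>xs\<in>tuples M ss. Q xs \<longleftrightarrow> sat M (xs @ ds) \<psi>" unfolding dfn_def by blast
  define r where "r i = (if i < length ss then i else i + length ts)" for i
  have w1: "wff L (ss @ ts @ us) (ren (\<lambda>i. i) \<phi>)"
    by (rule wff_ren[OF p(3)]) (auto simp: nth_append)
  have w2: "wff L (ss @ ts @ us) (ren r \<psi>)"
    by (rule wff_ren[OF q(3)]) (auto simp: nth_append r_def)
  have "P xs \<and> Q xs \<longleftrightarrow> sat M (xs @ cs @ ds) (Conj (ren (\<lambda>i. i) \<phi>) (ren r \<psi>))"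
    if xs: "xs \<in> tuples M ss" for xs
  proof -
    have "sat M (xs @ cs @ ds) (ren (\<lambda>i. i) \<phi>) \<longleftrightarrow> sat M (xs @ cs) \<phi>"
      by (rule sat_ren[OF p(3)])
         (use tuples_length[OF xs] tuples_length[OF p(2)] in \<open>auto simp: nth_append\<close>)
    moreover have "sat M (xs @ cs @ ds) (ren r \<psi>) \<longleftrightarrow> sat M (xs @ ds) \<psi>"
      by (rule sat_ren[OF q(3)])
         (use tuples_length[OF xs] tuples_length[OF p(2)] in \<open>auto simp: nth_append r_def\<close>)
    ultimately show ?thesis using p(4) q(4) xs by simp
  qed
  then show ?thesis
    by (rule dfnI[rotated 3]) (use p q w1 w2 in \<open>auto intro: tuples_append\<close>)
qed

lemma dfn_neg: "dfn C ss P \<Longrightarrow> dfn C ss (\<lambda>x. \<not> P x)"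
  by (erule dfnE) (rule dfnI[where \<phi> = "Neg _"], auto)

lemma dfn_const: "dfn C ss (\<lambda>_. b)"
proof (cases b)
  case True
  then show ?thesis by (intro dfnI[of "[]" C "[]" ss "Neg Falsum"]) auto
next
  case False
  then show ?thesis by (intro dfnI[of "[]" C "[]" ss Falsum]) auto
qed

lemma dfn_disj:
  assumes "dfn C ss P" "dfn C ss Q"
  shows "dfn C ss (\<lambda>x. P x \<or> Q x)"
proof -
  have "dfn C ss (\<lambda>x. \<not> (\<not> P x \<and> \<not> Q x))" by (intro dfn_neg dfn_conj assms)
  then show ?thesis by simp
qed

lemma dfn_imp:
  assumes "dfn C ss P" "dfn C ss Q"
  shows "dfn C ss (\<lambda>x. P x \<longrightarrow> Q x)"
proof -
  have "dfn C ss (\<lambda>x. \<not> P x \<or> Q x)" by (intro dfn_neg dfn_disj assms)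
  then show ?thesis by (simp only: imp_conv_disj)
qed

lemma dfn_iff:
  assumes "dfn C ss P" "dfn C ss Q"
  shows "dfn C ss (\<lambda>x. P x \<longleftrightarrow> Q x)"
proof -
  have "dfn C ss (\<lambda>x. (P x \<longrightarrow> Q x) \<and> (Q x \<longrightarrow> P x))" by (intro dfn_conj dfn_imp assms)
  then show ?thesis by (simp only: iff_conv_conj_imp)
qed

lemma dfn_ball_finite:
  "finite I \<Longrightarrow> (\<And>i. i \<in> I \<Longrightarrow> dfn C ss (P i)) \<Longrightarrow> dfn C ss (\<lambda>x. \<forall>i\<in>I. P i x)"
  by (induction I rule: finite_induct) (auto intro: dfn_const dfn_conj)

lemma dfn_all_less:
  fixes n :: nat
  assumes "\<And>i. i < n \<Longrightarrow> dfn C ss (P i)"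
  shows "dfn C ss (\<lambda>x. \<forall>i<n. P i x)"
proof -
  have "dfn C ss (\<lambda>x. \<forall>i\<in>{..<n}. P i x)" by (rule dfn_ball_finite) (use assms in auto)
  then show ?thesis by (simp only: Ball_def lessThan_iff)
qed

lemma dfn_ex:
  assumes "dfn C (ts @ ss) (\<lambda>e. P (drop (length ts) e) (take (length ts) e))"
  shows "dfn C ss (\<lambda>x. \<exists>y\<in>tuples M ts. P x y)"
proof -
  from assms obtain \<phi> cs us where p: "set cs \<subseteq> C" "cs \<in> tuples M us" "wff L ((ts @ ss) @ us) \<phi>"
    "\<forall>e\<in>tuples M (ts @ ss). P (drop (length ts) e) (take (length ts) e) \<longleftrightarrow> sat M (e @ cs) \<phi>"
    unfolding dfn_def by blast
  have *: "(\<exists>y\<in>tuples M ts. P x y) \<longleftrightarrow> sat M (x @ cs) (exs ts \<phi>)" if x: "x \<in> tuples M ss" for x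
    unfolding sat_exs
  proof (rule bex_cong[OF refl])
    fix y assume y: "y \<in> tuples M ts"
    show "P x y = sat M (y @ x @ cs) \<phi>"
      using p(4)[rule_format, OF tuples_append[OF y x]] tuples_length[OF y] by simp
  qed
  have "wff L (ss @ us) (exs ts \<phi>)" using p(3) by (intro wff_exs) simp
  from dfnI[OF p(1,2) this *] show ?thesis .
qed

lemma dfn_all:
  assumes "dfn C (ts @ ss) (\<lambda>e. P (drop (length ts) e) (take (length ts) e))"
  shows "dfn C ss (\<lambda>x. \<forall>y\<in>tuples M ts. P x y)"
proof -
  have "dfn C ss (\<lambda>x. \<not> (\<exists>y\<in>tuples M ts. \<not> P x y))" by (intro dfn_neg dfn_ex assms)
  then show ?thesis by simp
qed

text \<open>The maps that can be substituted in definable predicates without function symbols: each coordinate of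
  the value is a coordinate of the argument or a constant in \<open>C\<close>.\<close>

definition item :: "'m set \<Rightarrow> 's list \<Rightarrow> nat + 'm \<Rightarrow> 's \<Rightarrow> bool" where
  "item C ss j u \<longleftrightarrow>
     (case j of Inl i \<Rightarrow> i < length ss \<and> ss ! i = u | Inr c \<Rightarrow> c \<in> C \<and> c \<in> dom_of M u)"

definition tm :: "'m set \<Rightarrow> 's list \<Rightarrow> ('m list \<Rightarrow> 'm list) \<Rightarrow> 's list \<Rightarrow> bool" where
  "tm C ss t us \<longleftrightarrow> (\<exists>js. list_all2 (item C ss) js us \<and>
     (\<forall>xs\<in>tuples M ss. t xs = map (case_sum ((!) xs) (\<lambda>c. c)) js))"

lemma map_nth_append: "\<forall>j\<in>set js. j < length xs \<Longrightarrow> map ((!) (xs @ ys)) js = map ((!) xs) js"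
  by (simp add: nth_append)

text \<open>The constants picked by a map as in \<open>tm\<close> are collected in a parameter tuple \<open>ks\<close>, so that the map
  only selects entries of \<open>xs @ ks\<close>.\<close>

lemma items_split:
  assumes "list_all2 (item C ss) its us"
  shows "\<exists>ks ws js. ks \<in> tuples M ws \<and> set ks \<subseteq> C \<and>
    (\<forall>j\<in>set js. j < length (ss @ ws)) \<and> map ((!) (ss @ ws)) js = us \<and>
    (\<forall>xs\<in>tuples M ss. map (case_sum ((!) xs) (\<lambda>c. c)) its = map ((!) (xs @ ks)) js)"
  using assms
proof (induction its us)
  case Nil
  show ?case by (intro exI[of _ "[]"]) simp
next
  case (Cons it its u us)
  then obtain ks ws js where k: "ks \<in> tuples M ws" "set ks \<subseteq> C"
    "\<forall>j\<in>set js. j < length (ss @ ws)" "map ((!) (ss @ ws)) js = us"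
    "\<forall>xs\<in>tuples M ss. map (case_sum ((!) xs) (\<lambda>c. c)) its = map ((!) (xs @ ks)) js" by blast
  show ?case
  proof (cases it)
    case (Inl i)
    with Cons.hyps(1) have i: "i < length ss" "ss ! i = u" by (auto simp: item_def)
    then have "(xs @ ks) ! i = xs ! i" if "xs \<in> tuples M ss" for xs
      using tuples_length[OF that] by (simp add: nth_append)
    with k(5) Inl have "\<forall>xs\<in>tuples M ss. map (case_sum ((!) xs) (\<lambda>c. c)) (it # its) =
      map ((!) (xs @ ks)) (i # js)" by simp
    moreover have "(ss @ ws) ! i = u" using i by (simp add: nth_append)
    with k(4) have "map ((!) (ss @ ws)) (i # js) = u # us" by simp
    moreover have "\<forall>j\<in>set (i # js). j < length (ss @ ws)" using k(3) i by simp
    ultimately show ?thesis using k(1,2) by - (intro exI conjI; assumption)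
  next
    case (Inr c)
    with Cons.hyps(1) have c: "c \<in> C" "c \<in> dom_of M u" by (auto simp: item_def)
    have t: "ks @ [c] \<in> tuples M (ws @ [u])" using k(1) c by (auto intro: tuples_append)
    have e1: "map ((!) ((ss @ ws) @ [u])) js = us"
      using map_nth_append[OF k(3), of "[u]"] k(4) by simp
    have e2: "map ((!) ((xs @ ks) @ [c])) js = map ((!) (xs @ ks)) js"
      "((xs @ ks) @ [c]) ! length (ss @ ws) = c" if "xs \<in> tuples M ss" for xs
    proof -
      have l: "length (xs @ ks) = length (ss @ ws)"
        using tuples_length[OF that] tuples_length[OF k(1)] by simp
      show "map ((!) ((xs @ ks) @ [c])) js = map ((!) (xs @ ks)) js"
        by (rule map_nth_append) (use k(3) l in simp)
      show "((xs @ ks) @ [c]) ! length (ss @ ws) = c"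
        unfolding l[symmetric] by (rule nth_append_length)
    qed
    have "((ss @ ws) @ [u]) ! length (ss @ ws) = u" by (rule nth_append_length)
    with e1 have "map ((!) (ss @ ws @ [u])) (length (ss @ ws) # js) = u # us" by simp
    moreover have "\<forall>xs\<in>tuples M ss. map (case_sum ((!) xs) (\<lambda>c. c)) (it # its) =
      map ((!) (xs @ ks @ [c])) (length (ss @ ws) # js)"
      using k(5) e2 Inr by (simp del: length_append)
    moreover have "\<forall>j\<in>set (length (ss @ ws) # js). j < length (ss @ ws @ [u])"
      using k(3) by auto
    moreover have "set (ks @ [c]) \<subseteq> C" using k(2) c by simp
    ultimately show ?thesis using t by - (intro exI conjI; assumption)
  qed
qed

lemma dfn_tm:
  assumes "dfn C us P" "tm C ss t us"
  shows "dfn C ss (\<lambda>x. P (t x))"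
proof -
  from assms(2) obtain its where its: "list_all2 (item C ss) its us"
    "\<forall>xs\<in>tuples M ss. t xs = map (case_sum ((!) xs) (\<lambda>c. c)) its" unfolding tm_def by blast
  from items_split[OF its(1)] obtain ks ws js where
    k: "ks \<in> tuples M ws" "set ks \<subseteq> C"
    "\<forall>j\<in>set js. j < length (ss @ ws)" "map ((!) (ss @ ws)) js = us"
    "\<forall>xs\<in>tuples M ss. map (case_sum ((!) xs) (\<lambda>c. c)) its = map ((!) (xs @ ks)) js" by blast
  have "dfn C (ss @ ws) (\<lambda>xs. P (map ((!) xs) js))"
    by (rule dfn_vars[OF assms(1)]) (use k(3,4) in auto)
  from dfn_params[OF this k(1,2)] show ?thesis
    by (rule dfn_cong) (use k(5) its(2) in simp)
qed

lemma tm_range: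
  assumes "tm C ss t us" "x \<in> tuples M ss"
  shows "t x \<in> tuples M us"
proof -
  from assms(1) obtain its where its: "list_all2 (item C ss) its us"
    "\<forall>xs\<in>tuples M ss. t xs = map (case_sum ((!) xs) (\<lambda>c. c)) its" unfolding tm_def by blast
  have "case_sum ((!) x) (\<lambda>c. c) (its ! i) \<in> dom_of M (us ! i)" if "i < length us" for i
  proof (cases "its ! i")
    case (Inl k)
    with list_all2_nthD2[OF its(1) that] have "k < length ss" "ss ! k = us ! i"
      by (auto simp: item_def)
    with Inl tuples_nth[OF assms(2), of k] show ?thesis by simp
  next
    case (Inr c)
    with list_all2_nthD2[OF its(1) that] show ?thesis by (auto simp: item_def)
  qed
  moreover have "length its = length us" using its(1) by (rule list_all2_lengthD)
  moreover have "t x = map (case_sum ((!) x) (\<lambda>c. c)) its" using its(2) assms(2) by blast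
  ultimately show ?thesis unfolding tuples_def list_all2_conv_all_nth by simp
qed

lemma tmI:
  "list_all2 (item C ss) js us \<Longrightarrow>
    (\<And>xs. xs \<in> tuples M ss \<Longrightarrow> t xs = map (case_sum ((!) xs) (\<lambda>c. c)) js) \<Longrightarrow> tm C ss t us"
  unfolding tm_def by blast

lemma tmE:
  assumes "tm C ss t us"
  obtains js where "list_all2 (item C ss) js us"
    "\<And>xs. xs \<in> tuples M ss \<Longrightarrow> t xs = map (case_sum ((!) xs) (\<lambda>c. c)) js"
  using assms unfolding tm_def by blast

lemma tm_cong:
  assumes "tm C ss t us" "\<And>x. x \<in> tuples M ss \<Longrightarrow> t x = t' x"
  shows "tm C ss t' us"
  using assms(1)
proof (rule tmE)
  fix js assume "list_all2 (item C ss) js us"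
    "\<And>xs. xs \<in> tuples M ss \<Longrightarrow> t xs = map (case_sum ((!) xs) (\<lambda>c. c)) js"
  then show ?thesis using assms(2) by (intro tmI) (assumption, metis)
qed

lemma tm_const: "c \<in> tuples M us \<Longrightarrow> set c \<subseteq> C \<Longrightarrow> tm C ss (\<lambda>_. c) us"
  by (rule tmI[of C ss "map Inr c"])
     (auto simp: tuples_def list_all2_conv_all_nth item_def comp_def)

lemma tm_slice:
  "tm C (ss1 @ ss2 @ ss3) (\<lambda>x. take (length ss2) (drop (length ss1) x)) ss2"
proof (rule tmI)
  let ?js = "map (\<lambda>i. Inl (length ss1 + i)) [0..<length ss2]"
  show "list_all2 (item C (ss1 @ ss2 @ ss3)) ?js ss2"
    by (auto simp: list_all2_conv_all_nth item_def nth_append)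
  show "take (length ss2) (drop (length ss1) x) = map (case_sum ((!) x) (\<lambda>c. c)) ?js"
    if "x \<in> tuples M (ss1 @ ss2 @ ss3)" for x
    by (rule nth_equalityI) (use tuples_length[OF that] in simp_all)
qed

lemma tm_take: "tm C (ts @ ss) (\<lambda>x. take (length ts) x) ts"
  using tm_slice[of C "[]" ts ss] by simp

lemma tm_id: "tm C ss (\<lambda>x. x) ss"
  by (rule tm_cong[OF tm_take[of C ss "[]", simplified]]) (auto dest: tuples_length)

lemma tm_drop_id: "tm C (ts @ ss) (\<lambda>x. drop (length ts) x) ss"
  by (rule tm_cong[OF tm_slice[of C ts ss "[]", simplified]]) (auto dest: tuples_length)

lemma tm_comp:
  assumes "tm C ss t us" "tm C us t' vs"
  shows "tm C ss (\<lambda>x. t' (t x)) vs"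
proof -
  from assms(1) obtain its where its: "list_all2 (item C ss) its us"
    "\<forall>xs\<in>tuples M ss. t xs = map (case_sum ((!) xs) (\<lambda>c. c)) its" unfolding tm_def by blast
  from assms(2) obtain jts where jts: "list_all2 (item C us) jts vs"
    "\<forall>xs\<in>tuples M us. t' xs = map (case_sum ((!) xs) (\<lambda>c. c)) jts" unfolding tm_def by blast
  have i: "length its = length us" "\<And>i. i < length us \<Longrightarrow> item C ss (its ! i) (us ! i)"
    using its(1) by (auto simp: list_all2_conv_all_nth)
  let ?js = "map (case_sum ((!) its) Inr) jts"
  have "list_all2 (item C ss) ?js vs"
    unfolding list_all2_map1
  proof (rule list_all2_mono[OF jts(1)])
    fix j v assume "item C us j v"
    then show "item C ss (case_sum ((!) its) Inr j) v"
      using i(2) by (cases j) (auto simp: item_def[of C us] item_def[of C ss "Inr _"])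
  qed
  moreover have "t' (t x) = map (case_sum ((!) x) (\<lambda>c. c)) ?js" if x: "x \<in> tuples M ss" for x
  proof -
    have "case_sum ((!) (map (case_sum ((!) x) (\<lambda>c. c)) its)) (\<lambda>c. c) j =
      case_sum ((!) x) (\<lambda>c. c) (case_sum ((!) its) Inr j)" if "j \<in> set jts" for j
    proof -
      from that obtain k where "k < length jts" "j = jts ! k" by (auto simp: in_set_conv_nth)
      with jts(1) have "item C us j (vs ! k)" by (auto simp: list_all2_conv_all_nth)
      then show ?thesis using i(1) by (cases j) (auto simp: item_def)
    qed
    moreover have "t' (t x) = map (case_sum ((!) (t x)) (\<lambda>c. c)) jts"
      using jts(2) tm_range[OF assms(1) x] by blast
    moreover have "t x = map (case_sum ((!) x) (\<lambda>c. c)) its" using its(2) x by blast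
    ultimately show ?thesis by simp
  qed
  ultimately show ?thesis by (rule tmI)
qed

lemma tm_drop: "tm C ss t us \<Longrightarrow> tm C (ts @ ss) (\<lambda>x. t (drop (length ts) x)) us"
  by (rule tm_comp[OF tm_drop_id])

lemma tm_take_left: "tm C ts t us \<Longrightarrow> tm C (ts @ ss) (\<lambda>x. t (take (length ts) x)) us"
  by (rule tm_comp[OF tm_take])

lemma tm_append: "tm C ss t us \<Longrightarrow> tm C ss t' vs \<Longrightarrow> tm C ss (\<lambda>x. t x @ t' x) (us @ vs)"
  by (elim tmE) (rule tmI, erule (1) list_all2_appendI, simp)

lemma tm_concat:
  assumes "\<And>i. i < n \<Longrightarrow> tm C ss (t i) (u i)"
  shows "tm C ss (\<lambda>x. concat (map (\<lambda>i. t i x) [0..<n])) (concat (map u [0..<n]))"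
  using assms by (induction n) (auto intro: tm_append tm_const)

lemma tm_cover:
  assumes "cs \<in> tuples M ts" "set cs \<subseteq> C \<union> set z" "z \<in> tuples M zs"
  shows "\<exists>t. tm C zs t ts \<and> t z = cs"
proof -
  have ex: "\<exists>it. item C zs it (ts ! i) \<and> case_sum ((!) z) (\<lambda>c. c) it = cs ! i"
    if i: "i < length ts" for i
  proof (cases "cs ! i \<in> C")
    case True
    then show ?thesis using tuples_nth[OF assms(1) i]
      by (intro exI[of _ "Inr (cs ! i)"]) (simp add: item_def)
  next
    case False
    have "cs ! i \<in> set cs" using i tuples_length[OF assms(1)] by simp
    with False assms(2) have "cs ! i \<in> set z" by blast
    then obtain k where k: "k < length z" "z ! k = cs ! i" by (auto simp: in_set_conv_nth)
    with tuples_nth[OF assms(3), of k] tuples_length[OF assms(3)] tuples_nth[OF assms(1) i]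
    have "zs ! k = ts ! i" by (auto intro: sort_unique)
    with k tuples_length[OF assms(3)] show ?thesis
      by (intro exI[of _ "Inl k"]) (simp add: item_def)
  qed
  then obtain it where it: "\<And>i. i < length ts \<Longrightarrow> item C zs (it i) (ts ! i)"
    "\<And>i. i < length ts \<Longrightarrow> case_sum ((!) z) (\<lambda>c. c) (it i) = cs ! i" by metis
  let ?its = "map it [0..<length ts]"
  have "tm C zs (\<lambda>xs. map (case_sum ((!) xs) (\<lambda>c. c)) ?its) ts"
    by (rule tmI[where js = ?its]) (use it(1) in \<open>auto simp: list_all2_conv_all_nth\<close>)
  moreover have "map (case_sum ((!) z) (\<lambda>c. c)) ?its = cs"
    by (rule nth_equalityI) (use it(2) tuples_length[OF assms(1)] in simp_all)
  ultimately show ?thesis by blast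
qed

text \<open>Parameters from \<open>z\<close> are replaced by variables.\<close>

lemma dfn_cover:
  assumes "dfn (C \<union> set z) ss P" "z \<in> tuples M zs"
  shows "\<exists>Q. dfn C (ss @ zs) (\<lambda>e. Q (take (length ss) e) (drop (length ss) e)) \<and>
    (\<forall>x\<in>tuples M ss. P x \<longleftrightarrow> Q x z)"
proof -
  from dfn_finite_params[OF assms(1)] obtain Q ts cs where
    q: "set cs \<subseteq> C \<union> set z" "cs \<in> tuples M ts" "dfn {} (ss @ ts) Q"
       "\<forall>x\<in>tuples M ss. P x \<longleftrightarrow> Q (x @ cs)" by blast
  from tm_cover[OF q(2,1) assms(2)] obtain t where t: "tm C zs t ts" "t z = cs" by blast
  have "dfn C (ss @ zs) (\<lambda>e. Q (take (length ss) e @ t (drop (length ss) e)))"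
    by (rule dfn_tm[OF dfn_mono[OF q(3)]]) (simp, intro tm_append tm_take tm_drop t(1))
  with q(4) t(2) show ?thesis by (intro exI[of _ "\<lambda>x z. Q (x @ t z)"]) auto
qed

lemma dfn_nth_eq:
  assumes "i < length ss" "j < length ss" "ss ! i = ss ! j"
  shows "dfn C ss (\<lambda>x. x ! i = x ! j)"
proof -
  have "term_sort L ss (Var i) (ss ! i)" "term_sort L ss (Var j) (ss ! i)"
    using term_sort_Var[of i ss L] term_sort_Var[of j ss L] assms by auto
  then have "wff L ss (Equal (Var i) (Var j))" by auto
  then show ?thesis using assms tuples_length
    by (intro dfnI[of "[]" C "[]" ss "Equal (Var i) (Var j)"]) (auto simp: nth_append)
qed

lemma dfn_eq:
  assumes "tm C ss t us" "tm C ss t' us"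
  shows "dfn C ss (\<lambda>x. t x = t' x)"
proof -
  have "dfn C (us @ us) (\<lambda>e. \<forall>i<length us. e ! i = e ! (length us + i))"
    by (rule dfn_all_less, rule dfn_nth_eq) (auto simp: nth_append)
  from dfn_tm[OF this tm_append[OF assms]] show ?thesis
  proof (rule dfn_cong)
    fix x assume x: "x \<in> tuples M ss"
    have l: "length (t x) = length us" "length (t' x) = length us"
      using tm_range[OF assms(1) x] tm_range[OF assms(2) x] by (auto dest: tuples_length)
    then show "(\<forall>i<length us. (t x @ t' x) ! i = (t x @ t' x) ! (length us + i)) \<longleftrightarrow> t x = t' x"
      by (auto simp: nth_append intro: nth_equalityI)
  qed
qed

lemma dfn_mem:
  assumes "definable L M C us X" "tm C ss t us"
  shows "dfn C ss (\<lambda>x. t x \<in> X)"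
  by (rule dfn_tm[OF _ assms(2)]) (use assms(1) in \<open>simp add: definable_iff_dfn\<close>)

text \<open>Over a list of sorts other than that of \<open>X\<close>, membership in \<open>X\<close> is constantly false, since distinct
  sorts are disjoint.\<close>

lemma dfn_mem_any:
  assumes "definable L M C us X"
  shows "dfn C ss (\<lambda>x. x \<in> X)"
proof (cases "us = ss")
  case True
  with assms show ?thesis by (simp add: definable_iff_dfn)
next
  case False
  from assms have X: "X \<subseteq> tuples M us" by (simp add: definable_iff_dfn)
  have "x \<notin> X" if "x \<in> tuples M ss" for x
    using subsetD[OF X, of x] tuples_unique[OF that, of us] False by auto
  then show ?thesis by (intro dfn_cong[OF dfn_const[of C ss False]]) simp
qed

end

section \<open>Compactness and homogeneity of the monster model\<close>

context fo_structure begin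

lemma eval_term_sort:
  assumes "term_sort L ss t s" "xs \<in> tuples M ss"
  shows "eval_term M xs t \<in> dom_of M s"
  using assms(1)
proof (induction rule: term_sort.induct)
  case (term_sort_Var i)
  then show ?case using tuples_nth[OF assms(2)] by simp
next
  case (term_sort_App f ts)
  then have "map (eval_term M xs) ts \<in> tuples M (fargs L f)"
    by (auto simp: tuples_def list_all2_conv_all_nth)
  with term_sort_App(1) struct show ?case by (auto simp: is_structure_def)
qed

lemma automorphism_eval:
  assumes "automorphism L M h" "term_sort L ss t s" "xs \<in> tuples M ss"
  shows "eval_term M (map h xs) t = h (eval_term M xs t)"
  using assms(2)
proof (induction rule: term_sort.induct)
  case (term_sort_Var i)
  then show ?case using tuples_length[OF assms(3)] by simp
next
  case (term_sort_App f ts)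
  have "map (eval_term M xs) ts \<in> tuples M (fargs L f)"
    using term_sort_App(2) eval_term_sort[OF _ assms(3)]
    by (auto simp: tuples_def list_all2_conv_all_nth)
  then have "h (fint M f (map (eval_term M xs) ts)) = fint M f (map h (map (eval_term M xs) ts))"
    using assms(1) term_sort_App(1) unfolding automorphism_def by blast
  moreover have "map (eval_term M (map h xs)) ts = map h (map (eval_term M xs) ts)"
    using term_sort_App(2) by (auto simp: list_all2_conv_all_nth in_set_conv_nth)
  ultimately show ?case by (simp del: map_map)
qed

lemma automorphism_dom: "automorphism L M h \<Longrightarrow> bij_betw h (dom_of M s) (dom_of M s)"
  unfolding automorphism_def by blast

lemma automorphism_tuples:
  "automorphism L M h \<Longrightarrow> xs \<in> tuples M ss \<Longrightarrow> map h xs \<in> tuples M ss"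
  using automorphism_dom bij_betwE unfolding tuples_def
  by (fastforce simp: list_all2_conv_all_nth)

lemma automorphism_sat:
  assumes "automorphism L M h" "wff L ss \<phi>" "xs \<in> tuples M ss"
  shows "sat M (map h xs) \<phi> \<longleftrightarrow> sat M xs \<phi>"
  using assms(2,3)
proof (induction \<phi> arbitrary: ss xs)
  case (Equal t u)
  then obtain s where s: "term_sort L ss t s" "term_sort L ss u s" by auto
  have "inj_on h (dom_of M s)" using automorphism_dom[OF assms(1)] by (rule bij_betw_imp_inj_on)
  then show ?case
    using automorphism_eval[OF assms(1) s(1) Equal.prems(2)]
      automorphism_eval[OF assms(1) s(2) Equal.prems(2)]
      eval_term_sort[OF s(1) Equal.prems(2)] eval_term_sort[OF s(2) Equal.prems(2)]
    by (auto dest: inj_onD)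
next
  case (Rel R ts)
  then have R: "R \<in> rels L" "list_all2 (term_sort L ss) ts (rargs L R)" by auto
  have "map (eval_term M xs) ts \<in> tuples M (rargs L R)"
    using R(2) eval_term_sort[OF _ Rel.prems(2)] by (auto simp: tuples_def list_all2_conv_all_nth)
  then have "map (eval_term M xs) ts \<in> rint M R \<longleftrightarrow> map h (map (eval_term M xs) ts) \<in> rint M R"
    using assms(1) R(1) unfolding automorphism_def by blast
  moreover have "map (eval_term M (map h xs)) ts = map h (map (eval_term M xs) ts)"
    using R(2) automorphism_eval[OF assms(1) _ Rel.prems(2)]
    by (fastforce simp: list_all2_conv_all_nth in_set_conv_nth)
  ultimately show ?case by (simp del: map_map)
next
  case (Neg \<phi>)
  then show ?case by simp
next
  case (Conj \<phi> \<psi>)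
  then show ?case using Conj.IH(1)[of ss xs] Conj.IH(2)[of ss xs] by simp
next
  case (Exists s \<phi>)
  have "(\<exists>x\<in>dom_of M s. sat M (x # map h xs) \<phi>) \<longleftrightarrow>
    (\<exists>x\<in>h ` dom_of M s. sat M (x # map h xs) \<phi>)"
    using bij_betw_imp_surj_on[OF automorphism_dom[OF assms(1), of s]] by simp
  also have "\<dots> \<longleftrightarrow> (\<exists>x\<in>dom_of M s. sat M (x # xs) \<phi>)"
    using Exists.IH[of "s # ss" "_ # xs"] Exists.prems by simp
  finally show ?case by simp
qed simp

text \<open>Of an automorphism fixing \<open>C\<close> only its effect on \<open>C\<close>-definable predicates is needed.\<close>

definition preserves :: "'m set \<Rightarrow> ('m \<Rightarrow> 'm) \<Rightarrow> bool" where
  "preserves C h \<longleftrightarrow> (\<forall>ss. \<forall>x\<in>tuples M ss. map h x \<in> tuples M ss \<and>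
     (\<forall>P. dfn C ss P \<longrightarrow> (P (map h x) \<longleftrightarrow> P x)))"

lemma preserves_tuples: "preserves C h \<Longrightarrow> x \<in> tuples M ss \<Longrightarrow> map h x \<in> tuples M ss"
  unfolding preserves_def by blast

lemma preserves_dfn: "preserves C h \<Longrightarrow> dfn C ss P \<Longrightarrow> x \<in> tuples M ss \<Longrightarrow> P (map h x) \<longleftrightarrow> P x"
  unfolding preserves_def by blast

lemma preserves_id: "preserves C (\<lambda>x. x)"
  unfolding preserves_def by simp

lemma preserves_comp:
  assumes "preserves C g" "preserves C h"
  shows "preserves C (g \<circ> h)"
  unfolding preserves_def
proof (intro allI ballI impI conjI)
  fix ss x assume x: "x \<in> tuples M ss"
  from preserves_tuples[OF assms(2) x] have hx: "map h x \<in> tuples M ss" .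
  from preserves_tuples[OF assms(1) this] show "map (g \<circ> h) x \<in> tuples M ss" by simp
  fix P assume P: "dfn C ss P"
  from preserves_dfn[OF assms(1) P hx] preserves_dfn[OF assms(2) P x]
  show "P (map (g \<circ> h) x) \<longleftrightarrow> P x" by simp
qed

lemma preserves_inj:
  assumes "preserves C h" "x \<in> tuples M ss" "y \<in> tuples M ss"
  shows "map h x = map h y \<longleftrightarrow> x = y"
proof -
  have "dfn C (ss @ ss) (\<lambda>e. take (length ss) e = drop (length ss) e)"
    by (rule dfn_eq[where us = ss]) (rule tm_take tm_drop_id)+
  from preserves_dfn[OF assms(1) this tuples_append[OF assms(2,3)]] show ?thesis
    using tuples_length[OF assms(2)] by simp
qed

lemma automorphism_preserves:
  assumes "automorphism L M h" "\<And>c. c \<in> C \<Longrightarrow> h c = c"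
  shows "preserves C h"
  unfolding preserves_def
proof (intro allI ballI impI conjI)
  fix ss x assume x: "x \<in> tuples M ss"
  then show "map h x \<in> tuples M ss" by (rule automorphism_tuples[OF assms(1)])
  then have hx: "map h x \<in> tuples M ss" .
  fix P assume "dfn C ss P"
  then show "P (map h x) \<longleftrightarrow> P x"
  proof (rule dfnE)
    fix \<phi> cs ts
    assume p: "set cs \<subseteq> C" "cs \<in> tuples M ts" "wff L (ss @ ts) \<phi>"
      "\<And>xs. xs \<in> tuples M ss \<Longrightarrow> P xs \<longleftrightarrow> sat M (xs @ cs) \<phi>"
    have "map h cs = cs" using p(1) assms(2) by (intro map_idI) auto
    then have "map h (x @ cs) = map h x @ cs" by simp
    with automorphism_sat[OF assms(1) p(3) tuples_append[OF x p(2)]] p(4)[OF x] p(4)[OF hx]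
    show ?thesis by simp
  qed
qed

definition same_type :: "'m set \<Rightarrow> 's list \<Rightarrow> 'm list \<Rightarrow> 'm list \<Rightarrow> bool" where
  "same_type C ss x y \<longleftrightarrow> x \<in> tuples M ss \<and> y \<in> tuples M ss \<and>
     (\<forall>P. dfn C ss P \<longrightarrow> (P x \<longleftrightarrow> P y))"

lemma same_typeD: "same_type C ss x y \<Longrightarrow> dfn C ss P \<Longrightarrow> P x \<longleftrightarrow> P y"
  unfolding same_type_def by blast

lemma same_type_sym: "same_type C ss x y \<Longrightarrow> same_type C ss y x"
  unfolding same_type_def by blast

lemma same_type_trans: "same_type C ss x y \<Longrightarrow> same_type C ss y z \<Longrightarrow> same_type C ss x z"
  unfolding same_type_def by blast

lemma same_type_preserves: "preserves C h \<Longrightarrow> x \<in> tuples M ss \<Longrightarrow> same_type C ss (map h x) x"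
  unfolding same_type_def using preserves_tuples preserves_dfn by blast

lemma same_type_tm:
  assumes "same_type C ss x y" "tm C ss t us"
  shows "same_type C us (t x) (t y)"
  using assms tm_range[OF assms(2)] dfn_tm[OF _ assms(2)] unfolding same_type_def by blast

end

locale monster = fo_structure L M
  for L :: "('s, 'f, 'r) language" and M :: "('s, 'f, 'r, 'm) struct" +
  fixes \<kappa> :: "'k rel"
  assumes card_order: "Card_order \<kappa>"
    and uncountable: "|{\<phi>. \<exists>ss. wff L ss \<phi>}| <o \<kappa>"
    and saturated: "saturated \<kappa> L M"
    and homogeneous: "strongly_homogeneous \<kappa> L M"
begin

lemma countable_small:
  fixes S :: "'b set"
  assumes "countable S"
  shows "small \<kappa> S"
proof -
  \<comment> \<open>there are infinitely many formulas, the iterated negations of \<open>Falsum\<close>, in any language\<close>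
  define g :: "nat \<Rightarrow> ('s, 'f, 'r) formula" where "g n = (Neg ^^ n) Falsum" for n
  have "g m = g n \<Longrightarrow> m = n" for m n
  proof (induction m arbitrary: n)
    case 0
    then show ?case by (cases n) (auto simp: g_def)
  next
    case (Suc m)
    then show ?case by (cases n) (auto simp: g_def)
  qed
  then have "inj g" by (intro injI)
  moreover have "wff L ss (g n)" for n ss by (induction n) (auto simp: g_def)
  ultimately have "|UNIV :: nat set| \<le>o |{\<phi>. \<exists>ss. wff L ss \<phi>}|"
    by (intro card_of_ordLeqI[of g]) auto
  moreover from assms have "|S| \<le>o |UNIV :: nat set|"
    unfolding countable_def by (auto intro: card_of_ordLeqI)
  ultimately show ?thesis unfolding small_def
    using uncountable by (meson ordLeq_ordLess_trans ordLeq_transitive)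
qed

lemma small_Un:
  assumes "small \<kappa> S" "small \<kappa> S'"
  shows "small \<kappa> (S \<union> S')"
proof -
  have "infinite (Field \<kappa>)"
  proof
    assume "finite (Field \<kappa>)"
    moreover have "|UNIV :: nat set| <o \<kappa>"
      using countable_small[of "UNIV :: nat set"] by (simp add: small_def)
    then have "|UNIV :: nat set| \<le>o |Field \<kappa>|"
      using card_of_Field_ordIso[OF card_order] ordLess_imp_ordLeq ordIso_symmetric
        ordLeq_ordIso_trans by blast
    ultimately show False using card_of_ordLeq_finite by blast
  qed
  then show ?thesis
    using assms card_of_Un_ordLess_infinite_Field[OF _ card_order] unfolding small_def by blast
qed

lemma small_Un_set: "small \<kappa> S \<Longrightarrow> small \<kappa> (S \<union> set xs)"
  by (rule small_Un) (auto intro: countable_small countable_finite)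

lemma small_points_Un: "x \<in> tuples M vs \<Longrightarrow> C \<subseteq> points M \<Longrightarrow> small \<kappa> C \<Longrightarrow>
    C \<union> set x \<subseteq> points M \<and> small \<kappa> (C \<union> set x)"
  using tuples_subset_points small_Un_set by blast

text \<open>Saturation realizes complete types.  A finitely satisfiable set of formulas that is maximal, which
  exists by Zorn's lemma, is a complete type.\<close>

theorem compactness:
  assumes C: "C \<subseteq> points M" "small \<kappa> C"
    and F: "\<And>P. P \<in> F \<Longrightarrow> dfn C ss P"
    and fin: "\<And>G. finite G \<Longrightarrow> G \<subseteq> F \<Longrightarrow> \<exists>x\<in>tuples M ss. \<forall>P\<in>G. P x"
  shows "\<exists>x\<in>tuples M ss. \<forall>P\<in>F. P x"
proof -
  let ?Fm = "formulas_over L M C ss"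
  let ?S = "\<lambda>x (\<phi>, cs). sat M (x @ cs) \<phi>"
  define fsat where "fsat q \<longleftrightarrow> (\<forall>q0\<subseteq>q. finite q0 \<longrightarrow> (\<exists>x\<in>tuples M ss. \<forall>d\<in>q0. ?S x d))" for q
  define q0 where "q0 = {d \<in> ?Fm. \<exists>P\<in>F. \<forall>x\<in>tuples M ss. P x \<longleftrightarrow> ?S x d}"
  have q0: "fsat q0" unfolding fsat_def
  proof (intro allI impI)
    fix q assume q: "q \<subseteq> q0" "finite q"
    then have "\<forall>d\<in>q. \<exists>P\<in>F. \<forall>x\<in>tuples M ss. P x \<longleftrightarrow> ?S x d" unfolding q0_def by blast
    then obtain P where P: "\<forall>d\<in>q. P d \<in> F \<and> (\<forall>x\<in>tuples M ss. P d x \<longleftrightarrow> ?S x d)" by metis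
    with fin[of "P ` q"] q(2) show "\<exists>x\<in>tuples M ss. \<forall>d\<in>q. ?S x d" by auto
  qed
  let ?A = "{q. q0 \<subseteq> q \<and> q \<subseteq> ?Fm \<and> fsat q}"
  have "\<exists>q\<in>?A. \<forall>X\<in>?A. q \<subseteq> X \<longrightarrow> X = q"
  proof (rule subset_Zorn_nonempty)
    show "?A \<noteq> {}" using q0 unfolding q0_def by blast
    fix \<C> assume ch: "\<C> \<noteq> {}" "subset.chain ?A \<C>"
    have "fsat (\<Union>\<C>)" unfolding fsat_def
    proof (intro allI impI)
      fix q assume q: "q \<subseteq> \<Union>\<C>" "finite q"
      obtain X where "X \<in> \<C>" "q \<subseteq> X"
        using finite_subset_Union_chain[OF q(2,1) ch] by blast
      with ch(2) q(2) show "\<exists>x\<in>tuples M ss. \<forall>d\<in>q. ?S x d"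
        unfolding subset.chain_def fsat_def by blast
    qed
    with ch show "\<Union>\<C> \<in> ?A" unfolding subset.chain_def by blast
  qed
  then obtain q where q: "q0 \<subseteq> q" "q \<subseteq> ?Fm" "fsat q"
    and max: "\<And>X. X \<in> ?A \<Longrightarrow> q \<subseteq> X \<Longrightarrow> X = q" by auto
  have "complete_type L M C ss q" unfolding complete_type_def
  proof (intro conjI)
    show "q \<subseteq> ?Fm" by (rule q(2))
    show "\<forall>q'\<subseteq>q. finite q' \<longrightarrow> (\<exists>x\<in>tuples M ss. \<forall>(\<phi>, cs)\<in>q'. sat M (x @ cs) \<phi>)"
      using q(3) unfolding fsat_def .
    show "\<forall>(\<phi>, cs)\<in>?Fm. (\<phi>, cs) \<in> q \<or> (Neg \<phi>, cs) \<in> q"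
    proof (clarify, rule ccontr)
      fix \<phi> cs assume f: "(\<phi>, cs) \<in> ?Fm" and n: "(Neg \<phi>, cs) \<notin> q" and p: "(\<phi>, cs) \<notin> q"
      have f': "(Neg \<phi>, cs) \<in> ?Fm" using f by (auto simp: formulas_over_def)
      have ext: "\<exists>q1\<subseteq>q. finite q1 \<and> (\<forall>x\<in>tuples M ss. (\<forall>e\<in>q1. ?S x e) \<longrightarrow> \<not> ?S x d)"
        if d: "d \<in> ?Fm" "d \<notin> q" for d
      proof -
        have "\<not> fsat (insert d q)" using max[of "insert d q"] d q by blast
        then obtain q2 where q2: "q2 \<subseteq> insert d q" "finite q2"
          "\<not> (\<exists>x\<in>tuples M ss. \<forall>e\<in>q2. ?S x e)" unfolding fsat_def by blast
        have "q2 - {d} \<subseteq> q" "finite (q2 - {d})" using q2 by auto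
        moreover have "\<forall>x\<in>tuples M ss. (\<forall>e\<in>q2 - {d}. ?S x e) \<longrightarrow> \<not> ?S x d"
          using q2(3) by blast
        ultimately show ?thesis by blast
      qed
      from ext[OF f p] obtain q1 where q1: "q1 \<subseteq> q" "finite q1"
        "\<forall>x\<in>tuples M ss. (\<forall>e\<in>q1. ?S x e) \<longrightarrow> \<not> ?S x (\<phi>, cs)" by blast
      from ext[OF f' n] obtain q2 where q2: "q2 \<subseteq> q" "finite q2"
        "\<forall>x\<in>tuples M ss. (\<forall>e\<in>q2. ?S x e) \<longrightarrow> \<not> ?S x (Neg \<phi>, cs)" by blast
      from q(3) q1(1,2) q2(1,2) obtain x where x: "x \<in> tuples M ss" "\<forall>e\<in>q1 \<union> q2. ?S x e"
        unfolding fsat_def by (metis finite_UnI le_sup_iff)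
      with q1(3) q2(3) have "\<not> ?S x (\<phi>, cs)" "\<not> ?S x (Neg \<phi>, cs)" by blast+
      then show False by simp
    qed
  qed
  with saturated C obtain x where x: "realizes M ss x q" unfolding saturated_def by blast
  have "P x" if "P \<in> F" for P
  proof -
    from F[OF that] obtain \<phi> cs ts where p: "set cs \<subseteq> C" "cs \<in> tuples M ts" "wff L (ss @ ts) \<phi>"
      "\<forall>xs\<in>tuples M ss. P xs \<longleftrightarrow> sat M (xs @ cs) \<phi>" unfolding dfn_def by blast
    then have "(\<phi>, cs) \<in> q0" using that unfolding q0_def formulas_over_def by auto
    with q(1) x have "sat M (x @ cs) \<phi>" unfolding realizes_def by auto
    with p(4) x show ?thesis unfolding realizes_def by blast
  qed
  with x show ?thesis unfolding realizes_def by blast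
qed

corollary compact_cover:
  assumes "C \<subseteq> points M" "small \<kappa> C" "\<And>P. P \<in> F \<Longrightarrow> dfn C ss P" "dfn C ss D"
    and cover: "\<And>x. x \<in> tuples M ss \<Longrightarrow> D x \<Longrightarrow> \<exists>P\<in>F. P x"
  shows "\<exists>G\<subseteq>F. finite G \<and> (\<forall>x\<in>tuples M ss. D x \<longrightarrow> (\<exists>P\<in>G. P x))"
proof (rule ccontr)
  assume no: "\<not> ?thesis"
  let ?F = "insert D ((\<lambda>P x. \<not> P x) ` F)"
  have "\<exists>x\<in>tuples M ss. \<forall>P\<in>?F. P x"
  proof (rule compactness[OF assms(1,2)])
    fix P assume "P \<in> ?F"
    then show "dfn C ss P" using assms(3,4) by (auto intro: dfn_neg)
  next
    fix G assume G: "finite G" "G \<subseteq> ?F"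
    then obtain H where H: "H \<subseteq> F" "finite H" "G - {D} = (\<lambda>P x. \<not> P x) ` H"
      using finite_subset_image[of "G - {D}" "\<lambda>P x. \<not> P x" F] by blast
    have "\<not> (\<forall>x\<in>tuples M ss. D x \<longrightarrow> (\<exists>P\<in>H. P x))" using no H(1,2) by auto
    then obtain x where x: "x \<in> tuples M ss" "D x" "\<forall>P\<in>H. \<not> P x" by auto
    have "P x" if "P \<in> G" for P
    proof (cases "P = D")
      case False
      with that H(3) obtain Q where Q: "Q \<in> H" "P = (\<lambda>x. \<not> Q x)" by blast
      show ?thesis unfolding Q(2) by (rule bspec[OF x(3) Q(1)])
    qed (use x(2) in simp)
    with \<open>x \<in> tuples M ss\<close> show "\<exists>x\<in>tuples M ss. \<forall>P\<in>G. P x" by blast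
  qed
  then obtain x where x: "x \<in> tuples M ss" "\<forall>P\<in>?F. P x" ..
  have "D x" by (rule bspec[OF x(2)]) simp
  from cover[OF x(1) this] obtain P where P: "P \<in> F" "P x" ..
  have "\<not> P x" by (rule bspec[OF x(2), of "\<lambda>x. \<not> P x"]) (use P(1) in blast)
  with P(2) show False by contradiction
qed

text \<open>The homogeneity of the model concerns partial elementary maps on sets of elements.  The map that is the
  identity on \<open>C\<close> and takes \<open>x\<^sub>i\<close> to \<open>y\<^sub>i\<close> is well defined, because equations between entries of \<open>x\<close>, or
  between these and elements of \<open>C\<close>, are part of the type of \<open>x\<close> over \<open>C\<close>.\<close>

theorem homogeneity:
  assumes C: "C \<subseteq> points M" "small \<kappa> C" and xy: "same_type C ss x y"
  shows "\<exists>h. preserves C h \<and> map h x = y"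
proof -
  have x: "x \<in> tuples M ss" and y: "y \<in> tuples M ss" using xy unfolding same_type_def by auto
  define g where "g z = (if z \<in> C then z else y ! (LEAST i. i < length x \<and> x ! i = z))" for z
  have eqi: "y ! i = y ! j" if "i < length x" "j < length x" "x ! i = x ! j" for i j
  proof -
    have "ss ! i = ss ! j"
      using that tuples_nth[OF x] tuples_length[OF x] by (metis sort_unique)
    then have "dfn C ss (\<lambda>x. x ! i = x ! j)"
      using that tuples_length[OF x] by (intro dfn_nth_eq) auto
    from same_typeD[OF xy this] that show ?thesis by simp
  qed
  have eqc: "y ! i = x ! i" if i: "i < length x" "x ! i \<in> C" for i
  proof -
    have i': "i < length ss" using i tuples_length[OF x] by simp
    have t: "tm C ss (\<lambda>x. take 1 (drop i x)) [ss ! i]"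
      using tm_slice[of C "take i ss" "[ss ! i]" "drop (Suc i) ss"] i'
      by (simp add: id_take_nth_drop[symmetric])
    have "dfn C ss (\<lambda>e. take 1 (drop i e) = [x ! i])"
      by (rule dfn_eq[OF t], rule tm_const) (use i i' tuples_nth[OF x i'] in auto)
    from same_typeD[OF xy this] have "take 1 (drop i y) = [x ! i]"
      using i by (simp add: take_Suc_conv_app_nth hd_drop_conv_nth take_Suc)
    then show ?thesis using i' tuples_length[OF y] by (simp add: take_Suc hd_drop_conv_nth)
  qed
  have gx: "g (x ! i) = y ! i" if i: "i < length x" for i
  proof (cases "x ! i \<in> C")
    case True
    then show ?thesis using eqc[OF i] by (simp add: g_def)
  next
    case False
    let ?k = "LEAST k. k < length x \<and> x ! k = x ! i"
    have "?k < length x \<and> x ! ?k = x ! i" by (rule LeastI[of _ i]) (use i in simp)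
    with eqi[of ?k i] i False show ?thesis by (simp add: g_def)
  qed
  have "partial_elementary L M (C \<union> set x) g" unfolding partial_elementary_def
  proof (intro allI ballI impI)
    fix us z assume z: "z \<in> tuples M us" "set z \<subseteq> C \<union> set x"
    from tm_cover[OF z x] obtain t where t: "tm C ss t us" "t x = z" by blast
    from t(1) obtain js where js: "list_all2 (item C ss) js us"
      "\<forall>xs\<in>tuples M ss. t xs = map (case_sum ((!) xs) (\<lambda>c. c)) js" unfolding tm_def by blast
    have "g (case_sum ((!) x) (\<lambda>c. c) j) = case_sum ((!) y) (\<lambda>c. c) j" if "j \<in> set js" for j
    proof -
      from that js(1) obtain u where "item C ss j u"
        by (auto simp: list_all2_conv_all_nth in_set_conv_nth)
      then show ?thesis
      proof (cases j)
        case (Inl i)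
        then show ?thesis using \<open>item C ss j u\<close> gx tuples_length[OF x] by (auto simp: item_def)
      next
        case (Inr c)
        then show ?thesis using \<open>item C ss j u\<close> by (auto simp: item_def g_def)
      qed
    qed
    then have gz: "map g z = t y" using t(2) bspec[OF js(2) x] bspec[OF js(2) y] by auto
    show "map g z \<in> tuples M us \<and> (\<forall>\<phi>. wff L us \<phi> \<longrightarrow> sat M z \<phi> = sat M (map g z) \<phi>)"
    proof (intro conjI allI impI)
      show "map g z \<in> tuples M us" unfolding gz by (rule tm_range[OF t(1) y])
      fix \<phi> assume "wff L us \<phi>"
      then have "dfn C us (\<lambda>z. sat M z \<phi>)" by (intro dfnI[of "[]" C "[]" us \<phi>]) auto
      from same_typeD[OF xy dfn_tm[OF this t(1)]] show "sat M z \<phi> = sat M (map g z) \<phi>"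
        unfolding gz t(2) .
    qed
  qed
  moreover have "C \<union> set x \<subseteq> points M" using C(1) tuples_subset_points[OF x] by blast
  moreover have "small \<kappa> (C \<union> set x)" by (rule small_Un_set[OF C(2)])
  ultimately obtain h where h: "automorphism L M h" "\<forall>z\<in>C \<union> set x. h z = g z"
    using homogeneous unfolding strongly_homogeneous_def by blast
  have "preserves C h" by (rule automorphism_preserves[OF h(1)]) (use h(2) in \<open>auto simp: g_def\<close>)
  moreover have "map h x = y"
    by (rule nth_equalityI) (use h(2) gx tuples_length[OF x] tuples_length[OF y] in auto)
  ultimately show ?thesis by blast
qed

end

section \<open>Sets all of whose relations have bounded trees\<close>

context fo_structure begin

definition dfn2 :: "'m set \<Rightarrow> 's list \<Rightarrow> 's list \<Rightarrow> ('m list \<Rightarrow> 'm list \<Rightarrow> bool) \<Rightarrow> bool" where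
  "dfn2 C us vs R \<longleftrightarrow> dfn C (us @ vs) (\<lambda>e. R (take (length us) e) (drop (length us) e))"

definition dfn3 ::
  "'m set \<Rightarrow> 's list \<Rightarrow> 's list \<Rightarrow> 's list \<Rightarrow> ('m list \<Rightarrow> 'm list \<Rightarrow> 'm list \<Rightarrow> bool) \<Rightarrow> bool" where
  "dfn3 C us vs ws R \<longleftrightarrow> dfn C (us @ vs @ ws)
     (\<lambda>e. R (take (length us) e) (take (length vs) (drop (length us) e))
       (drop (length vs) (drop (length us) e)))"

lemma dfn2_sub:
  assumes "dfn2 C us vs R" "tm C ss t us" "tm C ss u vs"
  shows "dfn C ss (\<lambda>x. R (t x) (u x))"
  by (rule dfn_cong[OF dfn_tm[OF assms(1)[unfolded dfn2_def] tm_append[OF assms(2,3)]]])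
     (simp add: tuples_length[OF tm_range[OF assms(2)]])

lemma dfn3_sub:
  assumes "dfn3 C us vs ws R" "tm C ss t us" "tm C ss u vs" "tm C ss v ws"
  shows "dfn C ss (\<lambda>x. R (t x) (u x) (v x))"
  by (rule dfn_cong[OF dfn_tm[OF assms(1)[unfolded dfn3_def]
        tm_append[OF assms(2) tm_append[OF assms(3,4)]]]])
     (simp add: tuples_length[OF tm_range[OF assms(2)]] tuples_length[OF tm_range[OF assms(3)]])

lemma dfn2_mono: "dfn2 C us vs R \<Longrightarrow> C \<subseteq> D \<Longrightarrow> dfn2 D us vs R"
  unfolding dfn2_def by (rule dfn_mono)

lemma dfn3_mono: "dfn3 C us vs ws R \<Longrightarrow> C \<subseteq> D \<Longrightarrow> dfn3 D us vs ws R"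
  unfolding dfn3_def by (rule dfn_mono)

lemma dfn2_cong:
  assumes "dfn2 C us vs R" "\<And>x y. x \<in> tuples M us \<Longrightarrow> y \<in> tuples M vs \<Longrightarrow> R x y \<longleftrightarrow> R' x y"
  shows "dfn2 C us vs R'"
  using assms(1) unfolding dfn2_def
  by (rule dfn_cong) (use assms(2) tuples_take tuples_drop in blast)

text \<open>Trees of a fixed height are first-order.  In the induction the root \<open>z\<close> is moved to the parameters.\<close>

lemma dfn_tree:
  assumes "dfn2 C ys es P" "dfn3 C ys zs es \<phi>"
  shows "dfn C es (\<lambda>e. tree h (tuples M zs) (\<lambda>y z. \<phi> y z e) {y \<in> tuples M ys. P y e})"
  using assms
proof (induction h arbitrary: es P \<phi>)
  case 0
  have "dfn C es (\<lambda>e. \<exists>y\<in>tuples M ys. P y e)"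
    by (rule dfn_ex, rule dfn2_sub[OF "0.prems"(1)]) (rule tm_take tm_drop_id)+
  then show ?case by (rule dfn_cong) auto
next
  case (Suc h)
  define P1 where "P1 y e \<longleftrightarrow> P y (drop (length zs) e) \<and>
    \<phi> y (take (length zs) e) (drop (length zs) e)" for y e
  define P2 where "P2 y e \<longleftrightarrow> P y (drop (length zs) e) \<and>
    \<not> \<phi> y (take (length zs) e) (drop (length zs) e)" for y e
  define \<phi>' where "\<phi>' y z e \<longleftrightarrow> \<phi> y z (drop (length zs) e)" for y z e
  have t: "tm C (ys @ zs @ es) (take (length ys)) ys"
    "tm C (ys @ zs @ es) (\<lambda>x. take (length zs) (drop (length ys) x)) zs"
    "tm C (ys @ zs @ es) (\<lambda>x. drop (length zs) (drop (length ys) x)) es"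
    by (rule tm_take, rule tm_drop[OF tm_take], rule tm_drop[OF tm_drop_id])
  have 1: "dfn2 C ys (zs @ es) P1" unfolding dfn2_def P1_def
    by (intro dfn_conj dfn2_sub[OF Suc.prems(1)] dfn3_sub[OF Suc.prems(2)] t)
  have 2: "dfn2 C ys (zs @ es) P2" unfolding dfn2_def P2_def
    by (intro dfn_conj dfn_neg dfn2_sub[OF Suc.prems(1)] dfn3_sub[OF Suc.prems(2)] t)
  have 3: "dfn3 C ys zs (zs @ es) \<phi>'" unfolding dfn3_def \<phi>'_def
    by (rule dfn3_sub[OF Suc.prems(2)],
        rule tm_take, rule tm_drop[OF tm_take], rule tm_drop[OF tm_drop[OF tm_drop_id]])
  have "dfn C es (\<lambda>e. \<exists>z\<in>tuples M zs.
    tree h (tuples M zs) (\<lambda>y z. \<phi> y z e) {y \<in> tuples M ys. P y e \<and> \<phi> y z e} \<and>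
    tree h (tuples M zs) (\<lambda>y z. \<phi> y z e) {y \<in> tuples M ys. P y e \<and> \<not> \<phi> y z e})"
    by (rule dfn_ex)
       (rule dfn_conj[OF Suc.IH[OF 1 3] Suc.IH[OF 2 3], unfolded P1_def P2_def \<phi>'_def])
  then show ?case by simp
qed

text \<open>The second argument of \<open>\<phi>\<close> ranges over the whole model and not over \<open>X\<close>: this is what links stability
  of \<open>X\<close> with stable embeddedness.\<close>

definition tree_bounded :: "'s list \<Rightarrow> 'm list set \<Rightarrow> bool" where
  "tree_bounded ys X \<longleftrightarrow> definable L M (points M) ys X \<and>
     (\<forall>zs \<phi>. dfn2 (points M) ys zs \<phi> \<longrightarrow> (\<exists>h. \<not> tree h (tuples M zs) \<phi> X))"

lemma tree_bounded_definable: "tree_bounded ys X \<Longrightarrow> definable L M (points M) ys X"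
  unfolding tree_bounded_def by blast

lemma tree_boundedD: "tree_bounded ys X \<Longrightarrow> dfn2 (points M) ys zs \<phi> \<Longrightarrow> \<exists>h. \<not> tree h (tuples M zs) \<phi> X"
  unfolding tree_bounded_def by blast

lemma tree_bounded_subset:
  "tree_bounded ys X \<Longrightarrow> X' \<subseteq> X \<Longrightarrow> definable L M (points M) ys X' \<Longrightarrow> tree_bounded ys X'"
  unfolding tree_bounded_def using tree_mono[of _ _ _ X' X] by blast

lemma tree_bounded_empty: "tree_bounded ys {}"
proof -
  have "definable L M (points M) ys {}"
    using dfn_const[of "points M" ys False] by (simp add: definable_iff_dfn)
  then show ?thesis unfolding tree_bounded_def using tree_nonempty by blast
qed

lemma tree_bounded_Un:
  assumes "tree_bounded ys X" "tree_bounded ys X'"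
  shows "tree_bounded ys (X \<union> X')"
  unfolding tree_bounded_def
proof (intro conjI allI impI)
  show "definable L M (points M) ys (X \<union> X')"
    using tree_bounded_definable[OF assms(1)] tree_bounded_definable[OF assms(2)] dfn_disj
    by (auto simp: definable_iff_dfn)
  fix zs \<phi> assume "dfn2 (points M) ys zs \<phi>"
  from tree_boundedD[OF assms(1) this] tree_boundedD[OF assms(2) this] obtain m k where
    "\<not> tree m (tuples M zs) \<phi> X" "\<not> tree k (tuples M zs) \<phi> X'" by blast
  then show "\<exists>h. \<not> tree h (tuples M zs) \<phi> (X \<union> X')" using tree_split_leaves by blast
qed

lemma tree_bounded_Union: "finite \<X> \<Longrightarrow> (\<And>X. X \<in> \<X> \<Longrightarrow> tree_bounded ys X) \<Longrightarrow> tree_bounded ys (\<Union>\<X>)"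
  by (induction \<X> rule: finite_induct) (auto intro: tree_bounded_empty tree_bounded_Un)

lemma tree_bounded_Nil: "tree_bounded [] {[]}"
proof -
  have "definable L M (points M) [] {[]}"
    using dfn_const[of "points M" "[]" True] by (auto simp: definable_iff_dfn elim: dfn_cong)
  moreover have "\<not> tree (Suc 0) Z \<phi> {[]}" for Z and \<phi> :: "'m list \<Rightarrow> 'm list \<Rightarrow> bool" by auto
  ultimately show ?thesis unfolding tree_bounded_def by blast
qed

lemma dfn_finite_support: "dfn C ss P \<Longrightarrow> \<exists>cs. set cs \<subseteq> C \<and> dfn (set cs) ss P"
  unfolding dfn_def by blast

end

context monster begin

text \<open>If there are trees of every height, a tree of height \<open>\<omega>\<close> is built from the root: by
  saturation there is a root both of whose sides still have trees of every height.\<close>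

lemma tree_omega:
  assumes C: "C \<subseteq> points M" "small \<kappa> C"
    and X: "definable L M C ys X" and \<phi>: "dfn2 C ys zs \<phi>"
    and trees: "\<And>h. tree h (tuples M zs) \<phi> X"
  shows "\<exists>\<zeta>. range \<zeta> \<subseteq> tuples M zs \<and>
    (\<forall>\<sigma>::nat \<Rightarrow> bool. \<exists>y\<in>X. \<forall>n. \<phi> y (\<zeta> (map \<sigma> [0..<n])) \<longleftrightarrow> \<sigma> n)"
proof -
  have XT: "X \<subseteq> tuples M ys" and Xd: "dfn C ys (\<lambda>y. y \<in> X)" using X by (auto simp: definable_iff_dfn)
  define W where "W p = {y \<in> X. \<forall>(z, s)\<in>set p. \<phi> y z \<longleftrightarrow> s}" for p
  define good where "good p \<longleftrightarrow> fst ` set p \<subseteq> tuples M zs \<and> (\<forall>h. tree h (tuples M zs) \<phi> (W p))" for p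
  have \<phi>D: "dfn2 D ys zs \<phi>" and XD: "dfn D ys (\<lambda>y. y \<in> X)" if "C \<subseteq> D" for D
    using that \<phi> Xd by (auto intro: dfn2_mono dfn_mono)
  have W_dfn: "dfn D ys (\<lambda>y. y \<in> W p)"
    if "C \<subseteq> D" "fst ` set p \<subseteq> tuples M zs" "\<And>z. z \<in> fst ` set p \<Longrightarrow> set z \<subseteq> D" for D p
  proof -
    have "dfn D ys (\<lambda>y. y \<in> X \<and> (\<forall>d\<in>set p. \<phi> y (fst d) \<longleftrightarrow> snd d))"
    proof (intro dfn_conj dfn_ball_finite dfn_iff dfn_const XD that(1))
      fix d assume "d \<in> set p"
      with that(2,3) have "fst d \<in> tuples M zs" "set (fst d) \<subseteq> D" by auto
      then show "dfn D ys (\<lambda>y. \<phi> y (fst d))"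
        by (intro dfn2_sub[OF \<phi>D[OF that(1)]] tm_id tm_const)
    qed simp
    then show ?thesis by (rule dfn_cong) (auto simp: W_def)
  qed
  have step: "\<exists>z\<in>tuples M zs. good ((z, True) # p) \<and> good ((z, False) # p)" if p: "good p" for p
  proof -
    define D where "D = C \<union> (\<Union>z\<in>fst ` set p. set z)"
    have "small \<kappa> (\<Union>z\<in>fst ` set p. set z)" by (intro countable_small countable_finite) auto
    then have D: "small \<kappa> D" "C \<subseteq> D" unfolding D_def by (auto intro: small_Un C(2))
    have "set z \<subseteq> points M" if "z \<in> fst ` set p" for z
      by (rule tuples_subset_points[where ss = zs]) (use p that in \<open>auto simp: good_def\<close>)
    then have "D \<subseteq> points M" unfolding D_def by (intro Un_least UN_least C(1))
    note D = this D
    have Wd: "dfn D ys (\<lambda>y. y \<in> W p)"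
      by (rule W_dfn) (use p D in \<open>auto simp: good_def D_def\<close>)
    define B where "B h z \<longleftrightarrow> tree h (tuples M zs) \<phi> {y \<in> W p. \<phi> y z} \<and>
      tree h (tuples M zs) \<phi> {y \<in> W p. \<not> \<phi> y z}" for h z
    have WT: "W p \<subseteq> tuples M ys" using XT by (auto simp: W_def)
    have Bd: "dfn D zs (B h)" for h
    proof -
      have t: "tm D (ys @ zs) (take (length ys)) ys" "tm D (ys @ zs) (drop (length ys)) zs"
        by (rule tm_take tm_drop_id)+
      have m: "dfn D (ys @ zs) (\<lambda>e. take (length ys) e \<in> W p)" by (rule dfn_tm[OF Wd t(1)])
      have f: "dfn D (ys @ zs) (\<lambda>e. \<phi> (take (length ys) e) (drop (length ys) e))"
        using \<phi>D[OF D(3)] unfolding dfn2_def .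
      have 1: "dfn2 D ys zs (\<lambda>y z. y \<in> W p \<and> \<phi> y z)"
        unfolding dfn2_def by (intro dfn_conj m f)
      have 2: "dfn2 D ys zs (\<lambda>y z. y \<in> W p \<and> \<not> \<phi> y z)"
        unfolding dfn2_def by (intro dfn_conj dfn_neg m f)
      have 3: "dfn3 D ys zs zs (\<lambda>y z e. \<phi> y z)" unfolding dfn3_def
        by (rule dfn2_sub[OF \<phi>D[OF D(3)]], rule tm_take, rule tm_drop[OF tm_take])
      have "dfn D zs (\<lambda>z.
        tree h (tuples M zs) (\<lambda>y z'. \<phi> y z') {y \<in> tuples M ys. y \<in> W p \<and> \<phi> y z} \<and>
        tree h (tuples M zs) (\<lambda>y z'. \<phi> y z') {y \<in> tuples M ys. y \<in> W p \<and> \<not> \<phi> y z})"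
        by (intro dfn_conj dfn_tree[OF 1 3] dfn_tree[OF 2 3])
      moreover have "{y \<in> tuples M ys. y \<in> W p \<and> Q y} = {y \<in> W p. Q y}" for Q
        using WT by blast
      ultimately show ?thesis unfolding B_def[abs_def] by (simp only:)
    qed
    have "\<exists>z\<in>tuples M zs. \<forall>P\<in>range B. P z"
    proof (rule compactness[OF D(1,2)])
      fix P assume "P \<in> range B" then show "dfn D zs P" using Bd by auto
    next
      fix G assume "finite G" "G \<subseteq> range B"
      then obtain I where I: "finite I" "G = B ` I" by (meson finite_subset_image subset_UNIV)
      then obtain m where m: "\<forall>i\<in>I. i \<le> m" by (auto simp: finite_nat_set_iff_bounded_le)
      from p have "tree (Suc m) (tuples M zs) \<phi> (W p)" unfolding good_def by blast
      then obtain z where z: "z \<in> tuples M zs" "B m z" unfolding B_def by auto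
      then have "B i z" if "i \<in> I" for i using bspec[OF m that] tree_le unfolding B_def by blast
      with z I(2) show "\<exists>z\<in>tuples M zs. \<forall>P\<in>G. P z" by blast
    qed
    then obtain z where z: "z \<in> tuples M zs" "\<And>h. B h z" by blast
    have "W ((z, True) # p) = {y \<in> W p. \<phi> y z}" "W ((z, False) # p) = {y \<in> W p. \<not> \<phi> y z}"
      unfolding W_def by auto
    with z p have "good ((z, True) # p)" "good ((z, False) # p)"
      unfolding good_def B_def by simp_all
    with z(1) show ?thesis by blast
  qed
  define nxt where "nxt p = (SOME z. z \<in> tuples M zs \<and> good ((z, True) # p) \<and> good ((z, False) # p))" for p
  have nxt: "nxt p \<in> tuples M zs \<and> good ((nxt p, s) # p)" if "good p" for p s
  proof -
    have "\<exists>z. z \<in> tuples M zs \<and> good ((z, True) # p) \<and> good ((z, False) # p)"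
      using step[OF that] by blast
    from someI_ex[OF this] show ?thesis unfolding nxt_def[symmetric] by (cases s) auto
  qed
  define path where "path = rec_list [] (\<lambda>s _ p. (nxt p, s) # p)"
  have path: "path [] = []" "path (s # \<eta>) = (nxt (path \<eta>), s) # path \<eta>" for s \<eta>
    by (simp_all add: path_def)
  have good: "good (path \<eta>)" for \<eta>
  proof (induction \<eta>)
    case Nil
    then show ?case using trees by (simp add: path good_def W_def)
  next
    case (Cons s \<eta>)
    then show ?case using nxt by (simp add: path)
  qed
  define \<zeta> where "\<zeta> \<eta> = nxt (path (rev \<eta>))" for \<eta>
  have \<zeta>: "\<zeta> \<eta> \<in> tuples M zs" for \<eta> using nxt[OF good] by (simp add: \<zeta>_def)
  have "\<exists>y\<in>X. \<forall>n. \<phi> y (\<zeta> (map \<sigma> [0..<n])) \<longleftrightarrow> \<sigma> n" for \<sigma> :: "nat \<Rightarrow> bool"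
  proof -
    define z where "z n = \<zeta> (map \<sigma> [0..<n])" for n
    have p: "set (path (rev (map \<sigma> [0..<n]))) = (\<lambda>i. (z i, \<sigma> i)) ` {..<n}" for n
      by (induction n) (auto simp: path z_def \<zeta>_def lessThan_Suc)
    define D where "D = C \<union> (\<Union>n. set (z n))"
    have "set (z n) \<subseteq> points M" for n using tuples_subset_points[OF \<zeta>] by (simp add: z_def)
    then have D: "D \<subseteq> points M" using C(1) unfolding D_def by (simp add: UN_least)
    have "small \<kappa> (\<Union>n. set (z n))"
      by (intro countable_small countable_UN countableI_type) (simp add: countable_finite)
    then have D: "D \<subseteq> points M" "small \<kappa> D" "C \<subseteq> D"
      using D C(2) unfolding D_def by (auto intro: small_Un)
    define R where "R n y \<longleftrightarrow> y \<in> X \<and> (\<phi> y (z n) \<longleftrightarrow> \<sigma> n)" for n y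
    have "\<exists>y\<in>tuples M ys. \<forall>P\<in>range R. P y"
    proof (rule compactness[OF D(1,2)])
      fix P assume "P \<in> range R"
      then obtain n where P: "P = R n" by blast
      have "set (z n) \<subseteq> D" "z n \<in> tuples M zs" using \<zeta> by (auto simp: D_def z_def)
      then show "dfn D ys P" unfolding P R_def[abs_def]
        by (intro dfn_conj XD dfn_iff dfn_const dfn2_sub[OF \<phi>D[OF D(3)]] tm_id tm_const D(3))
    next
      fix G assume "finite G" "G \<subseteq> range R"
      then obtain I where I: "finite I" "G = R ` I" by (meson finite_subset_image subset_UNIV)
      then obtain m where m: "\<forall>i\<in>I. i < m" by (auto simp: finite_nat_set_iff_bounded)
      have "W (path (rev (map \<sigma> [0..<m]))) \<noteq> {}"
        using good tree_nonempty unfolding good_def by blast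
      then obtain y where y: "y \<in> X" "\<forall>i<m. \<phi> y (z i) \<longleftrightarrow> \<sigma> i" unfolding W_def p by auto
      with m I(2) have "\<forall>P\<in>G. P y" by (auto simp: R_def)
      with y(1) XT show "\<exists>y\<in>tuples M ys. \<forall>P\<in>G. P y" by blast
    qed
    then obtain y where "\<And>n. R n y" by auto
    then have "y \<in> X" "\<forall>n. \<phi> y (\<zeta> (map \<sigma> [0..<n])) \<longleftrightarrow> \<sigma> n" by (simp_all add: R_def z_def)
    then show ?thesis ..
  qed
  with \<zeta> show ?thesis by blast
qed

text \<open>Each element of a product leaves at most countably many traces on a countable set: the trace of
  the second coordinate is given by finitely many nodes, uniformly in the first coordinate, and
  the resulting relation on the first coordinate is again determined by finitely many nodes.
  A tree of height \<open>\<omega>\<close> would have continuum many.\<close>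

lemma tree_bounded_prod:
  assumes X1: "tree_bounded ys1 X1" and X2: "tree_bounded ys2 X2"
  shows "tree_bounded (ys1 @ ys2) {u @ w | u w. u \<in> X1 \<and> w \<in> X2}" (is "tree_bounded _ ?X")
proof -
  have T1: "X1 \<subseteq> tuples M ys1" and d1: "dfn (points M) ys1 (\<lambda>y. y \<in> X1)"
    using tree_bounded_definable[OF X1] by (auto simp: definable_iff_dfn)
  have T2: "X2 \<subseteq> tuples M ys2" and d2: "dfn (points M) ys2 (\<lambda>y. y \<in> X2)"
    using tree_bounded_definable[OF X2] by (auto simp: definable_iff_dfn)
  have mem: "e \<in> ?X \<longleftrightarrow> take (length ys1) e \<in> X1 \<and> drop (length ys1) e \<in> X2" for e
    using T1 by (auto simp: tuples_length subset_iff) (metis append_take_drop_id)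
  have dX: "dfn (points M) (ys1 @ ys2) (\<lambda>y. y \<in> ?X)" unfolding mem
    by (intro dfn_conj dfn_tm[OF d1] dfn_tm[OF d2] tm_take tm_drop_id)
  have XT: "?X \<subseteq> tuples M (ys1 @ ys2)" using T1 T2 by (auto intro: tuples_append)
  have "\<exists>h. \<not> tree h (tuples M zs) \<phi> ?X" if \<phi>: "dfn2 (points M) (ys1 @ ys2) zs \<phi>" for zs \<phi>
  proof (rule ccontr)
    assume "\<not> ?thesis"
    then have trees: "\<And>h. tree h (tuples M zs) \<phi> ?X" by blast
    from dfn_finite_support[OF dX] obtain cs where cs: "set cs \<subseteq> points M"
      "dfn (set cs) (ys1 @ ys2) (\<lambda>y. y \<in> ?X)" by blast
    from dfn_finite_support[OF \<phi>[unfolded dfn2_def]] obtain ds where ds: "set ds \<subseteq> points M"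
      "dfn2 (set ds) (ys1 @ ys2) zs \<phi>" unfolding dfn2_def by blast
    let ?C = "set (cs @ ds)"
    have C: "?C \<subseteq> points M" "small \<kappa> ?C"
      using cs ds by (auto intro: countable_small countable_finite)
    have XC: "definable L M ?C (ys1 @ ys2) ?X" unfolding definable_iff_dfn
      using XT dfn_mono[OF cs(2)] by simp
    have \<phi>C: "dfn2 ?C (ys1 @ ys2) zs \<phi>" by (rule dfn2_mono[OF ds(2)]) simp
    from tree_omega[OF C XC \<phi>C trees] obtain \<zeta> where \<zeta>: "range \<zeta> \<subseteq> tuples M zs"
      "\<forall>\<sigma>::nat \<Rightarrow> bool. \<exists>y\<in>?X. \<forall>n. \<phi> y (\<zeta> (map \<sigma> [0..<n])) \<longleftrightarrow> \<sigma> n" by blast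
    have \<zeta>p: "set (\<zeta> \<eta>) \<subseteq> points M" "\<zeta> \<eta> \<in> tuples M zs" for \<eta>
      using \<zeta>(1) tuples_subset_points by blast+
    \<comment> \<open>traces of \<open>u @ w\<close> for fixed \<open>u\<close>, given by nodes \<open>ql\<close>; then \<open>\<Theta>\<close> does the same for \<open>\<theta>\<close> and \<open>u\<close>, so that a
      countable type of codes \<open>(k, ql, k2, ql2)\<close> remains\<close>
    define \<theta> where "\<theta> k ql u z \<longleftrightarrow> tree k (tuples M zs) (\<lambda>w z. \<phi> (u @ w) z)
      {w \<in> X2. (\<forall>(\<eta>, s)\<in>set ql. \<phi> (u @ w) (\<zeta> \<eta>) \<longleftrightarrow> s) \<and> \<phi> (u @ w) z}"
      for k :: nat and ql :: "(bool list \<times> bool) list" and u z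
    define \<Theta> where "\<Theta> = (\<lambda>(k, ql, k2, ql2) z. tree k2 (tuples M zs) (\<theta> k ql)
      {u \<in> X1. (\<forall>(\<eta>, s)\<in>set ql2. \<theta> k ql u (\<zeta> \<eta>) \<longleftrightarrow> s) \<and> \<theta> k ql u z})"
    have \<theta>_dfn: "dfn2 (points M) ys1 zs (\<theta> k ql)" for k ql
    proof -
      let ?D = "points M"
      let ?c = "ys2 @ ys1 @ zs"
      have tw: "tm ?D ?c (take (length ys2)) ys2"
        "tm ?D ?c (\<lambda>e. take (length ys1) (drop (length ys2) e)) ys1"
        "tm ?D ?c (\<lambda>e. drop (length ys1) (drop (length ys2) e)) zs"
        by (rule tm_take, rule tm_drop[OF tm_take], rule tm_drop[OF tm_drop_id])
      have P: "dfn2 ?D ys2 (ys1 @ zs) (\<lambda>w e. w \<in> X2 \<and>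
        (\<forall>d\<in>set ql. \<phi> (take (length ys1) e @ w) (\<zeta> (fst d)) \<longleftrightarrow> snd d) \<and>
        \<phi> (take (length ys1) e @ w) (drop (length ys1) e))"
        unfolding dfn2_def
        by (intro dfn_conj dfn_ball_finite dfn_iff dfn_const dfn2_sub[OF \<phi>] tm_append tm_const tw
             \<zeta>p dfn_tm[OF d2 tw(1)] finite_set)
      have Q: "dfn3 ?D ys2 zs (ys1 @ zs) (\<lambda>w z e. \<phi> (take (length ys1) e @ w) z)"
        unfolding dfn3_def
        by (rule dfn2_sub[OF \<phi> tm_append], rule tm_drop[OF tm_drop[OF tm_take]], rule tm_take,
            rule tm_drop[OF tm_take])
      show ?thesis unfolding dfn2_def
        by (rule dfn_cong[OF dfn_tree[OF P Q, of k]])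
           (use T2 in \<open>auto simp: \<theta>_def split_beta intro!: arg_cong[of _ _ "tree k (tuples M zs) _"]\<close>)
    qed
    have "\<exists>c. \<forall>\<eta>. \<phi> y (\<zeta> \<eta>) \<longleftrightarrow> \<Theta> c (\<zeta> \<eta>)" if y: "y \<in> ?X" for y
    proof -
      have enc: "\<exists>ql. qs = map (\<lambda>(\<eta>, s). (\<zeta> \<eta>, s)) ql"
        if "fst ` set qs \<subseteq> range \<zeta>" for qs :: "('m list \<times> bool) list"
        using that
      proof (induction qs)
        case (Cons q qs)
        then obtain ql \<eta> where "qs = map (\<lambda>(\<eta>, s). (\<zeta> \<eta>, s)) ql" "fst q = \<zeta> \<eta>" by auto
        then show ?case by (intro exI[of _ "(\<eta>, snd q) # ql"]) (cases q; simp)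
      qed simp
      from y obtain u w where uw: "y = u @ w" "u \<in> X1" "w \<in> X2" by blast
      have "dfn2 (points M) ys2 zs (\<lambda>w z. \<phi> (u @ w) z)" unfolding dfn2_def
        using uw(2) T1 tuples_subset_points
        by (intro dfn2_sub[OF \<phi>] tm_append tm_const tm_take tm_drop_id) blast+
      from tree_boundedD[OF X2 this] obtain h where "\<not> tree h (tuples M zs) (\<lambda>w z. \<phi> (u @ w) z) X2" ..
      from trace_definable[OF this uw(3) \<zeta>(1)] obtain qs k where qs: "fst ` set qs \<subseteq> range \<zeta>"
        "\<forall>z\<in>range \<zeta>. \<phi> (u @ w) z \<longleftrightarrow> tree k (tuples M zs) (\<lambda>w z. \<phi> (u @ w) z)
           {w' \<in> X2. (\<forall>(q, s)\<in>set qs. \<phi> (u @ w') q \<longleftrightarrow> s) \<and> \<phi> (u @ w') z}" by blast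
      from enc[OF qs(1)] obtain ql where ql: "qs = map (\<lambda>(\<eta>, s). (\<zeta> \<eta>, s)) ql" ..
      have 1: "\<phi> y (\<zeta> \<eta>) \<longleftrightarrow> \<theta> k ql u (\<zeta> \<eta>)" for \<eta>
        using qs(2) by (simp add: \<theta>_def uw(1) ql split_beta)
      from tree_boundedD[OF X1 \<theta>_dfn] obtain h where "\<not> tree h (tuples M zs) (\<theta> k ql) X1" ..
      from trace_definable[OF this uw(2) \<zeta>(1)] obtain qs2 k2 where qs2: "fst ` set qs2 \<subseteq> range \<zeta>"
        "\<forall>z\<in>range \<zeta>. \<theta> k ql u z \<longleftrightarrow> tree k2 (tuples M zs) (\<theta> k ql)
           {u' \<in> X1. (\<forall>(q, s)\<in>set qs2. \<theta> k ql u' q \<longleftrightarrow> s) \<and> \<theta> k ql u' z}" by blast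
      from enc[OF qs2(1)] obtain ql2 where ql2: "qs2 = map (\<lambda>(\<eta>, s). (\<zeta> \<eta>, s)) ql2" ..
      have "\<theta> k ql u (\<zeta> \<eta>) \<longleftrightarrow> \<Theta> (k, ql, k2, ql2) (\<zeta> \<eta>)" for \<eta>
        using qs2(2) by (simp add: \<Theta>_def ql2 split_beta)
      with 1 show ?thesis by blast
    qed
    note trace = this
    have "\<exists>c. \<forall>n. \<sigma> n \<longleftrightarrow> \<Theta> c (\<zeta> (map \<sigma> [0..<n]))" for \<sigma> :: "nat \<Rightarrow> bool"
    proof -
      from spec[OF \<zeta>(2), of \<sigma>] obtain y where y: "y \<in> ?X"
        "\<forall>n. \<phi> y (\<zeta> (map \<sigma> [0..<n])) \<longleftrightarrow> \<sigma> n" by (rule bexE)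
      from trace[OF y(1)] obtain c where "\<forall>\<eta>. \<phi> y (\<zeta> \<eta>) \<longleftrightarrow> \<Theta> c (\<zeta> \<eta>)" ..
      with y(2) show ?thesis by (intro exI[of _ c]) simp
    qed
    then have "\<forall>\<sigma>::nat \<Rightarrow> bool. \<exists>c. \<forall>n. \<sigma> n \<longleftrightarrow> \<Theta> c (\<zeta> (map \<sigma> [0..<n]))" by (rule allI)
    from choice[OF this]
    obtain code :: "(nat \<Rightarrow> bool) \<Rightarrow> nat \<times> (bool list \<times> bool) list \<times> nat \<times> (bool list \<times> bool) list"
      where code: "\<forall>\<sigma> n. \<sigma> n \<longleftrightarrow> \<Theta> (code \<sigma>) (\<zeta> (map \<sigma> [0..<n]))" ..
    \<comment> \<open>two branches part at a common node, where equal codes would force equal turns\<close>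
    have "inj code"
    proof (rule injI, rule ccontr)
      fix \<sigma> \<tau> assume e: "code \<sigma> = code \<tau>" and "\<sigma> \<noteq> \<tau>"
      then have ex: "\<exists>n. \<sigma> n \<noteq> \<tau> n" by auto
      define n where "n = (LEAST n. \<sigma> n \<noteq> \<tau> n)"
      have n: "\<sigma> n \<noteq> \<tau> n" unfolding n_def using ex by (rule LeastI_ex)
      have "map \<sigma> [0..<n] = map \<tau> [0..<n]" unfolding n_def by (auto dest: not_less_Least)
      with n code[rule_format, of \<sigma> n] code[rule_format, of \<tau> n] e show False by simp
    qed
    then have "inj (to_nat \<circ> code \<circ> (\<lambda>S n. n \<in> S))"
      by (intro inj_compose) (auto intro!: injI simp: fun_eq_iff)
    then have "range (inv (to_nat \<circ> code \<circ> (\<lambda>S n. n \<in> S))) = Pow UNIV"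
      using inj_imp_surj_inv by simp
    then show False using Cantors_theorem[of "UNIV :: nat set"] by blast
  qed
  then show ?thesis unfolding tree_bounded_def definable_iff_dfn using XT dX by blast
qed

lemma tree_bounded_list_prod:
  assumes "\<And>i. i < n \<Longrightarrow> tree_bounded ys (X i)"
  shows "tree_bounded (concat (replicate n ys)) {concat (map y [0..<n]) | y. \<forall>i<n. y i \<in> X i}"
  using assms
proof (induction n)
  case 0
  then show ?case using tree_bounded_Nil by simp
next
  case (Suc n)
  let ?S = "\<lambda>n. {concat (map y [0..<n]) | y. \<forall>i<n. y i \<in> X i}"
  have "tree_bounded (concat (replicate n ys) @ ys) {u @ w | u w. u \<in> ?S n \<and> w \<in> X n}"
    by (rule tree_bounded_prod) (use Suc in auto)
  moreover have "concat (replicate n ys) @ ys = concat (replicate (Suc n) ys)"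
    by (simp flip: replicate_append_same)
  moreover have "{u @ w | u w. u \<in> ?S n \<and> w \<in> X n} = ?S (Suc n)"
  proof (intro set_eqI iffI; clarsimp)
    fix w y assume "\<forall>i<n. y i \<in> X i" "w \<in> X n"
    then show "\<exists>y'. concat (map y [0..<n]) @ w = concat (map y' [0..<n]) @ y' n \<and>
      (\<forall>i<Suc n. y' i \<in> X i)"
      by (intro exI[of _ "y(n := w)"]) (auto simp: less_Suc_eq intro!: arg_cong[of _ _ concat])
  next
    fix y assume "\<forall>i<Suc n. y i \<in> X i"
    then show "\<exists>u w. concat (map y [0..<n]) @ y n = u @ w \<and>
      (\<exists>y. u = concat (map y [0..<n]) \<and> (\<forall>i<n. y i \<in> X i)) \<and> w \<in> X n"
      by (intro exI[of _ "concat (map y [0..<n])"] exI[of _ "y n"]) auto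
  qed
  ultimately show ?case by simp
qed

end

section \<open>Blocks of a concatenated tuple\<close>

definition chunk :: "nat \<Rightarrow> nat \<Rightarrow> 'a list \<Rightarrow> 'a list" where
  "chunk l i e = take l (drop (i * l) e)"

lemma list_all2_replicate:
  "list_all2 P xs (replicate n y) \<longleftrightarrow> length xs = n \<and> (\<forall>x\<in>set xs. P x y)"
  by (auto simp: list_all2_conv_all_nth all_set_conv_all_nth)

lemma concat_map_const: "concat (map (\<lambda>_. ts) [0..<n]) = concat (replicate n ts)"
  by (simp add: map_replicate_const)

lemma length_concat_const:
  "(\<And>i. i < n \<Longrightarrow> length (y i) = l) \<Longrightarrow> length (concat (map y [0..<n])) = n * l"
  by (induction n) auto

lemma chunk_concat:
  assumes "\<And>i. i < n \<Longrightarrow> length (y i) = l" "i < n"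
  shows "chunk l i (concat (map y [0..<n])) = y i"
proof -
  have "[0..<n] = [0..<i] @ i # [Suc i..<n]"
    using assms(2) by (metis le0 upt_conv_Cons upt_add_eq_append le_add_diff_inverse less_imp_le_nat)
  then have e: "concat (map y [0..<n]) = concat (map y [0..<i]) @ y i @ concat (map y [Suc i..<n])"
    by simp
  have "length (concat (map y [0..<i])) = i * l"
    by (rule length_concat_const) (use assms in auto)
  then show ?thesis unfolding chunk_def e using assms by simp
qed

lemma concat_chunk: "length e = n * l \<Longrightarrow> concat (map (\<lambda>i. chunk l i e) [0..<n]) = e"
proof (induction n arbitrary: e)
  case (Suc n)
  have "chunk l i (take (n * l) e) = chunk l i e" if "i < n" for i
  proof -
    have "Suc i * l \<le> n * l" using that by (intro mult_le_mono1) simp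
    then have "min l (n * l - i * l) = l" by simp
    then show ?thesis by (simp add: chunk_def drop_take)
  qed
  then have "concat (map (\<lambda>i. chunk l i e) [0..<n]) = concat (map (\<lambda>i. chunk l i (take (n * l) e)) [0..<n])"
    by (intro arg_cong[of _ _ concat]) simp
  also have "\<dots> = take (n * l) e" by (rule Suc.IH) (use Suc.prems in simp)
  moreover have "chunk l n e = drop (n * l) e" using Suc.prems by (simp add: chunk_def)
  ultimately show ?case by simp
qed simp

lemma chunk_nth:
  assumes "\<And>a. a \<in> set as \<Longrightarrow> length a = l" "k < length as"
  shows "chunk l k (concat as) = as ! k"
  using chunk_concat[of "length as" "(!) as" l k] assms by (simp add: map_nth)

lemma chunk_drop: "chunk l k (drop (m * l) a) = chunk l (m + k) a"
  by (simp add: chunk_def add_mult_distrib add.commute)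

lemma concat_replicate_add: "concat (replicate (m + n) us) = concat (replicate m us) @ concat (replicate n us)"
  by (simp add: replicate_add)

context fo_structure begin

lemma tm_chunk: "i < n \<Longrightarrow> tm C (concat (replicate n ts)) (chunk (length ts) i) ts"
proof -
  assume i: "i < n"
  then have "concat (replicate n ts) =
    concat (replicate i ts) @ ts @ concat (replicate (n - Suc i) ts)"
    by (metis Suc_diff_Suc concat.simps(2) concat_append le_add_diff_inverse less_imp_le_nat
        replicate_Suc replicate_add)
  moreover have "length (concat (replicate i ts)) = i * length ts"
    by (simp add: length_concat sum_list_replicate)
  ultimately show ?thesis unfolding chunk_def[abs_def] using tm_slice by metis
qed

lemma tm_chunk_comp:
  "tm C ss t (concat (replicate n us)) \<Longrightarrow> i < n \<Longrightarrow> tm C ss (\<lambda>x. chunk (length us) i (t x)) us"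
  by (rule tm_comp[OF _ tm_chunk])

lemma tuples_concat_replicate:
  "(\<And>i. i < n \<Longrightarrow> y i \<in> tuples M ts) \<Longrightarrow> concat (map y [0..<n]) \<in> tuples M (concat (replicate n ts))"
  using tuples_concat[of n y M "\<lambda>_. ts"] by (simp add: concat_map_const)

lemma tuples_chunk:
  "e \<in> tuples M (concat (replicate n ts)) \<Longrightarrow> i < n \<Longrightarrow> chunk (length ts) i e \<in> tuples M ts"
  by (rule tm_range[OF tm_chunk])

lemma tuples_concat_chunk:
  assumes "e \<in> tuples M (concat (replicate n ts))"
  shows "concat (map (\<lambda>i. chunk (length ts) i e) [0..<n]) = e"
  by (rule concat_chunk)
     (use tuples_length[OF assms] in \<open>simp add: length_concat sum_list_replicate\<close>)

end

section \<open>Stable sets in a theory with NIP\<close>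

context fo_structure begin

lemma NIP_dfn:
  assumes "NIP L M" "dfn2 C ss ts R"
  shows "\<exists>n::nat. \<not> (\<exists>a b. (\<forall>i<n. a i \<in> tuples M ss) \<and> (\<forall>I\<subseteq>{..<n}. b I \<in> tuples M ts) \<and>
    (\<forall>i<n. \<forall>I\<subseteq>{..<n}. R (a i) (b I) \<longleftrightarrow> i \<in> I))"
proof -
  from assms(2) obtain \<phi> cs us where p: "cs \<in> tuples M us" "wff L ((ss @ ts) @ us) \<phi>"
    "\<forall>e\<in>tuples M (ss @ ts). R (take (length ss) e) (drop (length ss) e) \<longleftrightarrow> sat M (e @ cs) \<phi>"
    unfolding dfn2_def dfn_def by blast
  have R: "R x y \<longleftrightarrow> sat M (x @ y @ cs) \<phi>" if "x \<in> tuples M ss" "y \<in> tuples M ts" for x y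
    using p(3)[rule_format, OF tuples_append[OF that]] tuples_length[OF that(1)] by simp
  from assms(1)[unfolded NIP_def, rule_format, of ss "ts @ us" \<phi>] p(2)
  obtain n :: nat where n: "\<not> (\<exists>a b. (\<forall>i<n. a i \<in> tuples M ss) \<and>
    (\<forall>I\<subseteq>{..<n}. b I \<in> tuples M (ts @ us)) \<and>
    (\<forall>i<n. \<forall>I\<subseteq>{..<n}. sat M (a i @ b I) \<phi> \<longleftrightarrow> i \<in> I))"
    unfolding append_assoc by blast
  show ?thesis
  proof (rule exI[of _ n], clarify)
    fix a b assume a: "\<forall>i<n. a i \<in> tuples M ss" and b: "\<forall>I\<subseteq>{..<n}. b I \<in> tuples M ts"
      and ab: "\<forall>i<n. \<forall>I\<subseteq>{..<n}. R (a i) (b I) \<longleftrightarrow> i \<in> I"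
    have "\<forall>I\<subseteq>{..<n}. b I @ cs \<in> tuples M (ts @ us)" using b p(1) by (auto intro: tuples_append)
    moreover have "\<forall>i<n. \<forall>I\<subseteq>{..<n}. sat M (a i @ b I @ cs) \<phi> \<longleftrightarrow> i \<in> I"
      using ab R a b by simp
    ultimately show False using n a by (auto dest!: spec[of _ a] spec[of _ "\<lambda>I. b I @ cs"])
  qed
qed

text \<open>In the induced structure variables can be permuted, so stability applies to \<open>R\<close> with any one of its
  arguments separated from the others.\<close>

lemma stable_set_rel:
  assumes "stable_set L M C X" "R \<subseteq> power_set X m" "definable_relation L M C R" "Suc i < m"
  shows "\<exists>n::nat. \<not> (\<exists>a b. (\<forall>s<n. a s \<in> power_set X (m - 1) \<and> b s \<in> X) \<and>
    (\<forall>s<n. \<forall>t<n. take (Suc i) (a s) @ b t # drop (Suc i) (a s) \<in> R \<longleftrightarrow> s < t))"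
proof -
  let ?args = "map Var [0..<Suc i] @ Var (m - 1) # map Var [Suc i..<m - 1]"
  let ?ss = "replicate (m - 1) ()" and ?M = "induced_structure X" and ?L = "induced_language L M C X"
  have m: "length ?args = m" using assms(4) by simp
  have "term_sort ?L (?ss @ [()]) t ()" if "t \<in> set ?args" for t
  proof -
    from that obtain j where j: "t = Var j" "j < m" using assms(4) by auto
    then have "j < length (?ss @ [()])" by simp
    from term_sort_Var[OF this, of ?L] j(1) show ?thesis by simp
  qed
  then have "list_all2 (term_sort ?L (?ss @ [()])) ?args (replicate m ())"
    using m unfolding list_all2_replicate by blast
  then have "wff ?L (?ss @ [()]) (Rel (m, R) ?args)"
    using assms(2,3) by (simp add: induced_language_def)
  from assms(1)[unfolded stable_set_def stable_structure_def, rule_format, OF this]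
  obtain n :: nat where n: "\<not> (\<exists>a b.
    (\<forall>i<n. a i \<in> tuples ?M ?ss \<and> b i \<in> tuples ?M [()]) \<and>
    (\<forall>i<n. \<forall>j<n. sat ?M (a i @ b j) (Rel (m, R) ?args) \<longleftrightarrow> i < j))" ..
  show ?thesis
  proof (rule exI[of _ n], clarify)
    fix a b assume ab: "\<forall>s<n. a s \<in> power_set X (m - 1) \<and> b s \<in> X"
      "\<forall>s<n. \<forall>t<n. take (Suc i) (a s) @ b t # drop (Suc i) (a s) \<in> R \<longleftrightarrow> s < t"
    have l: "length (a s) = m - 1" if "s < n" for s using ab(1) that by (auto simp: power_set_def)
    have e: "map (eval_term ?M (a s @ [b t])) ?args = take (Suc i) (a s) @ b t # drop (Suc i) (a s)"
      if "s < n" for s t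
    proof -
      note l = l[OF that]
      have "map (eval_term ?M (a s @ [b t])) (map Var [0..<Suc i]) = take (Suc i) (a s)"
        by (rule nth_equalityI) (use l assms(4) in \<open>auto simp: nth_append simp del: upt_Suc\<close>)
      moreover have "map (eval_term ?M (a s @ [b t])) (map Var [Suc i..<m - 1]) = drop (Suc i) (a s)"
        by (rule nth_equalityI) (use l assms(4) in \<open>auto simp: nth_append\<close>)
      moreover have "eval_term ?M (a s @ [b t]) (Var (m - 1)) = b t"
        using l by (simp add: nth_append)
      ultimately show ?thesis by (simp del: upt_Suc)
    qed
    have "sat ?M (a s @ [b t]) (Rel (m, R) ?args) \<longleftrightarrow> s < t" if "s < n" "t < n" for s t
      unfolding sat.simps e[OF that(1)] using ab(2) that by (simp add: induced_structure_def)
    moreover have "a s \<in> tuples ?M ?ss \<and> [b s] \<in> tuples ?M [()]" if "s < n" for s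
      using ab(1) that
      by (auto simp: tuples_def induced_structure_def list_all2_replicate power_set_def)
    ultimately show False
      by - (rule notE[OF n], rule exI[of _ a], rule exI[of _ "\<lambda>j. [b j]"], intro conjI allI impI; blast)
  qed
qed

text \<open>A tuple \<open>y\<close> is an element of the quotient \<open>X\<close> if its class is \<open>{y}\<close>, and being alone in a class of a
  definable equivalence relation is definable.\<close>

lemma definable_singletons:
  assumes "imaginary_set L M C X"
  shows "definable L M C ts {y \<in> tuples M ts. {y} \<in> X}"
proof -
  from assms obtain ss D E where DE: "definable L M C ss D" "definable2 L M C ss E" "equiv D E"
    "X = D // E" unfolding imaginary_set_def by blast
  have DT: "D \<subseteq> tuples M ss" using DE(1) by (simp add: definable_iff_dfn)
  show ?thesis
  proof (cases "ts = ss")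
    case True
    from DE(2) have E: "E \<subseteq> tuples M ss \<times> tuples M ss"
      "definable L M C (ss @ ss) {x @ y | x y. (x, y) \<in> E}" unfolding definable2_def by auto
    have Em: "x @ y \<in> {x @ y | x y. (x, y) \<in> E} \<longleftrightarrow> (x, y) \<in> E"
      if "x \<in> tuples M ss" "y \<in> tuples M ss" for x y
    proof
      assume "x @ y \<in> {x @ y | x y. (x, y) \<in> E}"
      then obtain x' y' where e: "x @ y = x' @ y'" "(x', y') \<in> E" by blast
      then have "x' \<in> tuples M ss" using E(1) by blast
      with that(1) e(1) have "x = x'" "y = y'"
        using tuples_length[of x M ss] tuples_length[of x' M ss] by simp_all
      with e(2) show "(x, y) \<in> E" by simp
    qed blast
    have *: "{y} \<in> X \<longleftrightarrow> y \<in> D \<and> (\<forall>y'\<in>tuples M ss. (y, y') \<in> E \<longrightarrow> y' = y)"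
      if y: "y \<in> tuples M ss" for y
    proof
      assume "{y} \<in> X"
      then obtain x where x: "x \<in> D" "{y} = E `` {x}" unfolding DE(4) by (auto elim: quotientE)
      then have "(x, x) \<in> E" using DE(3) by (meson equivE refl_onD)
      then have "x = y" using x(2) by blast
      with x show "y \<in> D \<and> (\<forall>y'\<in>tuples M ss. (y, y') \<in> E \<longrightarrow> y' = y)" by blast
    next
      assume a: "y \<in> D \<and> (\<forall>y'\<in>tuples M ss. (y, y') \<in> E \<longrightarrow> y' = y)"
      then have "(y, y) \<in> E" using DE(3) by (meson equivE refl_onD)
      with a E(1) have "E `` {y} = {y}" by blast
      with a show "{y} \<in> X" unfolding DE(4) by (metis quotientI)
    qed
    have Ed: "dfn2 C ss ss (\<lambda>x y. (x, y) \<in> E)" unfolding dfn2_def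
    proof (rule dfn_cong)
      show "dfn C (ss @ ss) (\<lambda>e. e \<in> {x @ y | x y. (x, y) \<in> E})"
        using E(2) by (simp add: definable_iff_dfn)
      show "e \<in> {x @ y | x y. (x, y) \<in> E} \<longleftrightarrow> (take (length ss) e, drop (length ss) e) \<in> E"
        if "e \<in> tuples M (ss @ ss)" for e
        using Em[OF tuples_take[OF that] tuples_drop[OF that]] by simp
    qed
    have "dfn C ss (\<lambda>y. y \<in> D \<and> (\<forall>y'\<in>tuples M ss. (y, y') \<in> E \<longrightarrow> y' = y))"
      by (intro dfn_conj dfn_all dfn_imp dfn2_sub[OF Ed] dfn_eq[where us = ss] tm_take tm_drop_id
          dfn_mem[OF DE(1) tm_id])
    then have "dfn C ss (\<lambda>y. {y} \<in> X)" by (rule dfn_cong) (simp add: *)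
    then show ?thesis unfolding True by (rule dfn_imp_definable)
  next
    case False
    have "{y} \<notin> X" if "y \<in> tuples M ts" for y
    proof
      assume "{y} \<in> X"
      then obtain x where x: "x \<in> D" "{y} = E `` {x}" unfolding DE(4) by (auto elim: quotientE)
      have "(x, x) \<in> E" using x(1) DE(3) by (meson equivE refl_onD)
      then have "x \<in> {y}" unfolding x(2) by simp
      with x(1) DT have "y \<in> tuples M ss" by auto
      from tuples_unique[OF that this] False show False by simp
    qed
    then have "dfn C ts (\<lambda>y. {y} \<in> X)" by (intro dfn_cong[OF dfn_const[of C ts False]]) simp_all
    then show ?thesis by (rule dfn_imp_definable)
  qed
qed

text \<open>A subset of size \<open>m\<close> is coloured by the value of \<open>F\<close> at its increasing enumeration; \<open>h\<close> enumerates a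
  monochromatic set.\<close>

lemma ramsey_increasing:
  fixes V :: "'c set" and m K :: nat
  assumes "finite V"
  shows "\<exists>N::nat. \<forall>F. (\<forall>\<iota>. F (map \<iota> [0..<m]) \<in> V) \<longrightarrow>
    (\<exists>h W. (\<forall>k<K. h k < N) \<and> (\<forall>j k. j < k \<longrightarrow> k < K \<longrightarrow> h j < h k) \<and>
      (\<forall>\<iota>. (\<forall>q<m. \<iota> q < K) \<longrightarrow> (\<forall>p q. p < q \<longrightarrow> q < m \<longrightarrow> \<iota> p < \<iota> q) \<longrightarrow>
        F (map (\<lambda>q. h (\<iota> q)) [0..<m]) = W))"
proof -
  obtain g where g: "bij_betw g V {0..<card V}" using ex_bij_betw_finite_nat[OF assms] ..
  obtain N :: nat where N: "partn_lst {..<N} (replicate (card V) K) m" using ramsey_full by blast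
  show ?thesis
  proof (rule exI[of _ N], intro allI impI)
    fix F :: "nat list \<Rightarrow> 'c" assume F: "\<forall>\<iota>. F (map \<iota> [0..<m]) \<in> V"
    define f where "f S = g (F (sorted_list_of_set S))" for S :: "nat set"
    have f: "f \<in> nsets {..<N} m \<rightarrow> {..<length (replicate (card V) K)}"
    proof
      fix S assume "S \<in> nsets {..<N} m"
      then have S: "length (sorted_list_of_set S) = m" by (auto simp: nsets_def)
      have "map ((!) (sorted_list_of_set S)) [0..<m] = sorted_list_of_set S"
        using map_nth[of "sorted_list_of_set S"] S by simp
      then have "F (sorted_list_of_set S) \<in> V" using F by metis
      with g have "g (F (sorted_list_of_set S)) \<in> {0..<card V}" using bij_betwE by blast
      then show "f S \<in> {..<length (replicate (card V) K)}" by (simp add: f_def)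
    qed
    from N f obtain i where i: "i < card V" "monochromatic {..<N} K m f i"
      unfolding partn_lst_def by fastforce
    then obtain H where H: "H \<in> nsets {..<N} K" "f ` nsets H m \<subseteq> {i}"
      unfolding monochromatic_def by blast
    have Hf: "finite H" "card H = K" "H \<subseteq> {..<N}" using H(1) by (auto simp: nsets_def)
    define h where "h k = sorted_list_of_set H ! k" for k
    have hl: "length (sorted_list_of_set H) = K" using Hf by simp
    have hH: "h k \<in> H" if "k < K" for k
      using that hl Hf(1) unfolding h_def by (metis nth_mem set_sorted_list_of_set)
    have hm: "h j < h k" if "j < k" "k < K" for j k
      using strict_sorted_list_of_set[of H] that hl sorted_wrt_nth_less unfolding h_def by metis
    define W where "W = inv_into V g i"
    have "F (map (\<lambda>q. h (\<iota> q)) [0..<m]) = W"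
      if \<iota>: "\<forall>q<m. \<iota> q < K" "\<forall>p q. p < q \<longrightarrow> q < m \<longrightarrow> \<iota> p < \<iota> q" for \<iota>
    proof -
      let ?l = "map (\<lambda>q. h (\<iota> q)) [0..<m]"
      have sw: "sorted_wrt (<) ?l" unfolding sorted_wrt_iff_nth_less using \<iota> hm by auto
      then have "sorted ?l" "distinct ?l" by (simp_all add: strict_sorted_iff)
      then have s: "sorted_list_of_set (set ?l) = ?l"
        by (rule sorted_list_of_set.idem_if_sorted_distinct)
      have "set ?l \<in> nsets H m" using \<iota>(1) hH distinct_card[OF \<open>distinct ?l\<close>]
        by (auto simp: nsets_def)
      with H(2) have "f (set ?l) = i" by blast
      then have "g (F ?l) = i" unfolding f_def s .
      moreover have "F ?l \<in> V" using F[rule_format, of "\<lambda>q. h (\<iota> q)"] .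
      ultimately show ?thesis unfolding W_def
        using bij_betw_imp_inj_on[OF g] by (metis inv_into_f_f)
    qed
    moreover have "\<forall>k<K. h k < N" using hH Hf(3) by auto
    ultimately show "\<exists>h W. (\<forall>k<K. h k < N) \<and> (\<forall>j k. j < k \<longrightarrow> k < K \<longrightarrow> h j < h k) \<and>
      (\<forall>\<iota>. (\<forall>q<m. \<iota> q < K) \<longrightarrow> (\<forall>p q. p < q \<longrightarrow> q < m \<longrightarrow> \<iota> p < \<iota> q) \<longrightarrow>
        F (map (\<lambda>q. h (\<iota> q)) [0..<m]) = W)"
      using hm by (intro exI[of _ h] exI[of _ W]) blast
  qed
qed

lemma initial_segment:
  fixes w :: "nat set"
  assumes "finite w" "\<And>i. Suc i \<in> w \<Longrightarrow> i \<in> w"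
  shows "w = {..<card w}"
proof -
  have down: "j \<in> w" if "i \<in> w" "j \<le> i" for i j
    using that(2,1) by (induction i rule: dec_induct) (auto intro: assms(2))
  define k where "k = (LEAST k. k \<notin> w)"
  have "\<exists>k. k \<notin> w" using assms(1) ex_new_if_finite infinite_UNIV_nat by blast
  then have k: "k \<notin> w" unfolding k_def by (rule LeastI_ex)
  have "w = {..<k}"
  proof (intro set_eqI iffI)
    fix i assume "i \<in> w"
    with down[of i k] k have "\<not> k \<le> i" by blast
    then show "i \<in> {..<k}" by simp
  next
    fix i assume "i \<in> {..<k}" then show "i \<in> w" unfolding k_def using not_less_Least by auto
  qed
  then show ?thesis by simp
qed

text \<open>Otherwise take a long half graph that is homogeneous for the relations
  \<open>\<Psi> w\<close>: some \<open>z\<close> is \<open>\<phi>\<close>-related to exactly the entries of an \<open>m\<close>-tuple with index in \<open>w\<close>.  On increasing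
  tuples, \<open>\<Psi> w\<close> holds for initial segments \<open>w\<close> but, by NIP, not for all \<open>w\<close>.  So two patterns that
  differ by exchanging neighbours \<open>i\<close>, \<open>i + 1\<close> have different truth values, and then \<open>\<Psi> w\<close> orders
  the entries in places \<open>i\<close>, \<open>i + 1\<close>, contradicting stability of the induced structure.\<close>

lemma stable_imp_no_long_ladder:
  assumes nip: "NIP L M" and X: "stable_set L M C X"
    and Y: "Y = {y \<in> tuples M ts. {y} \<in> X}" and Yd: "definable L M C ts Y"
    and \<phi>: "dfn2 C ts zs \<phi>"
  shows "\<exists>N::nat. \<not> (\<exists>y z. (\<forall>i<N. y i \<in> Y \<and> z i \<in> tuples M zs) \<and>
    (\<forall>i<N. \<forall>j<N. \<phi> (y i) (z j) \<longleftrightarrow> i < j))"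
proof (rule ccontr)
  assume "\<not> ?thesis"
  then have ladder: "\<exists>y z. (\<forall>i<N. y i \<in> Y \<and> z i \<in> tuples M zs) \<and>
    (\<forall>i<N. \<forall>j<N. \<phi> (y i) (z j) \<longleftrightarrow> i < j)" for N :: nat by blast
  obtain m :: nat where m: "\<not> (\<exists>a b. (\<forall>i<m. a i \<in> tuples M ts) \<and>
    (\<forall>I\<subseteq>{..<m}. b I \<in> tuples M zs) \<and> (\<forall>i<m. \<forall>I\<subseteq>{..<m}. \<phi> (a i) (b I) \<longleftrightarrow> i \<in> I))"
    using NIP_dfn[OF nip \<phi>] by blast
  \<comment> \<open>by the choice of \<open>m\<close> no tuple satisfies all of these at once\<close>
  define \<Psi> where "\<Psi> w g \<longleftrightarrow> (\<exists>z\<in>tuples M zs. \<forall>i<m. \<phi> (g i) z \<longleftrightarrow> i \<in> w)"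
    for w :: "nat set" and g :: "nat \<Rightarrow> 'm list"
  have \<Psi>_cong: "\<Psi> w g \<longleftrightarrow> \<Psi> w g'" if "\<And>q. q < m \<Longrightarrow> g q = g' q" for w g g'
    using that by (simp add: \<Psi>_def)
  define R where "R w = {map (\<lambda>i. {y i}) [0..<m] | y. (\<forall>i<m. y i \<in> Y) \<and> \<Psi> w y}" for w
  have R_pow: "R w \<subseteq> power_set X m" for w unfolding R_def power_set_def Y by auto
  have R_iff: "map (\<lambda>i. {y i}) [0..<m] \<in> R w \<longleftrightarrow> \<Psi> w y" if "\<And>i. i < m \<Longrightarrow> y i \<in> Y" for y w
  proof
    assume "map (\<lambda>i. {y i}) [0..<m] \<in> R w"
    then obtain y' where y': "map (\<lambda>i. {y i}) [0..<m] = map (\<lambda>i. {y' i}) [0..<m]" "\<Psi> w y'"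
      unfolding R_def by blast
    then have "y i = y' i" if "i < m" for i using that by (auto simp: list_eq_iff_nth_eq)
    with y'(2) show "\<Psi> w y" using \<Psi>_cong[of y y' w] by blast
  next
    assume "\<Psi> w y" with that show "map (\<lambda>i. {y i}) [0..<m] \<in> R w" unfolding R_def by blast
  qed
  let ?l = "length ts" and ?ss = "concat (replicate m ts)"
  have R_dfn: "definable_relation L M C (R w)" for w
  proof -
    have "dfn C ?ss (\<lambda>e. (\<forall>i<m. chunk ?l i e \<in> Y) \<and>
      (\<exists>z\<in>tuples M zs. \<forall>i<m. \<phi> (chunk ?l i e) z \<longleftrightarrow> i \<in> w))"
      by (intro dfn_conj dfn_all_less dfn_ex dfn_iff dfn_const dfn_mem[OF Yd] dfn2_sub[OF \<phi>]
          tm_take tm_drop tm_chunk)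
    from dfn_imp_definable[OF this]
    have "definable L M C ?ss {e \<in> tuples M ?ss. (\<forall>i<m. chunk ?l i e \<in> Y) \<and>
      \<Psi> w (\<lambda>i. chunk ?l i e)}" unfolding \<Psi>_def .
    moreover have "{e \<in> tuples M ?ss. (\<forall>i<m. chunk ?l i e \<in> Y) \<and> \<Psi> w (\<lambda>i. chunk ?l i e)} =
      {concat xs | xs ks. ks \<in> R w \<and> list_all2 (\<in>) xs ks}" (is "?A = ?B")
    proof (intro set_eqI iffI)
      fix e assume "e \<in> ?A"
      then have e: "e \<in> tuples M ?ss" "\<forall>i<m. chunk ?l i e \<in> Y" "\<Psi> w (\<lambda>i. chunk ?l i e)" by auto
      let ?xs = "map (\<lambda>i. chunk ?l i e) [0..<m]"
      have "map (\<lambda>i. {chunk ?l i e}) [0..<m] \<in> R w" using e by (subst R_iff) auto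
      moreover have "list_all2 (\<in>) ?xs (map (\<lambda>i. {chunk ?l i e}) [0..<m])"
        by (auto simp: list_all2_conv_all_nth)
      moreover have "concat ?xs = e" by (rule tuples_concat_chunk[OF e(1)])
      ultimately show "e \<in> ?B" by (metis (mono_tags, lifting) mem_Collect_eq)
    next
      fix e assume "e \<in> ?B"
      then obtain xs ks where xs: "e = concat xs" "ks \<in> R w" "list_all2 (\<in>) xs ks" by blast
      then obtain y where y: "ks = map (\<lambda>i. {y i}) [0..<m]" "\<forall>i<m. y i \<in> Y" "\<Psi> w y"
        unfolding R_def by blast
      have "xs = map y [0..<m]"
        by (rule nth_equalityI) (use xs(3) y(1) in \<open>auto simp: list_all2_conv_all_nth\<close>)
      with xs(1) have e: "e = concat (map y [0..<m])" by simp
      have yT: "y i \<in> tuples M ts" if "i < m" for i using y(2) that Y by blast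
      have c: "chunk ?l i e = y i" if "i < m" for i
        unfolding e by (rule chunk_concat) (use yT that tuples_length in auto)
      have "\<Psi> w (\<lambda>i. chunk ?l i e)" using y(3) \<Psi>_cong[of "\<lambda>i. chunk ?l i e" y w] c by blast
      then show "e \<in> ?A" using c y(2) tuples_concat_replicate[of m y ts] yT e by auto
    qed
    ultimately show ?thesis unfolding definable_relation_def by (intro exI[of _ ?ss]) simp
  qed
  have "\<exists>n::nat. \<not> (\<exists>a b. (\<forall>s<n. a s \<in> power_set X (m - 1) \<and> b s \<in> X) \<and>
    (\<forall>s<n. \<forall>t<n. take (Suc i) (a s) @ b t # drop (Suc i) (a s) \<in> R w \<longleftrightarrow> s < t))"
    if "Suc i < m" for i w by (rule stable_set_rel[OF X R_pow R_dfn that])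
  then obtain nn :: "nat \<Rightarrow> nat set \<Rightarrow> nat" where nn: "\<And>i w. Suc i < m \<Longrightarrow>
    \<not> (\<exists>a b. (\<forall>s<nn i w. a s \<in> power_set X (m - 1) \<and> b s \<in> X) \<and>
    (\<forall>s<nn i w. \<forall>t<nn i w. take (Suc i) (a s) @ b t # drop (Suc i) (a s) \<in> R w \<longleftrightarrow> s < t))"
    by metis
  define n where "n = (\<Sum>i<m. \<Sum>w\<in>Pow {..<m}. nn i w)"
  have nn_le: "nn i w \<le> n" if "i < m" "w \<subseteq> {..<m}" for i w
  proof -
    have "nn i w \<le> (\<Sum>w\<in>Pow {..<m}. nn i w)" by (rule member_le_sum) (use that in auto)
    also have "\<dots> \<le> n" unfolding n_def by (rule member_le_sum) (use that in auto)
    finally show ?thesis .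
  qed
  define K where "K = m + 2 * n"
  let ?P = "Pow {..<m}"
  have "finite (Pow ?P)" by simp
  from ramsey_increasing[OF this, of m K] obtain N :: nat where N: "\<forall>F. (\<forall>\<iota>. F (map \<iota> [0..<m]) \<in> Pow ?P) \<longrightarrow>
    (\<exists>h W. (\<forall>k<K. h k < N) \<and> (\<forall>j k. j < k \<longrightarrow> k < K \<longrightarrow> h j < h k) \<and>
      (\<forall>\<iota>. (\<forall>q<m. \<iota> q < K) \<longrightarrow> (\<forall>p q. p < q \<longrightarrow> q < m \<longrightarrow> \<iota> p < \<iota> q) \<longrightarrow>
        F (map (\<lambda>q. h (\<iota> q)) [0..<m]) = W))" ..
  from ladder[of "Suc N"] obtain y z where
    yz: "\<forall>i<Suc N. y i \<in> Y \<and> z i \<in> tuples M zs"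
      "\<forall>i<Suc N. \<forall>j<Suc N. \<phi> (y i) (z j) \<longleftrightarrow> i < j" by blast
  define F where "F is = {w \<in> ?P. \<Psi> w (\<lambda>q. y (is ! q))}" for "is"
  have "\<forall>\<iota>. F (map \<iota> [0..<m]) \<in> Pow ?P" by (auto simp: F_def)
  from mp[OF spec[OF N, of F] this] obtain h W where h: "\<forall>k<K. h k < N" "\<forall>j k. j < k \<longrightarrow> k < K \<longrightarrow> h j < h k"
    and W: "\<forall>\<iota>. (\<forall>q<m. \<iota> q < K) \<longrightarrow> (\<forall>p q. p < q \<longrightarrow> q < m \<longrightarrow> \<iota> p < \<iota> q) \<longrightarrow>
      F (map (\<lambda>q. h (\<iota> q)) [0..<m]) = W" by (elim exE conjE)
  define G where "G k = y (h k)" for k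
  have hS: "h k < Suc N" if "k < K" for k using h(1) that by (blast intro: less_SucI)
  have GY: "G k \<in> Y" if "k < K" for k unfolding G_def using yz(1) hS[OF that] by blast
  have GW: "\<Psi> w (\<lambda>q. G (\<iota> q)) \<longleftrightarrow> w \<in> W"
    if "\<forall>q<m. \<iota> q < K" "\<forall>p q. p < q \<longrightarrow> q < m \<longrightarrow> \<iota> p < \<iota> q" "w \<subseteq> {..<m}" for \<iota> w
  proof -
    have "w \<in> W \<longleftrightarrow> \<Psi> w (\<lambda>q. y (map (\<lambda>q. h (\<iota> q)) [0..<m] ! q))"
      using W[rule_format, of \<iota>] that unfolding F_def by blast
    also have "\<dots> \<longleftrightarrow> \<Psi> w (\<lambda>q. G (\<iota> q))" by (rule \<Psi>_cong) (simp add: G_def)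
    finally show ?thesis by simp
  qed
  have init: "{..<k} \<in> W" if "k \<le> m" for k
  proof -
    define j where "j = (if k < m then h k else N)"
    have j: "j < Suc N" using hS[of k] by (auto simp: j_def K_def)
    have "h q < j \<longleftrightarrow> q < k" if "q < m" for q
    proof (cases "k < m")
      case True
      have "h q < h k" if "q < k" using h(2) that True by (simp add: K_def)
      moreover have "h k < h q" if "k < q" using h(2) that \<open>q < m\<close> by (simp add: K_def)
      ultimately show ?thesis using True by (auto simp: j_def) (metis less_asym' linorder_neqE_nat)
    next
      case False
      with that \<open>k \<le> m\<close> h(1) show ?thesis by (simp add: j_def K_def)
    qed
    then have "\<forall>q<m. \<phi> (G q) (z j) \<longleftrightarrow> q \<in> {..<k}"
      using yz(2) j hS unfolding G_def by (simp add: K_def)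
    then have "\<Psi> {..<k} (\<lambda>q. G q)" unfolding \<Psi>_def using yz(1) j by blast
    then show ?thesis by (subst GW[symmetric, of "\<lambda>q. q"]) (use that in \<open>auto simp: K_def\<close>)
  qed
  have "\<exists>w. w \<subseteq> {..<m} \<and> w \<notin> W"
  proof (rule ccontr)
    assume "\<not> ?thesis"
    then have "\<Psi> w (\<lambda>q. G q)" if "w \<subseteq> {..<m}" for w
      using that GW[of "\<lambda>q. q" w] by (auto simp: K_def)
    then have "\<forall>w. \<exists>z. w \<subseteq> {..<m} \<longrightarrow> z \<in> tuples M zs \<and> (\<forall>i<m. \<phi> (G i) z \<longleftrightarrow> i \<in> w)"
      unfolding \<Psi>_def by blast
    then obtain b where "\<forall>w. w \<subseteq> {..<m} \<longrightarrow> b w \<in> tuples M zs \<and> (\<forall>i<m. \<phi> (G i) (b w) \<longleftrightarrow> i \<in> w)"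
      by metis
    moreover have "\<forall>i<m. G i \<in> tuples M ts" using GY Y by (auto simp: K_def)
    ultimately show False by - (rule notE[OF m], rule exI[of _ G], rule exI[of _ b], blast)
  qed
  then obtain w0 where "w0 \<subseteq> {..<m} \<and> w0 \<notin> W" ..
  \<comment> \<open>take a failing pattern with the least sum of indices: exchanging an index with an absent predecessor
    lowers the sum, hence gives a pattern that holds\<close>
  from ex_has_least_nat[of "\<lambda>w. w \<subseteq> {..<m} \<and> w \<notin> W", OF this, of "\<lambda>w. \<Sum>w"]
  obtain w where w: "w \<subseteq> {..<m}" "w \<notin> W"
    and min: "\<forall>v. v \<subseteq> {..<m} \<and> v \<notin> W \<longrightarrow> \<Sum>w \<le> \<Sum>v" by (elim exE conjE)
  have fw: "finite w" using w(1) finite_subset by blast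
  have "\<exists>i. Suc i \<in> w \<and> i \<notin> w"
  proof (rule ccontr)
    assume "\<not> ?thesis"
    with initial_segment[OF fw] have "w = {..<card w}" by blast
    moreover have "card w \<le> m" using card_mono[OF _ w(1)] by simp
    ultimately show False using init w(2) by metis
  qed
  then obtain i where i: "Suc i \<in> w" "i \<notin> w" by blast
  have im: "Suc i < m" using i(1) w(1) by auto
  define v where "v = insert i (w - {Suc i})"
  have v: "v \<subseteq> {..<m}" using w(1) im by (auto simp: v_def)
  have "\<Sum>w = Suc i + \<Sum>(w - {Suc i})" using fw i(1) by (simp add: sum.remove)
  moreover have "\<Sum>v = i + \<Sum>(w - {Suc i})" unfolding v_def using fw i(2) by simp
  ultimately have vW: "v \<in> W" using min[rule_format, of v] v by fastforce
  \<comment> \<open>places before \<open>i\<close> get the first entries of \<open>G\<close>, places after \<open>i + 1\<close> the last ones, and \<open>2 n\<close>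
    entries are left for the places \<open>i\<close> and \<open>i + 1\<close>\<close>
  define J where "J s t q = (if q < i then q else if q = i then i + 2 * s + 1
    else if q = Suc i then i + 2 * t else 2 * n + q)" for s t q :: nat
  have J_less: "J s t q < K" if "q < m" "s < n" "t < n" for s t q
    using that im by (auto simp: J_def K_def)
  have order: "\<Psi> v (\<lambda>q. G (J s t q)) \<longleftrightarrow> s < t" if st: "s < n" "t < n" for s t
  proof (cases "s < t")
    case True
    have "\<Psi> v (\<lambda>q. G (J s t q)) \<longleftrightarrow> v \<in> W"
      by (rule GW) (use J_less st v True in \<open>auto simp: J_def\<close>)
    with vW True show ?thesis by simp
  next
    case False
    define J' where "J' q = (if q < i then q else if q = i then i + 2 * t
      else if q = Suc i then i + 2 * s + 1 else 2 * n + q)" for q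
    have J'_less: "J' q < K" if "q < m" for q
      using that im st by (auto simp: J'_def K_def)
    have "\<Psi> w (\<lambda>q. G (J' q)) \<longleftrightarrow> w \<in> W"
      by (rule GW) (use J'_less st w False in \<open>auto simp: J'_def\<close>)
    moreover have "(\<forall>q<m. \<phi> (G (J s t q)) z \<longleftrightarrow> q \<in> v) \<longleftrightarrow> (\<forall>q<m. \<phi> (G (J' q)) z \<longleftrightarrow> q \<in> w)" for z
    proof -
      define \<tau> where "\<tau> q = (if q = i then Suc i else if q = Suc i then i else q)" for q
      have sw: "J s t q = J' (\<tau> q)" "q \<in> v \<longleftrightarrow> \<tau> q \<in> w" "\<tau> q < m \<longleftrightarrow> q < m" "\<tau> (\<tau> q) = q" for q
        using i im by (auto simp: J_def J'_def v_def \<tau>_def)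
      show ?thesis unfolding sw(1,2) by (metis sw(3,4))
    qed
    ultimately show ?thesis using False w(2) unfolding \<Psi>_def by simp
  qed
  define a where "a s = map (\<lambda>q. {G (if q \<le> i then J s 0 q else J s 0 (Suc q))}) [0..<m - 1]" for s
  define b where "b t = {G (i + 2 * t)}" for t
  have ab: "take (Suc i) (a s) @ b t # drop (Suc i) (a s) = map (\<lambda>q. {G (J s t q)}) [0..<m]" for s t
    by (rule nth_equalityI) (use im in \<open>auto simp: a_def b_def J_def nth_append nth_Cons min_def
      intro!: arg_cong[of _ _ G] split: nat.splits\<close>)
  have GX: "{G k} \<in> X" if "k < K" for k using GY[OF that] Y by blast
  have 1: "a s \<in> power_set X (m - 1) \<and> b s \<in> X" if "s < n" for s
    using GX J_less that im by (auto simp: a_def b_def power_set_def K_def)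
  have 2: "take (Suc i) (a s) @ b t # drop (Suc i) (a s) \<in> R v \<longleftrightarrow> s < t"
    if "s < n" "t < n" for s t
    unfolding ab using order[OF that] J_less that GY by (subst R_iff) auto
  have "nn i v \<le> n" by (rule nn_le) (use im v in auto)
  then have le: "s < n" if "s < nn i v" for s using that by simp
  have A: "\<forall>s<nn i v. a s \<in> power_set X (m - 1) \<and> b s \<in> X"
    by (intro allI impI 1 le)
  have B: "\<forall>s<nn i v. \<forall>t<nn i v. take (Suc i) (a s) @ b t # drop (Suc i) (a s) \<in> R v \<longleftrightarrow> s < t"
    by (intro allI impI 2 le)
  show False
    by (rule notE[OF nn[OF im, of v]], rule exI[of _ a], rule exI[of _ b], rule conjI[OF A B])
qed

lemma stable_set_imp_tree_bounded:
  assumes "NIP L M" "C \<subseteq> points M" "imaginary_set L M C X" "stable_set L M C X"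
  shows "tree_bounded ts {y \<in> tuples M ts. {y} \<in> X}" (is "tree_bounded ts ?Y")
proof -
  have Yd: "definable L M C ts ?Y" by (rule definable_singletons[OF assms(3)])
  have "\<exists>h. \<not> tree h (tuples M zs) \<phi> ?Y" if \<phi>: "dfn2 (points M) ts zs \<phi>" for zs \<phi>
  proof -
    from dfn_finite_params[OF \<phi>[unfolded dfn2_def]] obtain Q us cs where
      Q: "cs \<in> tuples M us" "dfn {} ((ts @ zs) @ us) Q"
        "\<forall>e\<in>tuples M (ts @ zs). \<phi> (take (length ts) e) (drop (length ts) e) \<longleftrightarrow> Q (e @ cs)" by blast
    have d: "dfn2 C ts (zs @ us) (\<lambda>y z. Q (y @ z))"
      using dfn_mono[OF Q(2), of C] unfolding dfn2_def by simp
    from stable_imp_no_long_ladder[OF assms(1,4) refl Yd d] obtain N :: nat where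
      N: "\<not> (\<exists>y z. (\<forall>i<N. y i \<in> ?Y \<and> z i \<in> tuples M (zs @ us)) \<and>
        (\<forall>i<N. \<forall>j<N. Q (y i @ z j) \<longleftrightarrow> i < j))" by blast
    have "\<not> tree (ladder_height (2 * N)) (tuples M zs) \<phi> ?Y"
    proof
      assume t: "tree (ladder_height (2 * N)) (tuples M zs) \<phi> ?Y"
      have "tree (ladder_height (2 * N)) (tuples M (zs @ us)) (\<lambda>y z. Q (y @ z)) ?Y"
      proof (rule tree_transport[OF t, of "\<lambda>y. y" _ "\<lambda>z. z @ cs"])
        show "z @ cs \<in> tuples M (zs @ us)" if "z \<in> tuples M zs" for z
          by (rule tuples_append[OF that Q(1)])
        fix y z assume "y \<in> ?Y" "z \<in> tuples M zs"
        then show "Q (y @ z @ cs) \<longleftrightarrow> \<phi> y z"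
          using Q(3)[rule_format, of "y @ z"] tuples_length[of y M ts] by (simp add: tuples_append)
      qed
      from tree_imp_ladder[OF this] N show False by blast
    qed
    then show ?thesis ..
  qed
  moreover have "definable L M (points M) ts ?Y"
    using Yd dfn_mono[OF _ assms(2)] by (simp add: definable_iff_dfn)
  ultimately show ?thesis unfolding tree_bounded_def by blast
qed

end

section \<open>Definable types and their Morley sequences\<close>

locale monster_definable_type = monster L M \<kappa>
  for L :: "('s, 'f, 'r) language" and M :: "('s, 'f, 'r, 'm) struct" and \<kappa> :: "'k rel" +
  fixes A :: "'m set" and ss :: "'s list" and p :: "(('s, 'f, 'r) formula \<times> 'm list) set"
  assumes A: "A \<subseteq> points M" "small \<kappa> A"
    and p_global: "global_type L M ss p"
    and p_definable: "definable_type L M A ss p"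
begin

text \<open>\<open>generically P\<close> means that the formula \<open>P(x)\<close> belongs to \<open>p(x)\<close>, and \<open>generic C a\<close> below that \<open>a\<close> realizes
  the restriction of \<open>p\<close> to \<open>C\<close>.\<close>

definition generically :: "('m list \<Rightarrow> bool) \<Rightarrow> bool" where
  "generically P \<longleftrightarrow> {x \<in> tuples M ss. P x} \<in> type_sets M ss p"

lemma generically_cong: "(\<And>x. x \<in> tuples M ss \<Longrightarrow> P x \<longleftrightarrow> Q x) \<Longrightarrow> generically P \<longleftrightarrow> generically Q"
  unfolding generically_def by (metis (mono_tags, lifting) Collect_cong)

text \<open>Three formulas at once are enough to derive that \<open>generically\<close> commutes with negation and
  conjunction.\<close>

lemma generically_sat3:
  assumes "generically P" "generically Q" "generically R"
  shows "\<exists>x\<in>tuples M ss. P x \<and> Q x \<and> R x"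
proof -
  from assms obtain d1 d2 d3 where d: "d1 \<in> p" "d2 \<in> p" "d3 \<in> p"
    "{x \<in> tuples M ss. P x} = solutions M ss (fst d1) (snd d1)"
    "{x \<in> tuples M ss. Q x} = solutions M ss (fst d2) (snd d2)"
    "{x \<in> tuples M ss. R x} = solutions M ss (fst d3) (snd d3)"
    unfolding generically_def type_sets_def by auto
  have "{d1, d2, d3} \<subseteq> p" "finite {d1, d2, d3}" using d by auto
  then obtain x where x: "x \<in> tuples M ss"
    "\<forall>(\<phi>, cs)\<in>{d1, d2, d3}. sat M (x @ cs) \<phi>" using p_global unfolding complete_type_def by meson
  then have "x \<in> solutions M ss (fst d1) (snd d1)" "x \<in> solutions M ss (fst d2) (snd d2)"
    "x \<in> solutions M ss (fst d3) (snd d3)" by (auto simp: solutions_def split_beta)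
  then show ?thesis unfolding d(4-6)[symmetric] by blast
qed

lemma generically_formula:
  assumes "(\<phi>, cs) \<in> formulas_over L M (points M) ss"
    and "\<And>x. x \<in> tuples M ss \<Longrightarrow> P x \<longleftrightarrow> sat M (x @ cs) \<phi>"
  shows "generically P \<longleftrightarrow> (\<phi>, cs) \<in> p"
proof
  have in_p: "(\<psi>, ds) \<in> p \<Longrightarrow> generically (\<lambda>x. sat M (x @ ds) \<psi>)" for \<psi> ds
    unfolding generically_def type_sets_def solutions_def by blast
  assume "generically P"
  show "(\<phi>, cs) \<in> p"
  proof (rule ccontr)
    assume "(\<phi>, cs) \<notin> p"
    with p_global assms(1) have "(Neg \<phi>, cs) \<in> p" unfolding complete_type_def by fastforce
    from generically_sat3[OF \<open>generically P\<close> in_p[OF this] in_p[OF this]] assms(2) show False by auto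
  qed
next
  assume "(\<phi>, cs) \<in> p"
  moreover have "{x \<in> tuples M ss. P x} = solutions M ss \<phi> cs"
    using assms(2) unfolding solutions_def by blast
  ultimately show "generically P" unfolding generically_def type_sets_def by blast
qed

lemma generically_neg:
  assumes "dfn (points M) ss P"
  shows "generically (\<lambda>x. \<not> P x) \<longleftrightarrow> \<not> generically P"
proof -
  from assms obtain \<phi> cs ts where f: "set cs \<subseteq> points M" "cs \<in> tuples M ts" "wff L (ss @ ts) \<phi>"
    "\<forall>x\<in>tuples M ss. P x \<longleftrightarrow> sat M (x @ cs) \<phi>" unfolding dfn_def by blast
  then have fo: "(\<phi>, cs) \<in> formulas_over L M (points M) ss"
    "(Neg \<phi>, cs) \<in> formulas_over L M (points M) ss" unfolding formulas_over_def by auto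
  have 1: "generically P \<longleftrightarrow> (\<phi>, cs) \<in> p" by (rule generically_formula[OF fo(1)]) (use f(4) in blast)
  have 2: "generically (\<lambda>x. \<not> P x) \<longleftrightarrow> (Neg \<phi>, cs) \<in> p" by (rule generically_formula[OF fo(2)]) (use f(4) in simp)
  have "(\<phi>, cs) \<in> p \<or> (Neg \<phi>, cs) \<in> p" using p_global fo(1) unfolding complete_type_def by blast
  moreover have "\<not> (generically P \<and> generically (\<lambda>x. \<not> P x))" using generically_sat3[of P "\<lambda>x. \<not> P x" P] by blast
  ultimately show ?thesis using 1 2 by blast
qed

lemma generically_conj:
  assumes "dfn (points M) ss P" "dfn (points M) ss Q" "generically P" "generically Q"
  shows "generically (\<lambda>x. P x \<and> Q x)"
  using generically_sat3[OF assms(3,4), of "\<lambda>x. \<not> (P x \<and> Q x)"] generically_neg[OF dfn_conj[OF assms(1,2)]] by blast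

lemma generically_True: "generically (\<lambda>_. True)"
  using generically_neg[OF dfn_const[of "points M" ss False]] generically_sat3[of "\<lambda>_. False"] by auto

lemma dfn_generically:
  assumes "dfn2 C ss zs P" "A \<subseteq> C" "C \<subseteq> points M"
  shows "dfn C zs (\<lambda>z. generically (\<lambda>x. P x z))"
proof -
  from assms(1) obtain \<phi> cs us where f: "set cs \<subseteq> C" "cs \<in> tuples M us" "wff L ((ss @ zs) @ us) \<phi>"
    "\<forall>e\<in>tuples M (ss @ zs). P (take (length ss) e) (drop (length ss) e) \<longleftrightarrow> sat M (e @ cs) \<phi>"
    unfolding dfn2_def dfn_def by blast
  from p_definable f(3) have "definable L M A (zs @ us) {c \<in> tuples M (zs @ us). (\<phi>, c) \<in> p}"
    unfolding definable_type_def by simp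
  then have "dfn C (zs @ us) (\<lambda>c. c \<in> {c \<in> tuples M (zs @ us). (\<phi>, c) \<in> p})"
    using assms(2) dfn_mono by (auto simp: definable_iff_dfn)
  from dfn_params[OF this f(2,1)] show ?thesis
  proof (rule dfn_cong)
    fix z assume z: "z \<in> tuples M zs"
    have zc: "z @ cs \<in> tuples M (zs @ us)" by (rule tuples_append[OF z f(2)])
    have "generically (\<lambda>x. P x z) \<longleftrightarrow> (\<phi>, z @ cs) \<in> p"
    proof (rule generically_formula)
      show "(\<phi>, z @ cs) \<in> formulas_over L M (points M) ss"
        using zc tuples_subset_points[OF zc] f(3) unfolding formulas_over_def by auto
      fix x assume x: "x \<in> tuples M ss"
      show "P x z \<longleftrightarrow> sat M (x @ z @ cs) \<phi>"
        using bspec[OF f(4) tuples_append[OF x z]] tuples_length[OF x] by simp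
    qed
    with zc show "z @ cs \<in> {c \<in> tuples M (zs @ us). (\<phi>, c) \<in> p} \<longleftrightarrow> generically (\<lambda>x. P x z)" by simp
  qed
qed

definition generic :: "'m set \<Rightarrow> 'm list \<Rightarrow> bool" where
  "generic C a \<longleftrightarrow> a \<in> tuples M ss \<and> (\<forall>P. dfn C ss P \<longrightarrow> (generically P \<longleftrightarrow> P a))"

lemma generic_mono: "generic D a \<Longrightarrow> C \<subseteq> D \<Longrightarrow> generic C a"
  unfolding generic_def using dfn_mono by blast

lemma generic_tuples: "generic C a \<Longrightarrow> a \<in> tuples M ss"
  unfolding generic_def by blast

lemma genericD: "generic C a \<Longrightarrow> dfn C ss P \<Longrightarrow> generically P \<longleftrightarrow> P a"
  unfolding generic_def by blast

lemma generic_exists: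
  assumes C: "C \<subseteq> points M" "small \<kappa> C"
  shows "\<exists>a. generic C a"
proof -
  let ?F = "{P. dfn C ss P \<and> generically P}"
  have "\<exists>x\<in>tuples M ss. \<forall>P\<in>?F. P x"
  proof (rule compactness[OF C])
    fix Q assume "finite Q" "Q \<subseteq> ?F"
    then have "generically (\<lambda>x. \<forall>P\<in>Q. P x) \<and> dfn (points M) ss (\<lambda>x. \<forall>P\<in>Q. P x)"
    proof (induction Q rule: finite_induct)
      case empty
      then show ?case using generically_True dfn_const[of "points M" ss True] by simp
    next
      case (insert P Q)
      then have "dfn (points M) ss P" using dfn_mono[OF _ C(1)] by blast
      with insert generically_conj[of P "\<lambda>x. \<forall>P\<in>Q. P x"] dfn_conj[of "points M" ss P "\<lambda>x. \<forall>P\<in>Q. P x"]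
      show ?case by simp
    qed
    then have "generically (\<lambda>x. \<forall>P\<in>Q. P x)" ..
    from generically_sat3[OF this this this] show "\<exists>x\<in>tuples M ss. \<forall>P\<in>Q. P x" by blast
  qed blast
  then obtain a where a: "a \<in> tuples M ss" "\<And>P. dfn C ss P \<Longrightarrow> generically P \<Longrightarrow> P a" by blast
  have "generically P \<longleftrightarrow> P a" if P: "dfn C ss P" for P
    using a(2)[OF P] a(2)[OF dfn_neg[OF P]] generically_neg[OF dfn_mono[OF P C(1)]] by blast
  with a(1) show ?thesis unfolding generic_def by blast
qed

lemma generic_realizes:
  assumes "generic A a"
  shows "realizes M ss a (restrict_type p A)"
  unfolding realizes_def restrict_type_def
proof (intro conjI ballI)
  show "a \<in> tuples M ss" by (rule generic_tuples[OF assms])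
  fix d assume "d \<in> {(\<phi>, cs). (\<phi>, cs) \<in> p \<and> set cs \<subseteq> A}"
  then obtain \<phi> cs where d: "d = (\<phi>, cs)" "(\<phi>, cs) \<in> p" "set cs \<subseteq> A" by blast
  with p_global have fo: "(\<phi>, cs) \<in> formulas_over L M (points M) ss"
    unfolding complete_type_def by blast
  then obtain us where us: "cs \<in> tuples M us" "wff L (ss @ us) \<phi>" unfolding formulas_over_def by blast
  have "dfn A ss (\<lambda>x. sat M (x @ cs) \<phi>)" by (rule dfnI[OF d(3) us]) simp
  moreover have "generically (\<lambda>x. sat M (x @ cs) \<phi>)" using generically_formula[OF fo, of "\<lambda>x. sat M (x @ cs) \<phi>"] d(2) by simp
  ultimately show "case d of (\<phi>, cs) \<Rightarrow> sat M (a @ cs) \<phi>"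
    using genericD[OF assms] unfolding d(1) by auto
qed

text \<open>Morley sequences are lists whose head is the last element: this matches the iterated
  quantifier \<open>generically_n\<close>, which removes the head of the list first.\<close>

primrec morley :: "'m set \<Rightarrow> 'm list list \<Rightarrow> bool" where
  "morley C [] \<longleftrightarrow> True"
| "morley C (a # as) \<longleftrightarrow> generic (C \<union> set (concat as)) a \<and> morley C as"

abbreviation reps :: "nat \<Rightarrow> 's list \<Rightarrow> 's list" where
  "reps n us \<equiv> concat (replicate n us)"

lemma morley_tuples: "morley C as \<Longrightarrow> concat as \<in> tuples M (reps (length as) ss)"
  by (induction as) (auto intro: tuples_append generic_tuples)

lemma morley_nth: "morley C as \<Longrightarrow> i < length as \<Longrightarrow> generic C (as ! i)"
  by (induction as arbitrary: i) (auto simp: nth_Cons split: nat.splits intro: generic_mono)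

lemma morley_mono: "morley D as \<Longrightarrow> C \<subseteq> D \<Longrightarrow> morley C as"
  by (induction as) (auto intro: generic_mono)

lemma morley_append: "morley (C \<union> set (concat as)) bs \<Longrightarrow> morley C as \<Longrightarrow> morley C (bs @ as)"
  by (induction bs) (auto elim!: generic_mono)

lemma morley_suffix: "morley C (bs @ as) \<Longrightarrow> morley C as"
  by (induction bs) auto

lemma morley_delete: "morley C (xs @ ys @ zs) \<Longrightarrow> morley C (xs @ zs)"
  by (induction xs) (auto elim: generic_mono dest: morley_suffix)

lemma morley_exists:
  assumes "C \<subseteq> points M" "small \<kappa> C"
  shows "\<exists>as. length as = n \<and> morley C as"
proof (induction n)
  case (Suc n)
  then obtain as where as: "length as = n" "morley C as" by blast
  have "C \<union> set (concat as) \<subseteq> points M" "small \<kappa> (C \<union> set (concat as))"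
    using assms tuples_subset_points[OF morley_tuples[OF as(2)]] small_Un_set by blast+
  from generic_exists[OF this] obtain a where "generic (C \<union> set (concat as)) a" ..
  with as show ?case by (intro exI[of _ "a # as"]) simp
qed simp

primrec generically_n :: "nat \<Rightarrow> ('m list \<Rightarrow> bool) \<Rightarrow> 'm list \<Rightarrow> bool" where
  "generically_n 0 Q = Q"
| "generically_n (Suc n) Q = generically_n n (\<lambda>e. generically (\<lambda>x. Q (x @ e)))"

text \<open>Whether \<open>Q\<close> holds of a Morley sequence over \<open>z\<close>, followed by \<open>z\<close>, is a property of \<open>z\<close> alone and
  definable over \<open>C\<close>.  Hence the type of such a sequence depends only on that of \<open>z\<close>.\<close>

lemma morley_generically_n:
  assumes "dfn C (reps n ss @ zs) Q" "A \<subseteq> C" "C \<subseteq> points M"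
  shows "dfn C zs (generically_n n Q)"
    and "z \<in> tuples M zs \<Longrightarrow> morley (C \<union> set z) as \<Longrightarrow> length as = n \<Longrightarrow> Q (concat as @ z) \<longleftrightarrow> generically_n n Q z"
  using assms
proof (induction n arbitrary: Q as)
  case 0
  { case 1 then show ?case by simp }
  { case 2 then show ?case by simp }
next
  case (Suc n)
  have d: "dfn C (reps n ss @ zs) (\<lambda>e. generically (\<lambda>x. Q (x @ e)))"
    if "dfn C (reps (Suc n) ss @ zs) Q" "A \<subseteq> C" "C \<subseteq> points M" for Q
  proof -
    have "dfn2 C ss (reps n ss @ zs) (\<lambda>x e. Q (x @ e))" using that(1) unfolding dfn2_def by simp
    then show ?thesis by (rule dfn_generically) (use that in auto)
  qed
  { case 1 then show ?case using Suc.IH(1)[OF d[OF 1] 1(2,3)] by simp }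
  { case 2
    let ?Q = "\<lambda>e. generically (\<lambda>x. Q (x @ e))"
    from 2 obtain a bs where as: "as = a # bs" "length bs = n" by (cases as) auto
    with 2 have g: "generic (C \<union> set z \<union> set (concat bs)) a" "morley (C \<union> set z) bs" by auto
    have t: "concat bs @ z \<in> tuples M (reps n ss @ zs)"
      using morley_tuples[OF g(2)] as(2) 2(1) by (auto intro: tuples_append)
    have "dfn (C \<union> set z \<union> set (concat bs)) (ss @ reps n ss @ zs) Q"
      using 2(4) by (auto elim: dfn_mono)
    from dfn_params[OF this t] have "dfn (C \<union> set z \<union> set (concat bs)) ss (\<lambda>x. Q (x @ concat bs @ z))"
      by auto
    from genericD[OF g(1) this] have "Q (concat as @ z) \<longleftrightarrow> ?Q (concat bs @ z)" by (simp add: as)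
    also have "\<dots> \<longleftrightarrow> generically_n n ?Q z" by (rule Suc.IH(2)[OF 2(1) g(2) as(2) d[OF 2(4-6)] 2(5,6)])
    finally show ?case by simp }
qed

lemma morley_same_type:
  assumes "same_type A zs z z'" "morley (A \<union> set z) as" "morley (A \<union> set z') as'"
    and "length as = n" "length as' = n"
  shows "same_type A (reps n ss @ zs) (concat as @ z) (concat as' @ z')"
proof -
  have z: "z \<in> tuples M zs" "z' \<in> tuples M zs" using assms(1) unfolding same_type_def by auto
  have "Q (concat as @ z) \<longleftrightarrow> Q (concat as' @ z')" if Q: "dfn A (reps n ss @ zs) Q" for Q
    using morley_generically_n(2)[OF Q order_refl A(1) z(1) assms(2,4)]
      morley_generically_n(2)[OF Q order_refl A(1) z(2) assms(3,5)]
      same_typeD[OF assms(1) morley_generically_n(1)[OF Q order_refl A(1)]] by simp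
  moreover have "concat as @ z \<in> tuples M (reps n ss @ zs)" "concat as' @ z' \<in> tuples M (reps n ss @ zs)"
    using morley_tuples[OF assms(2)] morley_tuples[OF assms(3)] assms(4,5) z by (auto intro: tuples_append)
  ultimately show ?thesis unfolding same_type_def by blast
qed

text \<open>Since \<open>p\<close> is definable over \<open>A\<close>, the type of the sequence followed by \<open>z\<close> knows whether the sequence is
  a Morley sequence over \<open>z\<close>.\<close>

lemma morley_transfer:
  assumes "morley (A \<union> set z) as" "length as = n"
    and "same_type A (reps n ss @ zs) (concat as @ z) (concat as @ z')"
    and "z \<in> tuples M zs" "z' \<in> tuples M zs"
  shows "morley (A \<union> set z') as"
  using assms(1-3)
proof (induction as arbitrary: n)
  case (Cons a as)
  obtain n' where n: "n = Suc n'" "length as = n'" using Cons.prems(2) by auto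
  have e: "same_type A (ss @ reps n' ss @ zs) (a @ concat as @ z) (a @ concat as @ z')"
    using Cons.prems(3) by (simp add: n)
  have a: "a \<in> tuples M ss" using Cons.prems(1) by (auto intro: generic_tuples)
  have e': "same_type A (reps n' ss @ zs) (concat as @ z) (concat as @ z')"
    using same_type_tm[OF e tm_drop_id] tuples_length[OF a] by simp
  have m: "morley (A \<union> set z') as" using Cons.IH[OF _ n(2) e'] Cons.prems(1) by simp
  have t: "concat as @ z \<in> tuples M (reps n' ss @ zs)" "concat as @ z' \<in> tuples M (reps n' ss @ zs)"
    using e' unfolding same_type_def by auto
  have "generic (A \<union> set (concat as @ z')) a" unfolding generic_def
  proof (intro conjI a allI impI)
    fix P assume "dfn (A \<union> set (concat as @ z')) ss P"
    from dfn_cover[OF this t(2)] obtain Q where Q: "dfn2 A ss (reps n' ss @ zs) Q"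
      "\<forall>x\<in>tuples M ss. P x \<longleftrightarrow> Q x (concat as @ z')" unfolding dfn2_def by blast
    have "generically P \<longleftrightarrow> generically (\<lambda>x. Q x (concat as @ z'))" by (rule generically_cong) (use Q(2) in blast)
    also have "\<dots> \<longleftrightarrow> generically (\<lambda>x. Q x (concat as @ z))"
      using same_typeD[OF e' dfn_generically[OF Q(1) order_refl A(1)]] by simp
    also have "\<dots> \<longleftrightarrow> Q a (concat as @ z)"
    proof (rule genericD)
      show "generic (A \<union> set (concat as @ z)) a" using Cons.prems(1) by (auto elim: generic_mono)
      show "dfn (A \<union> set (concat as @ z)) ss (\<lambda>x. Q x (concat as @ z))"
        by (rule dfn2_sub[OF dfn2_mono[OF Q(1)] tm_id tm_const[OF t(1)]]) auto
    qed
    also have "\<dots> \<longleftrightarrow> Q a (concat as @ z')"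
      using same_typeD[OF e Q(1)[unfolded dfn2_def]] tuples_length[OF a] by simp
    also have "\<dots> \<longleftrightarrow> P a" using Q(2) a by blast
    finally show "generically P \<longleftrightarrow> P a" .
  qed
  then have "generic (A \<union> set z' \<union> set (concat as)) a" by (rule generic_mono) auto
  with m show ?case by simp
qed simp

end

section \<open>Germs of a family of functions with values in stable sets\<close>

text \<open>Compactness: if \<open>Q a b b'\<close> holds for all \<open>b'\<close> with the type of \<open>b\<close> over \<open>A a\<close>, then one
  formula \<open>\<chi>\<close> of that type is responsible, and \<open>Q\<close> holds between any two tuples that satisfy it.  If
  not, two realizations of the whole type would fail \<open>Q\<close>, and by homogeneity one of them could be taken
  to be \<open>b\<close>.\<close>

lemma (in monster) same_type_formula:
  assumes A: "A \<subseteq> points M" "small \<kappa> A"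
    and Q: "dfn3 A as us us Q" and a: "a \<in> tuples M as" and b: "b \<in> tuples M us"
    and all: "\<And>b'. same_type A (as @ us) (a @ b') (a @ b) \<Longrightarrow> Q a b b'"
  shows "\<exists>\<chi>. dfn2 A as us \<chi> \<and> \<chi> a b \<and> (\<forall>a'\<in>tuples M as. \<forall>b1\<in>tuples M us. \<forall>b2\<in>tuples M us.
    \<chi> a' b1 \<longrightarrow> \<chi> a' b2 \<longrightarrow> Q a' b1 b2)"
proof (rule ccontr)
  assume no: "\<not> ?thesis"
  let ?la = "length as" and ?lu = "length us"
  let ?ctx = "as @ us @ us"
  let ?x = "take ?la" and ?y1 = "\<lambda>e. take ?lu (drop ?la e)" and ?y2 = "\<lambda>e. drop ?lu (drop ?la e)"
  have t: "tm A ?ctx ?x as" "tm A ?ctx ?y1 us" "tm A ?ctx ?y2 us"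
    by (rule tm_take, rule tm_drop[OF tm_take], rule tm_drop[OF tm_drop_id])
  define T where "T = {\<chi>. dfn A (as @ us) \<chi> \<and> \<chi> (a @ b)}"
  define R where "R \<chi> e \<longleftrightarrow> \<chi> (?x e @ ?y1 e) \<and> \<chi> (?x e @ ?y2 e) \<and> \<not> Q (?x e) (?y1 e) (?y2 e)"
    for \<chi> e
  have "\<exists>e\<in>tuples M ?ctx. \<forall>P\<in>R ` T. P e"
  proof (rule compactness[OF A])
    fix P assume "P \<in> R ` T"
    then obtain \<chi> where \<chi>: "dfn A (as @ us) \<chi>" "P = R \<chi>" unfolding T_def by blast
    show "dfn A ?ctx P" unfolding \<chi>(2) R_def[abs_def]
      by (intro dfn_conj dfn_neg dfn3_sub[OF Q] dfn_tm[OF \<chi>(1)] tm_append t)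
  next
    fix H assume "finite H" "H \<subseteq> R ` T"
    then obtain S where S: "finite S" "S \<subseteq> T" "H = R ` S" by (meson finite_subset_image)
    let ?\<chi> = "\<lambda>x y. \<forall>\<chi>\<in>S. \<chi> (x @ y)"
    have "dfn2 A as us ?\<chi>" unfolding dfn2_def
    proof (rule dfn_ball_finite[OF S(1)])
      fix \<chi> assume "\<chi> \<in> S"
      then have "dfn A (as @ us) \<chi>" using S(2) unfolding T_def by blast
      then show "dfn A (as @ us) (\<lambda>e. \<chi> (take ?la e @ drop ?la e))" by simp
    qed
    moreover have "?\<chi> a b" using S(2) unfolding T_def by blast
    moreover have "\<not> (dfn2 A as us ?\<chi> \<and> ?\<chi> a b \<and> (\<forall>a'\<in>tuples M as. \<forall>b1\<in>tuples M us.
      \<forall>b2\<in>tuples M us. ?\<chi> a' b1 \<longrightarrow> ?\<chi> a' b2 \<longrightarrow> Q a' b1 b2))"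
      using no by (rule contrapos_nn) (rule exI)
    ultimately have "\<not> (\<forall>a'\<in>tuples M as. \<forall>b1\<in>tuples M us.
      \<forall>b2\<in>tuples M us. ?\<chi> a' b1 \<longrightarrow> ?\<chi> a' b2 \<longrightarrow> Q a' b1 b2)" by iprover
    then obtain a' b1 b2 where e: "a' \<in> tuples M as" "b1 \<in> tuples M us" "b2 \<in> tuples M us"
      "?\<chi> a' b1" "?\<chi> a' b2" "\<not> Q a' b1 b2" by (auto simp only: ball_simps not_imp bex_simps)
    have "R \<chi> (a' @ b1 @ b2)" if "\<chi> \<in> S" for \<chi>
      using bspec[OF e(4) that] bspec[OF e(5) that] e(6) tuples_length[OF e(1)] tuples_length[OF e(2)]
      by (simp add: R_def)
    moreover have "a' @ b1 @ b2 \<in> tuples M ?ctx" using e by (auto intro: tuples_append)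
    ultimately show "\<exists>e\<in>tuples M ?ctx. \<forall>P\<in>H. P e" unfolding S(3) by blast
  qed
  then obtain e where e: "e \<in> tuples M ?ctx" "\<And>\<chi>. \<chi> \<in> T \<Longrightarrow> R \<chi> e" by blast
  define a' b1 b2 where "a' = ?x e" and "b1 = ?y1 e" and "b2 = ?y2 e"
  have tt: "a' \<in> tuples M as" "b1 \<in> tuples M us" "b2 \<in> tuples M us"
    using tm_range[OF t(1) e(1)] tm_range[OF t(2) e(1)] tm_range[OF t(3) e(1)]
    by (auto simp: a'_def b1_def b2_def)
  have ab: "a @ b \<in> tuples M (as @ us)" by (rule tuples_append[OF a b])
  have R: "\<chi> (a' @ b1) \<and> \<chi> (a' @ b2) \<and> \<not> Q a' b1 b2" if "\<chi> \<in> T" for \<chi>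
    using e(2)[OF that] by (simp add: R_def a'_def b1_def b2_def)
  have iff: "P (a @ b) \<longleftrightarrow> P (a' @ b1)" "P (a @ b) \<longleftrightarrow> P (a' @ b2)" if P: "dfn A (as @ us) P" for P
    using R[of P] R[of "\<lambda>e. \<not> P e"] P dfn_neg[OF P] unfolding T_def by blast+
  have q1: "same_type A (as @ us) (a' @ b1) (a @ b)" and q2: "same_type A (as @ us) (a' @ b2) (a @ b)"
    unfolding same_type_def using iff ab tuples_append[OF tt(1,2)] tuples_append[OF tt(1,3)] by auto
  from homogeneity[OF A q1] obtain h where h: "preserves A h" "map h (a' @ b1) = a @ b" by blast
  then have hh: "map h a' = a" "map h b1 = b"
    using tuples_length[OF a] tuples_length[OF tt(1)] by auto
  have "same_type A (as @ us) (map h (a' @ b2)) (a @ b)"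
    by (rule same_type_trans[OF same_type_preserves[OF h(1) tuples_append[OF tt(1,3)]] q2])
  then have "Q a b (map h b2)" using all[of "map h b2"] hh by simp
  moreover have "Q (map h a') (map h b1) (map h b2) \<longleftrightarrow> Q a' b1 b2"
    using preserves_dfn[OF h(1) Q[unfolded dfn3_def] tuples_append[OF tt(1) tuples_append[OF tt(2,3)]]]
      tuples_length[OF tt(1)] tuples_length[OF tt(2)] by simp
  moreover have "\<not> Q a' b1 b2"
    using R[of "\<lambda>_. True"] dfn_const[of A "as @ us" True] unfolding T_def by blast
  ultimately show False using hh by simp
qed

locale stable_valued_family = monster_definable_type L M \<kappa> A ss p
  for L :: "('s, 'f, 'r) language" and M :: "('s, 'f, 'r, 'm) struct" and \<kappa> :: "'k rel"
    and A :: "'m set" and ss :: "'s list" and p :: "(('s, 'f, 'r) formula \<times> 'm list) set" +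
  fixes us ts :: "'s list" and B :: "'m list set" and f :: "'m list \<Rightarrow> 'm list \<rightharpoonup> 'm list"
  assumes nip: "NIP L M"
    and family: "definable_family_on L M A us ss ts p B f"
    and stable_values: "\<forall>b\<in>B. \<forall>a. realizes M ss a (restrict_type p A) \<longrightarrow>
           (\<exists>y. f b a = Some y \<and> {y} \<in> St L M (A \<union> set a))"
begin

definition fgraph :: "'m list \<Rightarrow> 'm list \<Rightarrow> 'm list \<Rightarrow> bool" where
  "fgraph b x y \<longleftrightarrow> b \<in> B \<and> f b x = Some y"

lemma B_definable: "definable L M A us B"
  using family unfolding definable_family_on_def by blast

lemma B_tuples: "b \<in> B \<Longrightarrow> b \<in> tuples M us"
  using B_definable by (auto simp: definable_iff_dfn)

lemma fgraph_tuples: "fgraph b x y \<Longrightarrow> b \<in> tuples M us \<and> x \<in> tuples M ss \<and> y \<in> tuples M ts"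
  using family B_tuples[of b] domI[of "f b" x y] ranI[of "f b" x y]
  unfolding definable_family_on_def fgraph_def by blast

lemma fgraph_fun: "fgraph b x y \<Longrightarrow> fgraph b x y' \<Longrightarrow> y = y'"
  by (simp add: fgraph_def)

lemma fgraph_dfn: "dfn3 A us ss ts fgraph"
proof -
  let ?S = "{b @ x @ y | b x y. b \<in> B \<and> f b x = Some y}"
  have S: "?S = {b @ x @ y | b x y. fgraph b x y}" unfolding fgraph_def by blast
  have "dfn A (us @ ss @ ts) (\<lambda>e. e \<in> ?S)"
    using family unfolding definable_family_on_def definable_iff_dfn by blast
  then show ?thesis unfolding dfn3_def
  proof (rule dfn_cong)
    fix e assume e: "e \<in> tuples M (us @ ss @ ts)"
    let ?b = "take (length us) e" and ?x = "take (length ss) (drop (length us) e)"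
      and ?y = "drop (length ss) (drop (length us) e)"
    have eq: "e = ?b @ ?x @ ?y" by (metis append_take_drop_id)
    show "e \<in> ?S \<longleftrightarrow> fgraph ?b ?x ?y"
    proof
      assume "e \<in> ?S"
      then obtain b x y where bxy: "e = b @ x @ y" "fgraph b x y" unfolding S by blast
      then have "length b = length us" "length x = length ss"
        using fgraph_tuples[OF bxy(2)] by (simp_all add: tuples_length[of b M us] tuples_length[of x M ss])
      with bxy show "fgraph ?b ?x ?y" by simp
    next
      assume "fgraph ?b ?x ?y" then show "e \<in> ?S" unfolding S using eq by blast
    qed
  qed
qed

lemma fgraph_preserves:
  assumes "preserves A h" "b \<in> tuples M us" "x \<in> tuples M ss" "y \<in> tuples M ts"
  shows "fgraph (map h b) (map h x) (map h y) \<longleftrightarrow> fgraph b x y"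
  using preserves_dfn[OF assms(1) fgraph_dfn[unfolded dfn3_def]
      tuples_append[OF assms(2) tuples_append[OF assms(3,4)]]]
    tuples_length[OF assms(2)] tuples_length[OF assms(3)] by simp

definition agree :: "'m list \<Rightarrow> 'm list \<Rightarrow> 'm list \<Rightarrow> bool" where
  "agree x b b' \<longleftrightarrow> (\<exists>y\<in>tuples M ts. fgraph b x y \<and> fgraph b' x y)"

lemma agree_dfn: "dfn3 A ss us us agree"
proof -
  have "dfn A (ss @ us @ us) (\<lambda>e. \<exists>y\<in>tuples M ts.
    fgraph (take (length us) (drop (length ss) e)) (take (length ss) e) y \<and>
    fgraph (drop (length us) (drop (length ss) e)) (take (length ss) e) y)"
    by (intro dfn_ex dfn_conj dfn3_sub[OF fgraph_dfn] tm_take tm_drop tm_drop_id)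
  then show ?thesis unfolding dfn3_def agree_def .
qed

lemma agreeI: "fgraph b x y \<Longrightarrow> fgraph b' x y \<Longrightarrow> agree x b b'"
  unfolding agree_def using fgraph_tuples[of b x y] by (intro bexI[of _ y]) simp_all

lemma agree_sym: "agree x b b' \<Longrightarrow> agree x b' b"
  unfolding agree_def by blast

lemma agree_trans: "agree x b b' \<Longrightarrow> agree x b' b'' \<Longrightarrow> agree x b b''"
  unfolding agree_def using fgraph_fun[of b' x] by auto

lemma generic_defined:
  assumes "b \<in> B" "generic A a"
  shows "\<exists>y. fgraph b a y"
  using bspec[OF stable_values assms(1)] assms(1) generic_realizes[OF assms(2)] unfolding fgraph_def by blast

lemma generic_agree_refl: "b \<in> B \<Longrightarrow> generic A a \<Longrightarrow> agree a b b"
  using generic_defined agreeI by blast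

definition same_germ :: "'m list \<Rightarrow> 'm list \<Rightarrow> bool" where
  "same_germ b b' \<longleftrightarrow> b \<in> B \<and> b' \<in> B \<and> generically (\<lambda>x. agree x b b')"

lemma same_germ_germ_rel: "germ_rel M ss p B f = {(b, b'). same_germ b b'}"
proof -
  have "{x \<in> tuples M ss. \<exists>y. f b x = Some y \<and> f b' x = Some y} = {x \<in> tuples M ss. agree x b b'}"
    if "b \<in> B" "b' \<in> B" for b b'
    using that fgraph_tuples unfolding agree_def fgraph_def by blast
  then show ?thesis unfolding germ_rel_def same_germ_def generically_def by auto
qed

lemma same_germ_dfn: "dfn2 A us us same_germ"
proof -
  have "dfn A (us @ us) (\<lambda>e. take (length us) e \<in> B \<and> drop (length us) e \<in> B \<and>
    generically (\<lambda>x. agree x (take (length us) e) (drop (length us) e)))"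
    by (intro dfn_conj dfn_mem[OF B_definable] tm_take tm_drop_id dfn_generically[OF _ order_refl A(1)])
       (unfold dfn2_def, rule dfn3_sub[OF agree_dfn], (intro tm_take tm_drop tm_drop_id)+)
  then show ?thesis unfolding dfn2_def same_germ_def .
qed

lemma agree_dfn_const:
  assumes "b \<in> tuples M us" "b' \<in> tuples M us"
  shows "dfn (A \<union> set b \<union> set b') ss (\<lambda>x. agree x b b')"
  by (rule dfn3_sub[where R = agree and us = ss and vs = us and ws = us])
     (use agree_dfn assms in \<open>auto simp: dfn3_def elim: dfn_mono intro: tm_id tm_const\<close>)

lemma generic_same_germ:
  assumes "b \<in> B" "b' \<in> B" "generic (A \<union> set b \<union> set b') a"
  shows "same_germ b b' \<longleftrightarrow> agree a b b'"
  using genericD[OF assms(3) agree_dfn_const[OF B_tuples[OF assms(1)] B_tuples[OF assms(2)]]] assms(1,2)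
  unfolding same_germ_def by simp

lemma same_germ_equiv: "equiv B (germ_rel M ss p B f)"
proof (rule equivI)
  show "germ_rel M ss p B f \<subseteq> B \<times> B" unfolding same_germ_germ_rel same_germ_def by blast
  \<comment> \<open>agreement is transitive at each single point, in particular at one generic over all three indices\<close>
  have gen2: "\<exists>a. generic (A \<union> set b \<union> set b' \<union> set b'') a" if "b \<in> B" "b' \<in> B" "b'' \<in> B" for b b' b''
    using small_points_Un[OF B_tuples[OF that(1)] A]
      small_points_Un[OF B_tuples[OF that(2)], of "A \<union> set b"]
      small_points_Un[OF B_tuples[OF that(3)], of "A \<union> set b \<union> set b'"] generic_exists by blast
  show "refl_on B (germ_rel M ss p B f)"
  proof (rule refl_onI)
    fix b assume b: "b \<in> B"
    from gen2[OF b b b] obtain a where "generic (A \<union> set b \<union> set b \<union> set b) a" ..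
    then have "generic (A \<union> set b \<union> set b) a" "generic A a" by (auto elim: generic_mono)
    with generic_same_germ[OF b b] generic_agree_refl[OF b] show "(b, b) \<in> germ_rel M ss p B f"
      unfolding same_germ_germ_rel by simp
  qed
  show "sym (germ_rel M ss p B f)" unfolding same_germ_germ_rel
  proof (rule symI, clarify)
    fix b b' assume "same_germ b b'"
    moreover have "agree x b b' \<longleftrightarrow> agree x b' b" for x using agree_sym by blast
    ultimately show "same_germ b' b" unfolding same_germ_def by simp
  qed
  show "trans (germ_rel M ss p B f)" unfolding same_germ_germ_rel
  proof (rule transI, clarify)
    fix b b' b'' assume g: "same_germ b b'" "same_germ b' b''"
    then have B: "b \<in> B" "b' \<in> B" "b'' \<in> B" unfolding same_germ_def by auto
    from gen2[OF B] obtain a where a: "generic (A \<union> set b \<union> set b' \<union> set b'') a" ..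
    have a12: "generic (A \<union> set b \<union> set b') a" and a23: "generic (A \<union> set b' \<union> set b'') a"
      and a13: "generic (A \<union> set b \<union> set b'') a" by (rule generic_mono[OF a], blast)+
    have "agree a b b'" "agree a b' b''" using generic_same_germ[OF B(1,2) a12] generic_same_germ[OF B(2,3) a23] g by simp_all
    then have "agree a b b''" by (rule agree_trans)
    with generic_same_germ[OF B(1,3) a13] show "same_germ b b''" by simp
  qed
qed

definition value_set :: "'m list \<Rightarrow> 'm list set" where
  "value_set a = {y \<in> tuples M ts. \<exists>b\<in>tuples M us. fgraph b a y}"

text \<open>The values are covered by stable sets definable over \<open>A a\<close>, and by compactness by finitely many of
  these.\<close>

lemma value_set_tree_bounded:
  assumes "generic A a"
  shows "tree_bounded ts (value_set a)"
proof -
  let ?C = "A \<union> set a"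
  have a: "a \<in> tuples M ss" by (rule generic_tuples[OF assms])
  then have C: "?C \<subseteq> points M" "small \<kappa> ?C" using small_points_Un[OF a A] by auto
  let ?F = "{\<lambda>y. y \<in> {y \<in> tuples M ts. {y} \<in> X} | X. imaginary_set L M ?C X \<and> stable_set L M ?C X}"
  have YC: "dfn ?C ts (\<lambda>y. y \<in> value_set a)"
  proof -
    have "dfn ?C ts (\<lambda>y. \<exists>b\<in>tuples M us. fgraph b a y)"
      by (intro dfn_ex dfn3_sub[where R = fgraph and us = us and vs = ss and ws = ts] tm_take tm_drop_id
          tm_const a) (use fgraph_dfn in \<open>auto simp: dfn3_def elim: dfn_mono\<close>)
    then show ?thesis by (rule dfn_cong) (simp add: value_set_def)
  qed
  have "\<exists>H\<subseteq>?F. finite H \<and> (\<forall>y\<in>tuples M ts. y \<in> value_set a \<longrightarrow> (\<exists>P\<in>H. P y))"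
  proof (rule compact_cover[OF C _ YC])
    fix P assume "P \<in> ?F"
    then obtain X where X: "imaginary_set L M ?C X" "P = (\<lambda>y. y \<in> {y \<in> tuples M ts. {y} \<in> X})" by blast
    show "dfn ?C ts P" unfolding X(2) using definable_singletons[OF X(1)] by (simp only: definable_iff_dfn)
  next
    fix y assume y: "y \<in> tuples M ts" "y \<in> value_set a"
    then obtain b where b: "fgraph b a y" unfolding value_set_def by blast
    then have "b \<in> B" "f b a = Some y" unfolding fgraph_def by auto
    with stable_values generic_realizes[OF assms] have "{y} \<in> St L M ?C" by fastforce
    then obtain X where X: "imaginary_set L M ?C X" "stable_set L M ?C X" "{y} \<in> X"
      unfolding St_def by blast
    let ?P = "\<lambda>y. y \<in> {y \<in> tuples M ts. {y} \<in> X}"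
    have "?P \<in> ?F" by (intro CollectI exI[of _ X] conjI refl X)
    moreover have "?P y" using y(1) X(3) by simp
    ultimately show "\<exists>P\<in>?F. P y" by (intro bexI[of _ ?P])
  qed
  then obtain H where H: "H \<subseteq> ?F" "finite H" "\<forall>y\<in>tuples M ts. y \<in> value_set a \<longrightarrow> (\<exists>P\<in>H. P y)"
    by (elim exE conjE)
  have "tree_bounded ts (\<Union>(Collect ` H))"
  proof (rule tree_bounded_Union)
    fix S assume "S \<in> Collect ` H"
    then obtain X where "imaginary_set L M ?C X" "stable_set L M ?C X"
      "S = {y \<in> tuples M ts. {y} \<in> X}" using H(1) by auto
    then show "tree_bounded ts S" using stable_set_imp_tree_bounded[OF nip C(1)] by blast
  qed (use H(2) in simp)
  moreover have "value_set a \<subseteq> \<Union>(Collect ` H)" using H(3) unfolding value_set_def by auto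
  moreover have "definable L M (points M) ts (value_set a)"
    using dfn_mono[OF YC C(1)] unfolding definable_iff_dfn value_set_def by blast
  ultimately show ?thesis by (rule tree_bounded_subset)
qed

text \<open>NIP bounds the length of independent sequences.  If each \<open>d\<^sub>n = f b (a\<^sub>n)\<close> could be moved by an
  automorphism \<open>g\<^sub>n\<close> that fixes \<open>A\<close>, the sequence \<open>a\<close> and all the other \<open>d\<^sub>k\<close>, then
  compositions of the \<open>g\<^sub>n\<close> would move any prescribed set of the \<open>d\<^sub>n\<close> and no others.\<close>

lemma NIP_moving_bound:
  "\<exists>N. \<forall>b as. b \<in> B \<longrightarrow> length as = N \<longrightarrow> (\<forall>k<N. generic A (as ! k)) \<longrightarrow>
    (\<exists>n<N. \<forall>b'. same_type A (reps N ss @ us) (concat as @ b') (concat as @ b) \<longrightarrow>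
      (\<forall>k<N. k \<noteq> n \<longrightarrow> agree (as ! k) b b') \<longrightarrow> agree (as ! n) b b')"
proof -
  have "dfn2 A (ss @ ts) us (\<lambda>e b. fgraph b (take (length ss) e) (drop (length ss) e))"
    unfolding dfn2_def
    by (intro dfn3_sub[OF fgraph_dfn] tm_drop_id tm_take_left tm_take)
  from NIP_dfn[OF nip this] obtain N :: nat where N: "\<not> (\<exists>e b. (\<forall>i<N. e i \<in> tuples M (ss @ ts)) \<and>
    (\<forall>I\<subseteq>{..<N}. b I \<in> tuples M us) \<and>
    (\<forall>i<N. \<forall>I\<subseteq>{..<N}. fgraph (b I) (take (length ss) (e i)) (drop (length ss) (e i)) \<longleftrightarrow> i \<in> I))" ..
  show ?thesis
  proof (rule exI[of _ N], intro allI impI, rule ccontr)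
    fix b as assume b: "b \<in> B" and l: "length as = N" and g: "\<forall>k<N. generic A (as ! k)"
    assume "\<not> (\<exists>n<N. \<forall>b'. same_type A (reps N ss @ us) (concat as @ b') (concat as @ b) \<longrightarrow>
      (\<forall>k<N. k \<noteq> n \<longrightarrow> agree (as ! k) b b') \<longrightarrow> agree (as ! n) b b')"
    then have move: "\<exists>b'. same_type A (reps N ss @ us) (concat as @ b') (concat as @ b) \<and>
      (\<forall>k<N. k \<noteq> n \<longrightarrow> agree (as ! k) b b') \<and> \<not> agree (as ! n) b b'" if "n < N" for n using that by blast
    have "\<forall>k. \<exists>y. k < N \<longrightarrow> fgraph b (as ! k) y" using generic_defined[OF b] g by blast
    from choice[OF this] obtain d where d: "\<forall>k<N. fgraph b (as ! k) (d k)" ..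
    have bT: "b \<in> tuples M us" by (rule B_tuples[OF b])
    have asT: "as ! k \<in> tuples M ss" if "k < N" for k using g that generic_tuples by blast
    have dT: "d k \<in> tuples M ts" if "k < N" for k using d that fgraph_tuples by blast
    have single: "\<exists>h. preserves A h \<and> (\<forall>k<N. map h (as ! k) = as ! k) \<and>
      (\<forall>k<N. map h (d k) = d k \<longleftrightarrow> k \<noteq> n)" if n: "n < N" for n
    proof -
      from move[OF n] obtain b' where b': "same_type A (reps N ss @ us) (concat as @ b') (concat as @ b)"
        "\<forall>k<N. k \<noteq> n \<longrightarrow> agree (as ! k) b b'" "\<not> agree (as ! n) b b'" by blast
      from homogeneity[OF A same_type_sym[OF b'(1)]] obtain h where
        h: "preserves A h" "map h (concat as @ b) = concat as @ b'" by blast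
      have "length (map h (concat as)) = length (concat as)" by simp
      with h(2) have ha: "map h (concat as) = concat as" "map h b = b'"
        by (metis append_eq_append_conv map_append)+
      have ha': "map h (as ! k) = as ! k" if "k < N" for k
      proof (rule map_idI)
        fix x assume "x \<in> set (as ! k)"
        then have "x \<in> set (concat as)" using l that by auto
        then show "h x = x" using ha(1) by (metis list.map_id0 id_apply map_eq_conv)
      qed
      have Fb': "fgraph b' (as ! k) (map h (d k))" if k: "k < N" for k
        using fgraph_preserves[OF h(1) bT asT[OF k] dT[OF k]] d k ha(2) ha'[OF k] by simp
      have "map h (d k) = d k \<longleftrightarrow> agree (as ! k) b b'" if k: "k < N" for k
        using Fb'[OF k] d k dT[OF k] unfolding agree_def by (metis fgraph_fun)
      with b'(2,3) n h(1) ha' show ?thesis by (intro exI[of _ h]) auto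
    qed
    have many: "\<exists>h. preserves A h \<and> (\<forall>k<N. map h (as ! k) = as ! k) \<and>
      (\<forall>k<N. map h (d k) = d k \<longleftrightarrow> k \<notin> S)" if "finite S" "S \<subseteq> {..<N}" for S
      using that
    proof (induction S rule: finite_induct)
      case empty
      then show ?case using preserves_id by (intro exI[of _ "\<lambda>x. x"]) simp
    next
      case (insert n S)
      then obtain h where h: "preserves A h" "\<forall>k<N. map h (as ! k) = as ! k"
        "\<forall>k<N. map h (d k) = d k \<longleftrightarrow> k \<notin> S" by auto
      from insert.prems have n: "n < N" by simp
      from single[OF n] obtain g where g': "preserves A g" "\<forall>k<N. map g (as ! k) = as ! k"
        "\<forall>k<N. map g (d k) = d k \<longleftrightarrow> k \<noteq> n" by blast
      have "map (g \<circ> h) (d k) = d k \<longleftrightarrow> k \<notin> insert n S" if k: "k < N" for k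
      proof (cases "k \<in> S")
        case True
        then have kn: "k \<noteq> n" using insert.hyps(2) by blast
        have "map g (map h (d k)) = map g (d k) \<longleftrightarrow> map h (d k) = d k"
          by (rule preserves_inj[OF g'(1) preserves_tuples[OF h(1) dT[OF k]] dT[OF k]])
        moreover have "map g (d k) = d k" "map h (d k) \<noteq> d k" using True h(3) g'(3) k kn by blast+
        ultimately have "map (g \<circ> h) (d k) \<noteq> d k" by (metis map_map)
        with True show ?thesis by simp
      next
        case False
        with h(3) k have "map h (d k) = d k" by blast
        then have "map (g \<circ> h) (d k) = map g (d k)" by (metis map_map)
        moreover have "map g (d k) = d k \<longleftrightarrow> k \<noteq> n" using g'(3) k by blast
        ultimately have "map (g \<circ> h) (d k) = d k \<longleftrightarrow> k \<noteq> n" by (simp only:)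
        with False show ?thesis by blast
      qed
      moreover have "map (g \<circ> h) (as ! k) = as ! k" if "k < N" for k
        using h(2) g'(2) that by (metis map_map)
      ultimately show ?case using preserves_comp[OF g'(1) h(1)] by blast
    qed
    have "\<exists>h. preserves A h \<and> (\<forall>k<N. map h (as ! k) = as ! k) \<and> (\<forall>k<N. map h (d k) = d k \<longleftrightarrow> k \<in> I)"
      if "I \<subseteq> {..<N}" for I using many[of "{..<N} - I"] by auto
    then have "\<forall>I. \<exists>h. I \<subseteq> {..<N} \<longrightarrow> preserves A h \<and> (\<forall>k<N. map h (as ! k) = as ! k) \<and>
      (\<forall>k<N. map h (d k) = d k \<longleftrightarrow> k \<in> I)" by blast
    from choice[OF this] obtain h where h: "\<forall>I. I \<subseteq> {..<N} \<longrightarrow> preserves A (h I) \<and>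
      (\<forall>k<N. map (h I) (as ! k) = as ! k) \<and> (\<forall>k<N. map (h I) (d k) = d k \<longleftrightarrow> k \<in> I)" ..
    have 1: "\<forall>i<N. as ! i @ d i \<in> tuples M (ss @ ts)" using asT dT by (auto intro: tuples_append)
    have 2: "\<forall>I\<subseteq>{..<N}. map (h I) b \<in> tuples M us" using h bT preserves_tuples by blast
    have 3: "\<forall>i<N. \<forall>I\<subseteq>{..<N}. fgraph (map (h I) b) (take (length ss) (as ! i @ d i))
      (drop (length ss) (as ! i @ d i)) \<longleftrightarrow> i \<in> I"
    proof (intro allI impI)
      fix i I assume i: "i < N" and I: "I \<subseteq> {..<N}"
      have "fgraph (map (h I) b) (as ! i) (map (h I) (d i))"
        using fgraph_preserves[of "h I", OF _ bT asT[OF i] dT[OF i]] h I i d by auto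
      then have "fgraph (map (h I) b) (as ! i) (d i) \<longleftrightarrow> map (h I) (d i) = d i" using fgraph_fun by metis
      also have "\<dots> \<longleftrightarrow> i \<in> I" using h I i by blast
      finally show "fgraph (map (h I) b) (take (length ss) (as ! i @ d i))
        (drop (length ss) (as ! i @ d i)) \<longleftrightarrow> i \<in> I" using tuples_length[OF asT[OF i]] by simp
    qed
    show False
      by (rule notE[OF N], rule exI[of _ "\<lambda>i. as ! i @ d i"], rule exI[of _ "\<lambda>I. map (h I) b"],
          intro conjI 1 2 3)
  qed
qed

lemma morley_chunk:
  assumes "morley C as" "k < length as"
  shows "chunk (length ss) k (concat as) = as ! k"
proof (rule chunk_nth)
  fix a assume "a \<in> set as"
  then obtain i where "i < length as" "a = as ! i" by (auto simp: in_set_conv_nth)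
  with morley_nth[OF assms(1)] show "length a = length ss" using generic_tuples tuples_length by metis
qed (rule assms(2))

section \<open>Recovering a germ from finitely many values\<close>

text \<open>For one Morley sequence \<open>R\<close> this is boundedness of trees on a product of sets of values.  Trees of a
  fixed height being first-order, the bound depends only on the type of \<open>R\<close> over \<open>A\<close>, which is the same
  for all \<open>R\<close>.\<close>

lemma values_bound:
  assumes \<psi>: "dfn3 A (reps K ts) zs (reps n ss) \<psi>" and \<pi>: "\<And>t. t < K \<Longrightarrow> \<pi> t < n"
  shows "\<exists>h. \<forall>R. morley A R \<longrightarrow> length R = n \<longrightarrow> \<not> tree h (tuples M zs) (\<lambda>y z. \<psi> y z (concat R))
    {y \<in> tuples M (reps K ts). \<forall>t<K. chunk (length ts) t y \<in> value_set (R ! \<pi> t)}"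
proof -
  let ?ls = "length ss" and ?lt = "length ts"
  obtain R0 where R0: "length R0 = n" "morley A R0" using morley_exists[OF A] by blast
  define Dp where "Dp y r \<longleftrightarrow> (\<forall>t<K. chunk ?lt t y \<in> tuples M ts \<and>
    (\<exists>b\<in>tuples M us. fgraph b (chunk ?ls (\<pi> t) r) (chunk ?lt t y)))" for y r
  have Dp: "Dp y (concat R) \<longleftrightarrow> (\<forall>t<K. chunk ?lt t y \<in> value_set (R ! \<pi> t))"
    if "morley A R" "length R = n" for y R
    using morley_chunk[OF that(1)] \<pi> that(2) unfolding Dp_def value_set_def by auto
  have Dp_dfn: "dfn2 A (reps K ts) (reps n ss) Dp"
  proof -
    have eq: "chunk ?lt t y \<in> tuples M ts" if "t < K" "y \<in> tuples M (reps K ts)" for t y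
      by (rule tuples_chunk[OF that(2,1)])
    have "dfn2 A (reps K ts) (reps n ss)
      (\<lambda>y r. \<forall>t<K. \<exists>b\<in>tuples M us. fgraph b (chunk ?ls (\<pi> t) r) (chunk ?lt t y))"
      unfolding dfn2_def
    proof (intro dfn_all_less dfn_ex dfn3_sub[OF fgraph_dfn] tm_take)
      fix t assume t: "t < K"
      show "tm A (us @ reps K ts @ reps n ss)
        (\<lambda>e. chunk ?ls (\<pi> t) (drop (length (reps K ts)) (drop (length us) e))) ss"
        by (rule tm_chunk_comp[OF tm_drop[OF tm_drop_id] \<pi>[OF t]])
      show "tm A (us @ reps K ts @ reps n ss)
        (\<lambda>e. chunk ?lt t (take (length (reps K ts)) (drop (length us) e))) ts"
        by (rule tm_chunk_comp[OF tm_drop[OF tm_take] t])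
    qed
    then show ?thesis by (rule dfn2_cong) (use eq in \<open>auto simp: Dp_def\<close>)
  qed
  have r0: "concat R0 \<in> tuples M (reps n ss)" using morley_tuples[OF R0(2)] R0(1) by simp
  let ?D = "\<lambda>r. {y \<in> tuples M (reps K ts). Dp y r}"
  have prod: "?D (concat R0) = {concat (map y [0..<K]) | y. \<forall>t<K. y t \<in> value_set (R0 ! \<pi> t)}"
  proof (intro set_eqI iffI)
    fix y assume "y \<in> ?D (concat R0)"
    then have y: "y \<in> tuples M (reps K ts)" "\<forall>t<K. chunk ?lt t y \<in> value_set (R0 ! \<pi> t)"
      using Dp[OF R0(2,1)] by auto
    then show "y \<in> {concat (map y [0..<K]) | y. \<forall>t<K. y t \<in> value_set (R0 ! \<pi> t)}"
      by (intro CollectI exI[of _ "\<lambda>t. chunk ?lt t y"]) (simp add: tuples_concat_chunk)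
  next
    fix y assume "y \<in> {concat (map y [0..<K]) | y. \<forall>t<K. y t \<in> value_set (R0 ! \<pi> t)}"
    then obtain v where v: "y = concat (map v [0..<K])" "\<forall>t<K. v t \<in> value_set (R0 ! \<pi> t)" by blast
    then have vT: "v t \<in> tuples M ts" if "t < K" for t using that unfolding value_set_def by blast
    have "chunk ?lt t y = v t" if "t < K" for t
      unfolding v(1) by (rule chunk_concat) (use vT that tuples_length in auto)
    then show "y \<in> ?D (concat R0)"
      using Dp[OF R0(2,1)] v tuples_concat_replicate[of K v ts] vT by auto
  qed
  have tree_bounded: "tree_bounded (reps K ts) (?D (concat R0))" unfolding prod
    by (rule tree_bounded_list_prod, rule value_set_tree_bounded, rule morley_nth[OF R0(2)]) (use \<pi> R0(1) in simp)
  have "dfn2 (points M) (reps K ts) zs (\<lambda>y z. \<psi> y z (concat R0))" unfolding dfn2_def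
    by (rule dfn3_sub[OF dfn3_mono[OF \<psi> A(1)] tm_take tm_drop_id
          tm_const[OF r0 tuples_subset_points[OF r0]]])
  from tree_boundedD[OF tree_bounded this] obtain h where
    h: "\<not> tree h (tuples M zs) (\<lambda>y z. \<psi> y z (concat R0)) (?D (concat R0))" ..
  have "\<not> tree h (tuples M zs) (\<lambda>y z. \<psi> y z (concat R)) (?D (concat R))"
    if R: "morley A R" "length R = n" for R
  proof -
    have "same_type A [] [] []" unfolding same_type_def by simp
    from morley_same_type[OF this, of R R0 n] R R0 have "same_type A (reps n ss) (concat R) (concat R0)" by simp
    from same_typeD[OF this dfn_tree[OF Dp_dfn \<psi>]] h show ?thesis by simp
  qed
  with Dp show ?thesis by (intro exI[of _ h]) simp
qed

definition val :: "'m list \<Rightarrow> 'm list \<Rightarrow> 'm list" where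
  "val b a = the (f b a)"

lemma fgraph_val: "b \<in> B \<Longrightarrow> generic A a \<Longrightarrow> fgraph b a (val b a)"
  using generic_defined unfolding fgraph_def val_def by fastforce

lemma agree_iff_fgraph: "fgraph b a y \<Longrightarrow> agree a b b' \<longleftrightarrow> fgraph b' a y"
  unfolding agree_def using fgraph_fun fgraph_tuples by metis

lemma val_tuples: "b \<in> B \<Longrightarrow> generic A a \<Longrightarrow> val b a \<in> tuples M ts"
  using fgraph_val fgraph_tuples by blast

text \<open>By \<open>NIP_moving_bound\<close> some formula \<open>\<chi>\<close> in the type of \<open>b\<close> over a Morley sequence of length \<open>N\<close> makes the
  value at the place \<open>n\<close> a function of the values on the \<open>l\<close> older elements \<open>Lf\<close> and the \<open>n\<close> newer
  elements \<open>R\<close>.  If some \<open>b'\<close> agreed with \<open>b\<close> on a long Morley sequence without having the same germ, it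
  would disagree on all later elements that are generic over \<open>b\<close> and \<open>b'\<close>; so there would be \<open>c i\<close>
  which agree with \<open>b\<close> on \<open>Lf\<close> and, in the middle part, exactly on the elements older than the \<open>i\<close>-th.
  But whether \<open>b\<close> and \<open>c i\<close> agree at an element \<open>x\<close> of the middle part can be read off from their values
  on \<open>R\<close>: a long half graph between tuples of values and elements \<open>x\<close>.\<close>

lemma germ_determined:
  assumes b: "b \<in> B"
  shows "\<exists>n. \<forall>as b'. length as = n \<longrightarrow> morley (A \<union> set b) as \<longrightarrow>
    same_type A (reps n ss @ us) (concat as @ b') (concat as @ b) \<longrightarrow>
    (\<forall>a\<in>set as. agree a b b') \<longrightarrow> same_germ b b'"
proof -
  let ?ls = "length ss" and ?lt = "length ts"
  have bT: "b \<in> tuples M us" by (rule B_tuples[OF b])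
  have Ab: "A \<union> set b \<subseteq> points M" "small \<kappa> (A \<union> set b)" using small_points_Un[OF bT A] by auto
  have same_type_refl: "same_type A us b b" using bT unfolding same_type_def by simp
  obtain N where N: "\<And>b as. b \<in> B \<Longrightarrow> length as = N \<Longrightarrow> (\<forall>k<N. generic A (as ! k)) \<Longrightarrow>
    (\<exists>n<N. \<forall>b'. same_type A (reps N ss @ us) (concat as @ b') (concat as @ b) \<longrightarrow>
      (\<forall>k<N. k \<noteq> n \<longrightarrow> agree (as ! k) b b') \<longrightarrow> agree (as ! n) b b')"
    using NIP_moving_bound by blast
  obtain as0 where as0: "length as0 = N" "morley (A \<union> set b) as0" using morley_exists[OF Ab] by blast
  have "\<forall>k<N. generic A (as0 ! k)" using morley_nth[OF as0(2)] as0(1) generic_mono by (metis Un_upper1)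
  from N[OF b as0(1) this] obtain n where n: "n < N" and
    move: "\<And>b'. same_type A (reps N ss @ us) (concat as0 @ b') (concat as0 @ b) \<Longrightarrow>
      (\<forall>k<N. k \<noteq> n \<longrightarrow> agree (as0 ! k) b b') \<Longrightarrow> agree (as0 ! n) b b'" by blast
  define Q where "Q a b1 b2 \<longleftrightarrow> ((\<forall>k<N. k \<noteq> n \<longrightarrow> agree (chunk ?ls k a) b1 b2) \<longrightarrow>
    agree (chunk ?ls n a) b1 b2)" for a b1 b2
  have Qd: "dfn3 A (reps N ss) us us Q" unfolding dfn3_def Q_def
    by (intro dfn_imp dfn_all_less dfn_const dfn3_sub[OF agree_dfn] tm_chunk_comp[OF tm_take]
        tm_drop tm_take tm_drop_id n)
  have c0: "concat as0 \<in> tuples M (reps N ss)" using morley_tuples[OF as0(2)] as0(1) by simp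
  have "\<exists>\<chi>. dfn2 A (reps N ss) us \<chi> \<and> \<chi> (concat as0) b \<and> (\<forall>a'\<in>tuples M (reps N ss).
    \<forall>b1\<in>tuples M us. \<forall>b2\<in>tuples M us. \<chi> a' b1 \<longrightarrow> \<chi> a' b2 \<longrightarrow> Q a' b1 b2)"
  proof (rule same_type_formula[OF A Qd c0 bT])
    fix b' assume "same_type A (reps N ss @ us) (concat as0 @ b') (concat as0 @ b)"
    from move[OF this] show "Q (concat as0) b b'"
      unfolding Q_def using morley_chunk[OF as0(2)] as0(1) n by simp
  qed
  then obtain \<chi> where \<chi>: "dfn2 A (reps N ss) us \<chi>" "\<chi> (concat as0) b" and
    \<chi>Q: "\<And>a' b1 b2. a' \<in> tuples M (reps N ss) \<Longrightarrow> b1 \<in> tuples M us \<Longrightarrow> b2 \<in> tuples M us \<Longrightarrow>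
      \<chi> a' b1 \<Longrightarrow> \<chi> a' b2 \<Longrightarrow> Q a' b1 b2" by blast
  have \<chi>_mor: "\<chi> (concat as) b'"
    if "same_type A us b' b" "morley (A \<union> set b') as" "length as = N" for as b'
  proof -
    have "concat as \<in> tuples M (reps N ss)" using morley_tuples[OF that(2)] that(3) by simp
    then show ?thesis
      using same_typeD[OF morley_same_type[OF that(1,2) as0(2) that(3) as0(1)] \<chi>(1)[unfolded dfn2_def]] \<chi>(2)
        tuples_length[OF c0] tuples_length[of "concat as" M "reps N ss"] by simp
  qed
  define l where "l = N - Suc n"
  have Nn: "N = n + (1 + l)" using n by (simp add: l_def)
  have repsN: "reps N ss = reps n ss @ ss @ reps l ss" unfolding Nn concat_replicate_add by simp
  let ?Zs = "ss @ reps l ss @ reps l ts" and ?Ys = "reps (n + n) ts" and ?Rs = "reps n ss"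
  define zx zl zy where "zx z = take ?ls z" and "zl z = take (length (reps l ss)) (drop ?ls z)"
    and "zy z = drop (length (reps l ss)) (drop ?ls z)" for z :: "'m list"
  have tz: "tm A ?Zs zx ss" "tm A ?Zs zl (reps l ss)" "tm A ?Zs zy (reps l ts)"
    unfolding zx_def[abs_def] zl_def[abs_def] zy_def[abs_def]
    by (rule tm_take, rule tm_drop[OF tm_take], rule tm_drop[OF tm_drop_id])
  \<comment> \<open>nodes \<open>z\<close> consist of a point \<open>x\<close>, the older elements and the values there, leaves \<open>y\<close> of the values of two
    functions on the newer elements \<open>r\<close>; on \<open>\<chi>\<close> these data decide whether the functions agree at \<open>x\<close>\<close>
  define \<rho> where "\<rho> y z r \<longleftrightarrow> (\<exists>b1\<in>tuples M us. \<exists>b2\<in>tuples M us.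
    \<chi> (r @ zx z @ zl z) b1 \<and> \<chi> (r @ zx z @ zl z) b2 \<and>
    (\<forall>k<l. fgraph b1 (chunk ?ls k (zl z)) (chunk ?lt k (zy z))) \<and>
    (\<forall>k<l. fgraph b2 (chunk ?ls k (zl z)) (chunk ?lt k (zy z))) \<and>
    (\<forall>k<n. fgraph b1 (chunk ?ls k r) (chunk ?lt k y)) \<and>
    (\<forall>k<n. fgraph b2 (chunk ?ls k r) (chunk ?lt (n + k) y)) \<and> agree (zx z) b1 b2)" for y z r
  have \<rho>d: "dfn3 A ?Ys ?Zs ?Rs \<rho>"
  proof -
    let ?c = "us @ us @ ?Ys @ ?Zs @ ?Rs"
    let ?e = "\<lambda>e. drop (length us) (drop (length us) e)"
    let ?y = "\<lambda>e. take (length ?Ys) (?e e)"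
    let ?z = "\<lambda>e. take (length ?Zs) (drop (length ?Ys) (?e e))"
    let ?r = "\<lambda>e. drop (length ?Zs) (drop (length ?Ys) (?e e))"
    have ty: "tm A ?c ?y ?Ys" by (rule tm_drop[OF tm_drop[OF tm_take]])
    have "tm A (?Ys @ ?Zs @ ?Rs) (\<lambda>e. take (length ?Zs) (drop (length ?Ys) e)) ?Zs"
      by (rule tm_slice)
    from tm_drop[OF tm_drop[OF this]] have tzz: "tm A ?c ?z ?Zs" .
    have "tm A (?Ys @ ?Zs @ ?Rs) (\<lambda>e. drop (length ?Zs) (drop (length ?Ys) e)) ?Rs"
      using tm_drop[OF tm_drop_id[of A ?Zs ?Rs], of ?Ys] by simp
    from tm_drop[OF tm_drop[OF this]] have tr: "tm A ?c ?r ?Rs" .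
    note tx = tm_comp[OF tzz tz(1)] and tl = tm_comp[OF tzz tz(2)] and tzy = tm_comp[OF tzz tz(3)]
    have tN: "tm A ?c (\<lambda>e. ?r e @ zx (?z e) @ zl (?z e)) (reps N ss)"
      unfolding repsN by (intro tm_append tr tx tl)
    have tb1: "tm A ?c (\<lambda>e. take (length us) (drop (length us) e)) us" by (rule tm_drop[OF tm_take])
    have tb2: "tm A ?c (\<lambda>e. take (length us) e) us" by (rule tm_take)
    have "dfn A ?c (\<lambda>e. \<chi> (?r e @ zx (?z e) @ zl (?z e)) (take (length us) (drop (length us) e)) \<and>
      \<chi> (?r e @ zx (?z e) @ zl (?z e)) (take (length us) e) \<and>
      (\<forall>k<l. fgraph (take (length us) (drop (length us) e)) (chunk ?ls k (zl (?z e))) (chunk ?lt k (zy (?z e)))) \<and>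
      (\<forall>k<l. fgraph (take (length us) e) (chunk ?ls k (zl (?z e))) (chunk ?lt k (zy (?z e)))) \<and>
      (\<forall>k<n. fgraph (take (length us) (drop (length us) e)) (chunk ?ls k (?r e)) (chunk ?lt k (?y e))) \<and>
      (\<forall>k<n. fgraph (take (length us) e) (chunk ?ls k (?r e)) (chunk ?lt (n + k) (?y e))) \<and>
      agree (zx (?z e)) (take (length us) (drop (length us) e)) (take (length us) e))"
      by (intro dfn_conj dfn_all_less dfn2_sub[OF \<chi>(1)] dfn3_sub[OF fgraph_dfn] dfn3_sub[OF agree_dfn]
          tN tb1 tb2 tx tm_chunk_comp[OF tl] tm_chunk_comp[OF tzy] tm_chunk_comp[OF tr]
          tm_chunk_comp[OF ty]) simp_all
    then show ?thesis unfolding dfn3_def \<rho>_def by (intro dfn_ex)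
  qed
  define \<pi> where "\<pi> t = (if t < n then t else t - n)" for t
  have \<pi>: "\<pi> t < n" if "t < n + n" for t using that by (auto simp: \<pi>_def)
  from values_bound[OF \<rho>d, of \<pi>, OF \<pi>] obtain h where h: "\<And>R. morley A R \<Longrightarrow> length R = n \<Longrightarrow>
    \<not> tree h (tuples M ?Zs) (\<lambda>y z. \<rho> y z (concat R))
      {y \<in> tuples M ?Ys. \<forall>t<n + n. chunk ?lt t y \<in> value_set (R ! \<pi> t)}" by blast
  \<comment> \<open>a half graph of this length makes a tree of height \<open>h\<close>\<close>
  define J :: nat where "J = 2 ^ h"
  have J0: "0 < J" by (simp add: J_def)
  show ?thesis
  proof (rule exI[of _ "J + l"], intro allI impI, rule ccontr)
    fix as b' assume len: "length as = J + l" and mas: "morley (A \<union> set b) as"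
      and e: "same_type A (reps (J + l) ss @ us) (concat as @ b') (concat as @ b)"
      and agree: "\<forall>a\<in>set as. agree a b b'" and no: "\<not> same_germ b b'"
    have aT: "concat as \<in> tuples M (reps (J + l) ss)" using morley_tuples[OF mas] len by simp
    have eb: "same_type A us b' b" using same_type_tm[OF e tm_drop_id] tuples_length[OF aT] by simp
    have b'T: "b' \<in> tuples M us" using eb unfolding same_type_def by blast
    have "b' \<in> B" using same_typeD[OF eb dfn_mem[OF B_definable tm_id]] b by blast
    note b' = this
    have mas': "morley (A \<union> set b') as" by (rule morley_transfer[OF mas len same_type_sym[OF e] bT b'T])
    define W Lf where "W = take J as" and "Lf = drop J as"
    have as: "as = W @ Lf" "length W = J" "length Lf = l" using len by (auto simp: W_def Lf_def)
    let ?D = "A \<union> set b \<union> set b' \<union> set (concat as)"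
    have "?D \<subseteq> points M" "small \<kappa> ?D"
      using Ab small_points_Un[OF b'T Ab] tuples_subset_points[OF aT] small_Un_set by blast+
    from morley_exists[OF this] obtain XR where XR: "length XR = n + J" "morley ?D XR" by blast
    define R X where "R = take n XR" and "X = drop n XR"
    have RX: "XR = R @ X" "length R = n" "length X = J" using XR(1) by (auto simp: R_def X_def)
    have m1: "morley (A \<union> set b) (R @ X @ W @ Lf)" "morley (A \<union> set b') (R @ X @ W @ Lf)"
      using morley_append[of "A \<union> set b" as XR] morley_append[of "A \<union> set b'" as XR] mas mas'
        morley_mono[OF XR(2), of "A \<union> set b \<union> set (concat as)"]
        morley_mono[OF XR(2), of "A \<union> set b' \<union> set (concat as)"] RX(1) as(1) by auto
    have disagree: "\<not> agree a b b'" if "a \<in> set X" for a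
    proof -
      from that RX(1) obtain k where "k < length XR" "a = XR ! k"
        by (metis Un_iff in_set_conv_nth set_append)
      with morley_nth[OF XR(2)] have "generic (A \<union> set b \<union> set b') a" using generic_mono by (metis Un_upper1)
      with generic_same_germ[OF b b'] no show ?thesis by blast
    qed
    \<comment> \<open>\<open>i + 1\<close> places of disagreement, from \<open>X\<close>, followed by older places of agreement, from \<open>W\<close>; all these
      sequences have the same type over \<open>b\<close>, so moving them to \<open>mid 0\<close> moves \<open>b'\<close> to conjugates \<open>c i\<close>\<close>
    define mid where "mid i = drop (J - 1 - i) X @ drop (i + 1) W" for i
    have mid_len: "length (mid i) = J" if "i < J" for i using that RX(3) as(2) by (simp add: mid_def)
    have mid_agree: "agree (mid i ! q) b b' \<longleftrightarrow> i < q" if "i < J" "q < J" for i q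
    proof (cases "i < q")
      case True
      then have "mid i ! q = W ! q" using that RX(3) as(2) by (simp add: mid_def nth_append)
      then have "mid i ! q \<in> set as" using that as by simp
      with agree True show ?thesis by blast
    next
      case False
      then have "mid i ! q = X ! (J - 1 - i + q)" using that RX(3) by (simp add: mid_def nth_append)
      moreover have "J - 1 - i + q < length X" using that False RX(3) by simp
      ultimately have "mid i ! q \<in> set X" by (metis nth_mem)
      with disagree False show ?thesis by blast
    qed
    have m2: "morley C (R @ mid i @ Lf)" if m: "morley C (R @ X @ W @ Lf)" for i C
    proof -
      have "morley C (R @ (take (J - 1 - i) X @ drop (J - 1 - i) X @ W @ Lf))"
        using m by (metis append.assoc append_take_drop_id)
      then have "morley C (R @ drop (J - 1 - i) X @ W @ Lf)" by (rule morley_delete)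
      then have "morley C ((R @ drop (J - 1 - i) X) @ take (i + 1) W @ (drop (i + 1) W @ Lf))"
        by (metis append.assoc append_take_drop_id)
      then have "morley C ((R @ drop (J - 1 - i) X) @ drop (i + 1) W @ Lf)" by (rule morley_delete)
      then show ?thesis by (simp add: mid_def)
    qed
    have m3: "morley C (R @ mid i ! q # Lf)" if m: "morley C (R @ mid i @ Lf)" and i: "i < J" and q: "q < J"
      for i q C
    proof -
      have s: "mid i = take q (mid i) @ [mid i ! q] @ drop (Suc q) (mid i)"
        using mid_len[OF i] q by (simp add: id_take_nth_drop)
      have "morley C (R @ take q (mid i) @ ([mid i ! q] @ drop (Suc q) (mid i) @ Lf))"
        using m by (subst (asm) s) simp
      then have "morley C (R @ ([mid i ! q] @ drop (Suc q) (mid i) @ Lf))" by (rule morley_delete)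
      then have "morley C ((R @ [mid i ! q]) @ drop (Suc q) (mid i) @ Lf)" by simp
      then have "morley C ((R @ [mid i ! q]) @ Lf)" by (rule morley_delete)
      then show ?thesis by simp
    qed
    let ?T = "n + (J + l)"
    have lenseq: "length (R @ mid i @ Lf) = ?T" if "i < J" for i using mid_len[OF that] RX as by simp
    have "\<exists>c. same_type A (reps ?T ss @ us @ us) (concat (R @ mid 0 @ Lf) @ b @ c)
      (concat (R @ mid i @ Lf) @ b @ b')" if i: "i < J" for i
    proof -
      let ?s = "concat (R @ mid i @ Lf)" and ?start = "concat (R @ mid 0 @ Lf)"
      have sT: "?s \<in> tuples M (reps ?T ss)" "?start \<in> tuples M (reps ?T ss)"
        using morley_tuples[OF m2[OF m1(1)]] lenseq[OF i] lenseq[OF J0] by metis+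
      have "same_type A (reps ?T ss @ us) (?s @ b) (?start @ b)"
        by (rule morley_same_type[OF same_type_refl m2[OF m1(1)] m2[OF m1(1)] lenseq[OF i] lenseq[OF J0]])
      from homogeneity[OF A this] obtain g where g: "preserves A g" "map g (?s @ b) = ?start @ b" by blast
      have "map g ?s @ map g b = ?start @ b" using g(2) by simp
      moreover have "length (map g ?s) = length ?start" using tuples_length[OF sT(1)] tuples_length[OF sT(2)] by simp
      ultimately have gg: "map g ?s = ?start" "map g b = b" by (metis append_eq_append_conv)+
      have "same_type A (reps ?T ss @ us @ us) (map g (?s @ b @ b')) (?s @ b @ b')"
        by (rule same_type_preserves[OF g(1)]) (intro tuples_append sT bT b'T)
      moreover have "map g (?s @ b @ b') = ?start @ b @ map g b'" unfolding map_append gg ..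
      ultimately show ?thesis by (intro exI[of _ "map g b'"]) (simp only:)
    qed
    then have "\<forall>i. \<exists>c. i < J \<longrightarrow> same_type A (reps ?T ss @ us @ us) (concat (R @ mid 0 @ Lf) @ b @ c)
      (concat (R @ mid i @ Lf) @ b @ b')" by blast
    from choice[OF this] obtain c where c: "\<And>i. i < J \<Longrightarrow> same_type A (reps ?T ss @ us @ us)
      (concat (R @ mid 0 @ Lf) @ b @ c i) (concat (R @ mid i @ Lf) @ b @ b')" by blast
    let ?S = "R @ mid 0 @ Lf"
    have mS: "morley (A \<union> set b) ?S" by (rule m2[OF m1(1)])
    have mSA: "morley A ?S" by (rule morley_mono[OF mS]) simp
    have genS: "generic A a" if "a \<in> set ?S" for a
      using that morley_nth[OF mSA] by (metis in_set_conv_nth)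
    have ST: "concat ?S \<in> tuples M (reps ?T ss)" using morley_tuples[OF mSA] lenseq[OF J0] by simp
    have cT: "c i \<in> tuples M us" if i: "i < J" for i
    proof -
      have "same_type A us (drop (length us) (drop (length (reps ?T ss)) (concat ?S @ b @ c i)))
         (drop (length us) (drop (length (reps ?T ss)) (concat (R @ mid i @ Lf) @ b @ b')))"
        by (rule same_type_tm[OF c[OF i] tm_drop[OF tm_drop_id]])
      moreover have "drop (length us) (drop (length (reps ?T ss)) (concat ?S @ b @ c i)) = c i"
        using tuples_length[OF ST] tuples_length[OF bT] by simp
      ultimately show ?thesis unfolding same_type_def by metis
    qed
    have transfer: "P (concat ?S) b (c i) \<longleftrightarrow> P (concat (R @ mid i @ Lf)) b b'"
      if P: "dfn3 A (reps ?T ss) us us P" and i: "i < J" for P i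
    proof -
      have "concat (R @ mid i @ Lf) \<in> tuples M (reps ?T ss)"
        using morley_tuples[OF m2[OF m1(1)]] lenseq[OF i] by metis
      then show ?thesis
        using same_typeD[OF c[OF i] P[unfolded dfn3_def]] tuples_length[OF ST] tuples_length[OF bT]
          tuples_length[of "concat (R @ mid i @ Lf)" M "reps ?T ss"] by simp
    qed
    have chS: "chunk ?ls k (concat (R @ mid i @ Lf)) = (R @ mid i @ Lf) ! k" if "k < ?T" "i < J" for k i
      by (rule morley_chunk[OF m2[OF m1(1)]]) (use that lenseq in simp)
    have cag: "agree (?S ! k) b (c i) \<longleftrightarrow> agree ((R @ mid i @ Lf) ! k) b b'" if i: "i < J" and k: "k < ?T" for i k
    proof -
      have "dfn3 A (reps ?T ss) us us (\<lambda>a b1 b2. agree (chunk ?ls k a) b1 b2)" unfolding dfn3_def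
        by (intro dfn3_sub[OF agree_dfn] tm_chunk_comp[OF tm_take] tm_drop tm_take tm_drop_id k)
      from transfer[OF this i] show ?thesis using chS[OF k i] chS[OF k J0] by simp
    qed
    have cB: "c i \<in> B" if i: "i < J" for i
    proof -
      have "dfn3 A (reps ?T ss) us us (\<lambda>a b1 b2. b2 \<in> B)" unfolding dfn3_def
        by (intro dfn_mem[OF B_definable] tm_drop tm_drop_id)
      from transfer[OF this i] b' show ?thesis by blast
    qed
    have c_mid: "agree (mid 0 ! q) b (c i) \<longleftrightarrow> i < q" if "i < J" "q < J" for i q
      using cag[of i "n + q"] mid_agree[OF that] that RX(2) mid_len J0 by (simp add: nth_append)
    have c_Lf: "agree (Lf ! k) b (c i)" if "i < J" "k < l" for i k
    proof -
      have "Lf ! k \<in> set as" using that as by simp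
      then show ?thesis using cag[of i "n + (J + k)"] that RX(2) mid_len J0 agree
        by (simp add: nth_append)
    qed
    have \<chi>b: "\<chi> (concat (R @ mid 0 ! q # Lf)) b" if "q < J" for q
      by (rule \<chi>_mor[OF same_type_refl m3[OF mS J0 that]]) (use RX as Nn in simp)
    have \<chi>c: "\<chi> (concat (R @ mid 0 ! q # Lf)) (c i)" if i: "i < J" and q: "q < J" for q i
    proof -
      let ?a = "\<lambda>a. take (length (reps n ss)) a @ chunk ?ls (n + q) a @ drop (length (reps (n + J) ss)) a"
      have 1: "?a (concat (R @ mid i @ Lf)) = concat (R @ mid i ! q # Lf)" if i: "i < J" for i
      proof -
        have mR: "morley A R" "morley A (R @ mid i)"
          using morley_delete[of A R "mid i @ Lf" "[]"] morley_delete[of A "R @ mid i" Lf "[]"]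
            morley_mono[OF m2[OF m1(1)], of A i] by simp_all
        have "length (concat R) = length (reps n ss)"
          using morley_tuples[OF mR(1)] RX(2) tuples_length by metis
        moreover have "length (concat (R @ mid i)) = length (reps (n + J) ss)"
          using morley_tuples[OF mR(2)] RX(2) mid_len[OF i] tuples_length by (metis length_append)
        moreover have "chunk ?ls (n + q) (concat (R @ mid i @ Lf)) = mid i ! q"
          using chS[of "n + q" i] i q RX(2) mid_len by (simp add: nth_append)
        ultimately show ?thesis by simp
      qed
      have rT: "reps ?T ss = reps (n + J) ss @ reps l ss" "reps ?T ss = reps n ss @ reps (J + l) ss"
        using concat_replicate_add[of "n + J" l ss] concat_replicate_add[of n "J + l" ss] by (simp_all add: add.assoc)
      have ta: "tm A (reps ?T ss) ?a (reps N ss)" unfolding repsN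
      proof (intro tm_append)
        show "tm A (reps ?T ss) (take (length (reps n ss))) (reps n ss)"
          unfolding rT(2) by (rule tm_take)
        show "tm A (reps ?T ss) (chunk ?ls (n + q)) ss" by (rule tm_chunk) (use q in simp)
        show "tm A (reps ?T ss) (drop (length (reps (n + J) ss))) (reps l ss)"
          unfolding rT(1) by (rule tm_drop_id)
      qed
      have "dfn3 A (reps ?T ss) us us (\<lambda>a b1 b2. \<chi> (?a a) b2)" unfolding dfn3_def
        by (rule dfn2_sub[OF \<chi>(1) tm_take_left[OF ta] tm_drop[OF tm_drop_id]])
      from transfer[OF this i] have "\<chi> (concat (R @ mid 0 ! q # Lf)) (c i) \<longleftrightarrow>
        \<chi> (concat (R @ mid i ! q # Lf)) b'" unfolding 1[OF i] 1[OF J0] .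
      moreover have "\<chi> (concat (R @ mid i ! q # Lf)) b'"
        by (rule \<chi>_mor[OF eb m3[OF m2[OF m1(2)] i q]]) (use RX as Nn in simp)
      ultimately show ?thesis by blast
    qed
    have mR: "morley A R" using morley_delete[of A R "mid 0 @ Lf" "[]"] mSA by simp
    have RT: "R ! k \<in> tuples M ss" "generic A (R ! k)" if "k < n" for k
      using genS[of "R ! k"] that RX(2) generic_tuples by auto
    have LT: "Lf ! k \<in> tuples M ss" "generic A (Lf ! k)" if "k < l" for k
      using genS[of "Lf ! k"] that as(3) generic_tuples by auto
    have xT: "mid 0 ! q \<in> tuples M ss" if "q < J" for q
      using genS[of "mid 0 ! q"] that mid_len[OF J0] generic_tuples by auto
    define v where "v i t = (if t < n then val b (R ! t) else val (c i) (R ! (t - n)))" for i t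
    define y where "y i = concat (map (v i) [0..<n + n])" for i
    define zL where "zL = concat (map (\<lambda>k. val b (Lf ! k)) [0..<l])"
    define z where "z q = mid 0 ! q @ concat Lf @ zL" for q
    have vT: "v i t \<in> tuples M ts" if "i < J" "t < n + n" for i t
      using that val_tuples[OF b RT(2)] val_tuples[OF cB RT(2)] by (simp add: v_def)
    have yT: "y i \<in> tuples M ?Ys" if "i < J" for i
      unfolding y_def by (rule tuples_concat_replicate) (use vT that in blast)
    have ych: "chunk ?lt t (y i) = v i t" if "i < J" "t < n + n" for i t
      unfolding y_def by (rule chunk_concat) (use vT that tuples_length in blast)+
    have mL: "morley A Lf" using morley_suffix[of A "R @ mid 0" Lf] mSA by simp
    have LfT: "concat Lf \<in> tuples M (reps l ss)" using morley_tuples[OF mL] as(3) by simp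
    have zLT: "zL \<in> tuples M (reps l ts)"
      unfolding zL_def by (rule tuples_concat_replicate) (use val_tuples[OF b LT(2)] in blast)
    have zLch: "chunk ?lt k zL = val b (Lf ! k)" if "k < l" for k
      unfolding zL_def by (rule chunk_concat) (use val_tuples[OF b LT(2)] that tuples_length in blast)+
    have zT: "z q \<in> tuples M ?Zs" if "q < J" for q
      unfolding z_def by (intro tuples_append xT[OF that] LfT zLT)
    have zparts: "zx (z q) = mid 0 ! q" "zl (z q) = concat Lf" "zy (z q) = zL" if "q < J" for q
      using tuples_length[OF xT[OF that]] tuples_length[OF LfT]
      by (simp_all add: z_def zx_def zl_def zy_def)
    have Rch: "chunk ?ls k (concat R) = R ! k" if "k < n" for k
      by (rule morley_chunk[OF mR]) (use that RX in simp)
    have Lch: "chunk ?ls k (concat Lf) = Lf ! k" if "k < l" for k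
      by (rule morley_chunk[OF mL]) (use that as in simp)
    have Fb: "fgraph b (R ! k) (v i k)" if "k < n" for k i
      using fgraph_val[OF b RT(2)[OF that]] that by (simp add: v_def)
    have Fc: "fgraph (c i) (R ! k) (v i (n + k))" if "k < n" "i < J" for k i
      using fgraph_val[OF cB[OF that(2)] RT(2)[OF that(1)]] that by (simp add: v_def)
    have FbL: "fgraph b (Lf ! k) (val b (Lf ! k))" if "k < l" for k by (rule fgraph_val[OF b LT(2)[OF that]])
    have FcL: "fgraph (c i) (Lf ! k) (val b (Lf ! k))" if "k < l" "i < J" for k i
      using agree_iff_fgraph[OF FbL[OF that(1)]] c_Lf[OF that(2,1)] by blast
    have "tree h (tuples M ?Zs) (\<lambda>y z. \<rho> y z (concat R))
      {y \<in> tuples M ?Ys. \<forall>t<n + n. chunk ?lt t y \<in> value_set (R ! \<pi> t)}"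
    proof (rule ladder_imp_tree)
      fix i :: nat assume "i < 2 ^ h"
      then have i: "i < J" by (simp add: J_def)
      have "v i t \<in> value_set (R ! \<pi> t)" if t: "t < n + n" for t
      proof (cases "t < n")
        case True
        with Fb[OF True] bT vT[OF i t] show ?thesis by (auto simp: value_set_def \<pi>_def)
      next
        case False
        then have "t - n < n" using t by linarith
        from Fc[OF this i] False have "fgraph (c i) (R ! (t - n)) (v i t)" by simp
        with False cT[OF i] vT[OF i t] show ?thesis by (auto simp: value_set_def \<pi>_def)
      qed
      then show "y i \<in> {y \<in> tuples M ?Ys. \<forall>t<n + n. chunk ?lt t y \<in> value_set (R ! \<pi> t)} \<and> z i \<in> tuples M ?Zs"
        using yT[OF i] zT[OF i] ych[OF i] by simp
    next
      fix i q :: nat assume "i < 2 ^ h" "q < 2 ^ h"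
      then have i: "i < J" and q: "q < J" by (simp_all add: J_def)
      let ?a = "concat (R @ mid 0 ! q # Lf)"
      have a: "?a = concat R @ mid 0 ! q @ concat Lf" by simp
      have ma: "morley A (R @ mid 0 ! q # Lf)" by (rule m3[OF mSA J0 q])
      have aT: "?a \<in> tuples M (reps N ss)" using morley_tuples[OF ma] RX(2) as(3) Nn by simp
      have ach: "chunk ?ls k ?a = (R @ mid 0 ! q # Lf) ! k" if "k < N" for k
        by (rule morley_chunk[OF ma]) (use that RX as Nn in simp)
      show "\<rho> (y i) (z q) (concat R) \<longleftrightarrow> i < q"
      proof
        assume "i < q"
        then have x: "agree (mid 0 ! q) b (c i)" using c_mid[OF i q] by simp
        show "\<rho> (y i) (z q) (concat R)" unfolding \<rho>_def zparts[OF q] a[symmetric]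
        proof (rule bexI[of _ b], rule bexI[of _ "c i"], intro conjI allI impI)
          show "\<chi> ?a b" by (rule \<chi>b[OF q])
          show "\<chi> ?a (c i)" by (rule \<chi>c[OF i q])
        qed (use x bT cT[OF i] Lch zLch Rch ych[OF i] FbL FcL[OF _ i] Fb Fc[OF _ i] in simp_all)
      next
        assume "\<rho> (y i) (z q) (concat R)"
        then obtain b1 b2 where bb: "b1 \<in> tuples M us" "b2 \<in> tuples M us" "\<chi> ?a b1" "\<chi> ?a b2"
          "\<forall>k<l. fgraph b1 (chunk ?ls k (concat Lf)) (chunk ?lt k zL)"
          "\<forall>k<l. fgraph b2 (chunk ?ls k (concat Lf)) (chunk ?lt k zL)"
          "\<forall>k<n. fgraph b1 (chunk ?ls k (concat R)) (chunk ?lt k (y i))"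
          "\<forall>k<n. fgraph b2 (chunk ?ls k (concat R)) (chunk ?lt (n + k) (y i))" "agree (mid 0 ! q) b1 b2"
          unfolding \<rho>_def zparts[OF q] a by blast
        have old: "agree (chunk ?ls k ?a) b' b''"
          if k: "k < N" "k \<noteq> n" and R: "\<And>k. k < n \<Longrightarrow> agree (R ! k) b' b''"
            and L: "\<And>k. k < l \<Longrightarrow> agree (Lf ! k) b' b''" for b' b'' k
        proof (cases "k < n")
          case True
          with R ach[OF k(1)] RX(2) show ?thesis by (simp add: nth_append)
        next
          case False
          then have "k - Suc n < l" "(R @ mid 0 ! q # Lf) ! k = Lf ! (k - Suc n)"
            using k RX(2) Nn by (auto simp: nth_append nth_Cons')
          with L ach[OF k(1)] show ?thesis by simp
        qed
        have an: "chunk ?ls n ?a = mid 0 ! q" using ach[OF n] RX(2) by (simp add: nth_append)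
        have "agree (mid 0 ! q) b1 b"
        proof -
          have "agree (R ! k) b1 b" if "k < n" for k
            using bb(7) Rch[OF that] ych[OF i, of k] Fb[OF that] that agreeI by auto
          moreover have "agree (Lf ! k) b1 b" if "k < l" for k
            using bb(5) Lch[OF that] zLch[OF that] FbL[OF that] that agreeI by auto
          ultimately show ?thesis
            using \<chi>Q[OF aT bb(1) bT bb(3) \<chi>b[OF q]] old unfolding Q_def an by blast
        qed
        moreover have "agree (mid 0 ! q) b2 (c i)"
        proof -
          have "agree (R ! k) b2 (c i)" if "k < n" for k
            using bb(8) Rch[OF that] ych[OF i, of "n + k"] Fc[OF that i] that agreeI by auto
          moreover have "agree (Lf ! k) b2 (c i)" if "k < l" for k
            using bb(6) Lch[OF that] zLch[OF that] FcL[OF that i] that agreeI by auto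
          ultimately show ?thesis
            using \<chi>Q[OF aT bb(2) cT[OF i] bb(4) \<chi>c[OF i q]] old unfolding Q_def an by blast
        qed
        ultimately have "agree (mid 0 ! q) b (c i)" using bb(9) agree_sym agree_trans by blast
        then show "i < q" using c_mid[OF i q] by simp
      qed
    qed
    with h[OF mR RX(2)] show False by blast
  qed
qed

section \<open>Bounded trees for germ-invariant relations\<close>

text \<open>Among the indices satisfying \<open>\<chi>\<close>, the germ is a function of the values at \<open>n\<close> points.\<close>

definition determines :: "nat \<Rightarrow> ('m list \<Rightarrow> 'm list \<Rightarrow> bool) \<Rightarrow> bool" where
  "determines n \<chi> \<longleftrightarrow> dfn2 A (reps n ss) us \<chi> \<and>
     (\<forall>a\<in>tuples M (reps n ss). \<forall>b1\<in>tuples M us. \<forall>b2\<in>tuples M us.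
       \<chi> a b1 \<longrightarrow> \<chi> a b2 \<longrightarrow> (\<forall>k<n. agree (chunk (length ss) k a) b1 b2) \<longrightarrow> same_germ b1 b2)"

text \<open>The newest elements of a sequence come first, so a longer Morley sequence is cut down by dropping an
  initial block.\<close>

lemma determines_pad:
  assumes "determines n \<chi>" "n \<le> n'"
  shows "determines n' (\<lambda>a b. \<chi> (drop (length (reps (n' - n) ss)) a) b)"
  unfolding determines_def
proof (intro conjI ballI impI)
  have r: "reps n' ss = reps (n' - n) ss @ reps n ss" using concat_replicate_add[of "n' - n" n ss] assms(2) by simp
  have l: "length (reps (n' - n) ss) = (n' - n) * length ss"
    by (simp add: length_concat sum_list_replicate)
  have \<chi>: "dfn2 A (reps n ss) us \<chi>" using assms(1) unfolding determines_def by blast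
  show "dfn2 A (reps n' ss) us (\<lambda>a b. \<chi> (drop (length (reps (n' - n) ss)) a) b)" unfolding dfn2_def
    by (rule dfn2_sub[OF \<chi>]) (unfold r, rule tm_take_left[OF tm_drop_id], rule tm_drop_id)
  fix a b1 b2
  assume a: "a \<in> tuples M (reps n' ss)" and b: "b1 \<in> tuples M us" "b2 \<in> tuples M us"
    and x: "\<chi> (drop (length (reps (n' - n) ss)) a) b1" "\<chi> (drop (length (reps (n' - n) ss)) a) b2"
    and agree: "\<forall>k<n'. agree (chunk (length ss) k a) b1 b2"
  have "drop (length (reps (n' - n) ss)) a \<in> tuples M (reps n ss)"
    using tuples_drop a unfolding r by blast
  moreover have "\<forall>k<n. agree (chunk (length ss) k (drop (length (reps (n' - n) ss)) a)) b1 b2"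
    using agree assms(2) unfolding l chunk_drop by simp
  ultimately show "same_germ b1 b2" using assms(1) b x unfolding determines_def by blast
qed

text \<open>By \<open>germ_determined\<close> and \<open>same_type_formula\<close>, each \<open>b\<close> satisfies a determining formula at a Morley
  sequence over \<open>A b\<close>, which is an \<open>A\<close>-definable property of \<open>b\<close>.  Compactness leaves finitely many, and
  padding makes the lengths equal.\<close>

lemma finite_determining_family:
  "\<exists>n S. finite S \<and> (\<forall>\<chi>\<in>S. determines n \<chi>) \<and>
    (\<forall>b\<in>B. \<exists>\<chi>\<in>S. \<forall>as. length as = n \<longrightarrow> morley (A \<union> set b) as \<longrightarrow> \<chi> (concat as) b)"
proof -
  define P where "P = (\<lambda>(n, \<chi>). generically_n n (\<lambda>e. \<chi> (take (length (reps n ss)) e) (drop (length (reps n ss)) e)))"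
  let ?F = "P ` {(n, \<chi>). determines n \<chi>}"
  have P_dfn: "dfn A us (P (n, \<chi>))" if "determines n \<chi>" for n \<chi>
    unfolding P_def split
    by (rule morley_generically_n(1)[OF _ order_refl A(1)]) (use that in \<open>simp add: determines_def dfn2_def\<close>)
  have P_morley: "\<chi> (concat as) b \<longleftrightarrow> P (n, \<chi>) b"
    if d: "determines n \<chi>" and b: "b \<in> B" and as: "morley (A \<union> set b) as" "length as = n" for n \<chi> b as
  proof -
    have "dfn A (reps n ss @ us) (\<lambda>e. \<chi> (take (length (reps n ss)) e) (drop (length (reps n ss)) e))"
      using d unfolding determines_def dfn2_def by blast
    from morley_generically_n(2)[OF this order_refl A(1) B_tuples[OF b] as]
    show ?thesis using tuples_length[OF morley_tuples[OF as(1)]] as(2) unfolding P_def by simp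
  qed
  have "\<exists>H\<subseteq>?F. finite H \<and> (\<forall>b\<in>tuples M us. b \<in> B \<longrightarrow> (\<exists>P\<in>H. P b))"
  proof (rule compact_cover[OF A])
    fix R assume "R \<in> ?F" then show "dfn A us R" using P_dfn by auto
  next
    show "dfn A us (\<lambda>b. b \<in> B)" by (rule dfn_mem[OF B_definable tm_id])
  next
    fix b assume "b \<in> tuples M us" and b: "b \<in> B"
    from germ_determined[OF b] obtain n where n: "\<And>as b'. length as = n \<Longrightarrow> morley (A \<union> set b) as \<Longrightarrow>
      same_type A (reps n ss @ us) (concat as @ b') (concat as @ b) \<Longrightarrow>
      (\<forall>a\<in>set as. agree a b b') \<Longrightarrow> same_germ b b'" by blast
    have "A \<union> set b \<subseteq> points M" "small \<kappa> (A \<union> set b)"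
      using small_points_Un[OF B_tuples[OF b] A] by auto
    from morley_exists[OF this] obtain as where as: "length as = n" "morley (A \<union> set b) as" by blast
    define Q where "Q a b1 b2 \<longleftrightarrow> ((\<forall>k<n. agree (chunk (length ss) k a) b1 b2) \<longrightarrow> same_germ b1 b2)" for a b1 b2
    have Qd: "dfn3 A (reps n ss) us us Q" unfolding dfn3_def Q_def
      by (intro dfn_imp dfn_all_less dfn3_sub[OF agree_dfn] dfn2_sub[OF same_germ_dfn] tm_chunk_comp[OF tm_take]
          tm_drop tm_take tm_drop_id)
    have cas: "concat as \<in> tuples M (reps n ss)" using morley_tuples[OF as(2)] as(1) by simp
    have "\<exists>\<chi>. dfn2 A (reps n ss) us \<chi> \<and> \<chi> (concat as) b \<and> (\<forall>a'\<in>tuples M (reps n ss).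
      \<forall>b1\<in>tuples M us. \<forall>b2\<in>tuples M us. \<chi> a' b1 \<longrightarrow> \<chi> a' b2 \<longrightarrow> Q a' b1 b2)"
    proof (rule same_type_formula[OF A Qd cas B_tuples[OF b]])
      fix b' assume e: "same_type A (reps n ss @ us) (concat as @ b') (concat as @ b)"
      show "Q (concat as) b b'" unfolding Q_def
      proof (intro impI n[OF as e] ballI)
        fix a assume "\<forall>k<n. agree (chunk (length ss) k (concat as)) b b'" "a \<in> set as"
        then show "agree a b b'" using morley_chunk[OF as(2)] as(1) by (metis in_set_conv_nth)
      qed
    qed
    then obtain \<chi> where "dfn2 A (reps n ss) us \<chi>" "\<chi> (concat as) b" "\<forall>a'\<in>tuples M (reps n ss).
      \<forall>b1\<in>tuples M us. \<forall>b2\<in>tuples M us. \<chi> a' b1 \<longrightarrow> \<chi> a' b2 \<longrightarrow> Q a' b1 b2" by blast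
    then have "determines n \<chi>" "\<chi> (concat as) b" unfolding determines_def Q_def by blast+
    with P_morley[OF _ b as(2,1)] show "\<exists>P\<in>?F. P b"
      by (intro bexI[of _ "P (n, \<chi>)"] imageI) auto
  qed
  then obtain H where H: "H \<subseteq> ?F" "finite H" "\<forall>b\<in>tuples M us. b \<in> B \<longrightarrow> (\<exists>P\<in>H. P b)"
    by (elim exE conjE)
  from finite_subset_image[OF H(2,1)] obtain S where S: "S \<subseteq> {(n, \<chi>). determines n \<chi>}" "finite S"
    "H = P ` S" by blast
  have "finite (fst ` S)" using S(2) by simp
  then obtain n' where n': "\<forall>n\<in>fst ` S. n \<le> n'" by (auto simp: finite_nat_set_iff_bounded_le)
  let ?pad = "\<lambda>(n, \<chi>) a b. \<chi> (drop (length (reps (n' - n) ss)) a) b"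
  show ?thesis
  proof (intro exI[of _ n'] exI[of _ "?pad ` S"] conjI ballI)
    show "finite (?pad ` S)" using S(2) by simp
    fix \<chi>' assume "\<chi>' \<in> ?pad ` S"
    then obtain n \<chi> where x: "(n, \<chi>) \<in> S" "\<chi>' = (\<lambda>a b. \<chi> (drop (length (reps (n' - n) ss)) a) b)" by auto
    show "determines n' \<chi>'" unfolding x(2)
      by (rule determines_pad) (use x(1) S(1) n' in force)+
  next
    fix b assume b: "b \<in> B"
    with H(3) B_tuples S(3) obtain d where d: "d \<in> S" "P d b" by blast
    obtain n \<chi> where d': "d = (n, \<chi>)" by (cases d)
    have det: "determines n \<chi>" and nn: "n \<le> n'" using d(1) S(1) n' unfolding d' by force+
    show "\<exists>\<chi>\<in>?pad ` S. \<forall>as. length as = n' \<longrightarrow> morley (A \<union> set b) as \<longrightarrow> \<chi> (concat as) b"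
    proof (rule bexI[of _ "?pad d"], intro allI impI)
      show "?pad d \<in> ?pad ` S" by (rule imageI[OF d(1)])
      fix as assume as: "length as = n'" "morley (A \<union> set b) as"
      let ?s = "drop (n' - n) as" and ?t = "take (n' - n) as"
      have m: "morley (A \<union> set b) ?s" using as(2) morley_suffix[of _ ?t ?s] by simp
      have t: "morley (A \<union> set b) ?t" using as(2) morley_delete[of _ ?t ?s "[]"] by simp
      have "length (concat ?t) = length (reps (n' - n) ss)"
        using tuples_length[OF morley_tuples[OF t]] as(1) by simp
      moreover have "concat as = concat ?t @ concat ?s" by (metis append_take_drop_id concat_append)
      ultimately have "drop (length (reps (n' - n) ss)) (concat as) = concat ?s" by simp
      moreover have "\<chi> (concat ?s) b"
        using P_morley[OF det b m] as(1) nn d(2) unfolding d' by simp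
      ultimately show "?pad d (concat as) b" unfolding d' by simp
    qed
  qed
qed

definition B_power :: "nat \<Rightarrow> 'm list set" where
  "B_power k = {bs \<in> tuples M (reps k us). \<forall>i<k. chunk (length us) i bs \<in> B}"

lemma B_power_dfn: "dfn A (reps k us) (\<lambda>bs. bs \<in> B_power k)"
proof -
  have "dfn A (reps k us) (\<lambda>bs. \<forall>i<k. chunk (length us) i bs \<in> B)"
    by (intro dfn_all_less dfn_mem[OF B_definable tm_chunk])
  then show ?thesis by (rule dfn_cong) (simp add: B_power_def)
qed

definition germ_invariant :: "nat \<Rightarrow> ('m list \<Rightarrow> 'm list \<Rightarrow> bool) \<Rightarrow> bool" where
  "germ_invariant k \<phi> \<longleftrightarrow> (\<forall>bs\<in>B_power k. \<forall>bs'\<in>B_power k. \<forall>z.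
     (\<forall>i<k. same_germ (chunk (length us) i bs) (chunk (length us) i bs')) \<longrightarrow> (\<phi> bs z \<longleftrightarrow> \<phi> bs' z))"

text \<open>The determining formulas split \<open>B_power k\<close> into finitely many parts.  In one part, a tree needs
  finitely many \<open>b\<close> only; evaluation on a Morley sequence \<open>a\<close> over all of them turns it into a tree on a
  product of sets of values.\<close>

lemma germ_trees_bounded:
  assumes \<phi>: "dfn2 A (reps k us) zs \<phi>" and inv: "germ_invariant k \<phi>"
  shows "\<exists>h. \<not> tree h (tuples M zs) \<phi> (B_power k)"
proof -
  let ?ls = "length ss" and ?lt = "length ts" and ?lu = "length us"
  obtain n S where S: "finite S" "\<And>\<chi>. \<chi> \<in> S \<Longrightarrow> determines n \<chi>"
    and cover: "\<And>b. b \<in> B \<Longrightarrow> \<exists>\<chi>\<in>S. \<forall>as. length as = n \<longrightarrow> morley (A \<union> set b) as \<longrightarrow> \<chi> (concat as) b"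
    using finite_determining_family by blast
  define U where "U \<chi> b \<longleftrightarrow> (\<forall>as. length as = n \<longrightarrow> morley (A \<union> set b) as \<longrightarrow> \<chi> (concat as) b)" for \<chi> b
  define V where "V xs = {bs \<in> B_power k. \<forall>i<k. U (xs ! i) (chunk ?lu i bs)}" for xs
  let ?I = "{xs. set xs \<subseteq> S \<and> length xs = k}"
  have "B_power k \<subseteq> (\<Union>xs\<in>?I. V xs)"
  proof
    fix bs assume bs: "bs \<in> B_power k"
    have "\<forall>i. \<exists>\<chi>. i < k \<longrightarrow> \<chi> \<in> S \<and> U \<chi> (chunk ?lu i bs)"
      using cover bs unfolding B_power_def U_def by blast
    from choice[OF this] obtain x where x: "\<forall>i<k. x i \<in> S \<and> U (x i) (chunk ?lu i bs)" by blast
    then have "map x [0..<k] \<in> ?I" "bs \<in> V (map x [0..<k])" using bs by (auto simp: V_def)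
    then show "bs \<in> (\<Union>xs\<in>?I. V xs)" by blast
  qed
  moreover have "\<exists>h. \<not> tree h (tuples M zs) \<phi> (\<Union>xs\<in>?I. V xs)"
  proof (rule tree_finite_Union)
    show "finite ?I" by (rule finite_lists_length_eq[OF S(1)])
    fix xs assume xs: "xs \<in> ?I"
    then have det: "determines n (xs ! i)" if "i < k" for i
      using xs that by (intro S(2)) (auto dest: nth_mem)
    then have xd: "dfn2 A (reps n ss) us (xs ! i)" if "i < k" for i
      using that unfolding determines_def by blast
    let ?K = "k * n"
    \<comment> \<open>\<open>\<phi>\<close> in terms of the values \<open>y\<close> on \<open>a\<close>; the index tuple \<open>bs\<close> is unique up to germs\<close>
    define \<psi> where "\<psi> y z a \<longleftrightarrow> (\<exists>bs\<in>tuples M (reps k us). (\<forall>i<k. chunk ?lu i bs \<in> B) \<and>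
      (\<forall>i<k. (xs ! i) a (chunk ?lu i bs)) \<and>
      (\<forall>i<k. \<forall>j<n. fgraph (chunk ?lu i bs) (chunk ?ls j a) (chunk ?lt (i * n + j) y)) \<and> \<phi> bs z)"
      for y z a
    have idx: "i * n + j < ?K" if "i < k" "j < n" for i j
    proof -
      have "i * n + j < Suc i * n" using that(2) by simp
      also have "\<dots> \<le> k * n" using that(1) by (intro mult_le_mono1) simp
      finally show ?thesis .
    qed
    have \<psi>d: "dfn3 A (reps ?K ts) zs (reps n ss) \<psi>"
    proof -
      let ?c = "reps k us @ reps ?K ts @ zs @ reps n ss"
      let ?e = "\<lambda>e. drop (length (reps k us)) e"
      let ?z = "\<lambda>e. take (length zs) (drop (length (reps ?K ts)) (?e e))"
      let ?a = "\<lambda>e. drop (length zs) (drop (length (reps ?K ts)) (?e e))"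
      have t: "tm A ?c (\<lambda>e. take (length (reps k us)) e) (reps k us)"
        "tm A ?c (\<lambda>e. take (length (reps ?K ts)) (?e e)) (reps ?K ts)"
        "tm A ?c ?z zs" "tm A ?c ?a (reps n ss)"
        by (rule tm_take, rule tm_drop[OF tm_take], rule tm_drop[OF tm_drop[OF tm_take]],
            rule tm_drop[OF tm_drop[OF tm_drop_id]])
      have "dfn A ?c (\<lambda>e. (\<forall>i<k. chunk ?lu i (take (length (reps k us)) e) \<in> B) \<and>
        (\<forall>i<k. (xs ! i) (?a e) (chunk ?lu i (take (length (reps k us)) e))) \<and>
        (\<forall>i<k. \<forall>j<n. fgraph (chunk ?lu i (take (length (reps k us)) e)) (chunk ?ls j (?a e))
          (chunk ?lt (i * n + j) (take (length (reps ?K ts)) (?e e)))) \<and>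
        \<phi> (take (length (reps k us)) e) (?z e))"
        by (intro dfn_conj dfn_all_less dfn_mem[OF B_definable] dfn2_sub[OF xd] dfn3_sub[OF fgraph_dfn]
            dfn2_sub[OF \<phi>] t tm_chunk_comp[OF t(1)] tm_chunk_comp[OF t(2)] tm_chunk_comp[OF t(4)] idx)
      then show ?thesis unfolding dfn3_def \<psi>_def by (rule dfn_ex)
    qed
    have "t mod n < n" if "t < ?K" for t using that by (cases n) auto
    from values_bound[OF \<psi>d, of "\<lambda>t. t mod n", OF this] obtain h where
      h: "\<And>R. morley A R \<Longrightarrow> length R = n \<Longrightarrow> \<not> tree h (tuples M zs) (\<lambda>y z. \<psi> y z (concat R))
        {y \<in> tuples M (reps ?K ts). \<forall>t<?K. chunk ?lt t y \<in> value_set (R ! (t mod n))}" by blast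
    have "\<not> tree h (tuples M zs) \<phi> (V xs)"
    proof
      assume "tree h (tuples M zs) \<phi> (V xs)"
      from tree_finite[OF this] obtain V0 where V0: "V0 \<subseteq> V xs" "finite V0"
        "tree h (tuples M zs) \<phi> V0" by blast
      have V0T: "bs \<in> tuples M (reps k us)" if "bs \<in> V0" for bs
        using that V0(1) unfolding V_def B_power_def by blast
      let ?C = "A \<union> (\<Union>bs\<in>V0. set bs)"
      have "?C \<subseteq> points M" using A(1) tuples_subset_points[OF V0T] by blast
      moreover have "small \<kappa> ?C"
        by (intro small_Un A(2) countable_small countable_finite finite_UN_I V0(2)) simp
      ultimately obtain as where as: "length as = n" "morley ?C as" using morley_exists by blast
      have mA: "morley A as" by (rule morley_mono[OF as(2)]) simp
      have gA: "generic A (as ! j)" if "j < n" for j using morley_nth[OF mA] that as(1) by simp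
      have aT: "concat as \<in> tuples M (reps n ss)" using morley_tuples[OF mA] as(1) by simp
      have ach: "chunk ?ls j (concat as) = as ! j" if "j < n" for j
        by (rule morley_chunk[OF mA]) (use that as(1) in simp)
      define v where "v bs t = val (chunk ?lu (t div n) bs) (as ! (t mod n))" for bs t
      define g where "g bs = concat (map (v bs) [0..<?K])" for bs
      have B: "chunk ?lu i bs \<in> B" if "bs \<in> V0" "i < k" for bs i
        using that V0(1) unfolding V_def B_power_def by blast
      have \<chi>: "(xs ! i) (concat as) (chunk ?lu i bs)" if bs: "bs \<in> V0" and i: "i < k" for bs i
      proof -
        have "U (xs ! i) (chunk ?lu i bs)" using bs i V0(1) unfolding V_def by blast
        moreover have "set (chunk ?lu i bs) \<subseteq> set bs"
          unfolding chunk_def by (metis set_drop_subset set_take_subset order_trans)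
        then have "morley (A \<union> set (chunk ?lu i bs)) as" using bs by (intro morley_mono[OF as(2)]) blast
        ultimately show ?thesis using as(1) unfolding U_def by blast
      qed
      have tn: "t div n < k" "t mod n < n" if "t < ?K" for t
        using that by (rule less_mult_imp_div_less) (use that in \<open>cases n; auto\<close>)
      have F: "fgraph (chunk ?lu (t div n) bs) (as ! (t mod n)) (v bs t)" if "bs \<in> V0" "t < ?K" for bs t
        unfolding v_def by (rule fgraph_val[OF B[OF that(1) tn(1)[OF that(2)]] gA[OF tn(2)[OF that(2)]]])
      have vT: "v bs t \<in> tuples M ts" if "bs \<in> V0" "t < ?K" for bs t
        using fgraph_tuples[OF F[OF that]] by blast
      have gT: "g bs \<in> tuples M (reps ?K ts)" if "bs \<in> V0" for bs
        unfolding g_def by (rule tuples_concat_replicate[OF vT[OF that]])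
      have gch: "chunk ?lt t (g bs) = v bs t" if "bs \<in> V0" "t < ?K" for bs t
        unfolding g_def by (rule chunk_concat[OF _ that(2)]) (rule tuples_length[OF vT[OF that(1)]])
      have F': "fgraph (chunk ?lu i bs) (as ! j) (chunk ?lt (i * n + j) (g bs))"
        if "bs \<in> V0" "i < k" "j < n" for bs i j
        using F[OF that(1) idx[OF that(2,3)]] gch[OF that(1) idx[OF that(2,3)]] that(3) by simp
      have "tree h (tuples M zs) (\<lambda>y z. \<psi> y z (concat as))
        {y \<in> tuples M (reps ?K ts). \<forall>t<?K. chunk ?lt t y \<in> value_set (as ! (t mod n))}"
      proof (rule tree_transport[OF V0(3), of g _ "\<lambda>z. z"])
        fix bs assume bs: "bs \<in> V0"
        have "v bs t \<in> value_set (as ! (t mod n))" if "t < ?K" for t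
          using F[OF bs that] fgraph_tuples[OF F[OF bs that]] unfolding value_set_def by blast
        then show "g bs \<in> {y \<in> tuples M (reps ?K ts). \<forall>t<?K. chunk ?lt t y \<in> value_set (as ! (t mod n))}"
          using gT[OF bs] gch[OF bs] by simp
        fix z
        show "\<psi> (g bs) z (concat as) \<longleftrightarrow> \<phi> bs z"
        proof
          assume "\<phi> bs z"
          then show "\<psi> (g bs) z (concat as)" unfolding \<psi>_def
            using V0T[OF bs] B[OF bs] \<chi>[OF bs] F'[OF bs] ach by (intro bexI[of _ bs]) simp_all
        next
          assume "\<psi> (g bs) z (concat as)"
          then obtain bs' where bs': "bs' \<in> tuples M (reps k us)" "\<forall>i<k. chunk ?lu i bs' \<in> B"
            "\<forall>i<k. (xs ! i) (concat as) (chunk ?lu i bs')"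
            "\<forall>i<k. \<forall>j<n. fgraph (chunk ?lu i bs') (chunk ?ls j (concat as)) (chunk ?lt (i * n + j) (g bs))"
            "\<phi> bs' z" unfolding \<psi>_def by blast
          have "same_germ (chunk ?lu i bs) (chunk ?lu i bs')" if i: "i < k" for i
          proof -
            have "\<forall>j<n. agree (chunk ?ls j (concat as)) (chunk ?lu i bs) (chunk ?lu i bs')"
            proof (intro allI impI)
              fix j assume j: "j < n"
              show "agree (chunk ?ls j (concat as)) (chunk ?lu i bs) (chunk ?lu i bs')"
                using agreeI[OF F'[OF bs i j]] bs'(4) i j ach by simp
            qed
            then show ?thesis
              using det[OF i] aT B_tuples[OF B[OF bs i]] B_tuples[of "chunk ?lu i bs'"] bs'(2,3) \<chi>[OF bs i] i
              unfolding determines_def by blast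
          qed
          moreover have "bs \<in> B_power k" "bs' \<in> B_power k" using V0T[OF bs] B[OF bs] bs'(1,2) by (auto simp: B_power_def)
          ultimately show "\<phi> bs z" using inv bs'(5) unfolding germ_invariant_def by blast
        qed
      qed
      with h[OF mA as(1)] show False by blast
    qed
    then show "\<exists>h. \<not> tree h (tuples M zs) \<phi> (V xs)" ..
  qed
  ultimately show ?thesis using tree_mono by blast
qed

end

section \<open>Stability and stable embeddedness of the set of germs\<close>

context stable_valued_family begin

definition germ_of :: "'m list \<Rightarrow> 'm list set" where
  "germ_of b = germ M ss p B f b"

definition germs :: "'m list set set" where
  "germs = germ_of ` B"

abbreviation germs_of :: "nat \<Rightarrow> 'm list \<Rightarrow> 'm list set list" where
  "germs_of k bs \<equiv> map (\<lambda>i. germ_of (chunk (length us) i bs)) [0..<k]"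

lemma germ_of_eq_iff: "b \<in> B \<Longrightarrow> b' \<in> B \<Longrightarrow> germ_of b = germ_of b' \<longleftrightarrow> same_germ b b'"
  using eq_equiv_class_iff[OF same_germ_equiv, of b b'] unfolding germ_of_def germ_def same_germ_germ_rel by simp

lemma mem_germ_of: "b' \<in> germ_of b \<longleftrightarrow> same_germ b b'"
  unfolding germ_of_def germ_def same_germ_germ_rel by simp

lemma germ_of_self: "b \<in> B \<Longrightarrow> b \<in> germ_of b"
  unfolding mem_germ_of using germ_of_eq_iff by blast

lemma germs_mem:
  assumes "x \<in> germs" "b \<in> x"
  shows "b \<in> B \<and> x = germ_of b"
proof -
  from assms(1) obtain b' where b': "b' \<in> B" "x = germ_of b'" unfolding germs_def by blast
  with assms(2) have "same_germ b' b" by (simp add: mem_germ_of)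
  then show ?thesis using b' germ_of_eq_iff[OF b'(1), of b] unfolding same_germ_def by blast
qed

lemma germs_imaginary: "imaginary_set L M A germs"
proof -
  have "germs = B // germ_rel M ss p B f" unfolding germs_def germ_of_def[abs_def] germ_def quotient_def by blast
  moreover have "definable2 L M A us (germ_rel M ss p B f)" unfolding definable2_def
  proof (intro conjI)
    show "germ_rel M ss p B f \<subseteq> tuples M us \<times> tuples M us"
      unfolding same_germ_germ_rel same_germ_def using B_tuples by blast
    have "definable L M A (us @ us) {e \<in> tuples M (us @ us).
        same_germ (take (length us) e) (drop (length us) e)}"
      by (rule dfn_imp_definable[OF same_germ_dfn[unfolded dfn2_def]])
    moreover have "{x @ y | x y. (x, y) \<in> germ_rel M ss p B f} =
      {e \<in> tuples M (us @ us). same_germ (take (length us) e) (drop (length us) e)}"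
    proof (intro set_eqI iffI)
      fix e assume "e \<in> {x @ y | x y. (x, y) \<in> germ_rel M ss p B f}"
      then obtain x y where e: "e = x @ y" "same_germ x y" unfolding same_germ_germ_rel by blast
      then have "x \<in> tuples M us" "y \<in> tuples M us" using B_tuples unfolding same_germ_def by auto
      with e show "e \<in> {e \<in> tuples M (us @ us). same_germ (take (length us) e) (drop (length us) e)}"
        using tuples_length[of x M us] by (simp add: tuples_append)
    next
      fix e assume "e \<in> {e \<in> tuples M (us @ us). same_germ (take (length us) e) (drop (length us) e)}"
      then have "same_germ (take (length us) e) (drop (length us) e)" by blast
      then show "e \<in> {x @ y | x y. (x, y) \<in> germ_rel M ss p B f}" unfolding same_germ_germ_rel
        by (intro CollectI exI[of _ "take (length us) e"] exI[of _ "drop (length us) e"]) simp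
    qed
    ultimately show "definable L M A (us @ us) {x @ y | x y. (x, y) \<in> germ_rel M ss p B f}" by simp
  qed
  ultimately show ?thesis unfolding imaginary_set_def using B_definable same_germ_equiv by blast
qed

lemma B_power_tuples: "bs \<in> B_power k \<Longrightarrow> bs \<in> tuples M (reps k us)"
  by (simp add: B_power_def)

lemma B_power_chunk: "bs \<in> B_power k \<Longrightarrow> i < k \<Longrightarrow> chunk (length us) i bs \<in> B"
  by (simp add: B_power_def)

lemma germs_of_power_set: "bs \<in> B_power k \<Longrightarrow> germs_of k bs \<in> power_set germs k"
  using B_power_chunk unfolding power_set_def germs_def by auto

lemma germs_of_eq_iff:
  assumes "bs \<in> B_power k" "bs' \<in> B_power k"
  shows "germs_of k bs = germs_of k bs' \<longleftrightarrow> (\<forall>i<k. same_germ (chunk (length us) i bs) (chunk (length us) i bs'))"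
  using germ_of_eq_iff[OF B_power_chunk[OF assms(1)] B_power_chunk[OF assms(2)]] by (auto simp: list_eq_iff_nth_eq)

lemma representatives:
  assumes "ks \<in> power_set germs k"
  shows "\<exists>bs\<in>B_power k. germs_of k bs = ks"
proof -
  have "\<forall>i. \<exists>b. i < k \<longrightarrow> b \<in> B \<and> germ_of b = ks ! i"
    using assms unfolding power_set_def germs_def by (auto dest!: subsetD[OF _ nth_mem])
  from choice[OF this] obtain b where b: "\<forall>i<k. b i \<in> B \<and> germ_of (b i) = ks ! i" ..
  have ch: "chunk (length us) i (concat (map b [0..<k])) = b i" if "i < k" for i
    by (rule chunk_concat[OF _ that]) (use b B_tuples tuples_length in blast)
  have "concat (map b [0..<k]) \<in> B_power k" unfolding B_power_def
    using tuples_concat_replicate[of k b us] b B_tuples ch by simp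
  moreover have "germs_of k (concat (map b [0..<k])) = ks"
    by (rule nth_equalityI) (use assms b ch in \<open>auto simp: power_set_def\<close>)
  ultimately show ?thesis by blast
qed

text \<open>Representatives of a germ are the indices in its class, and \<open>B_power k\<close> collects those of \<open>k\<close>-tuples of
  germs.\<close>

lemma preimage_eq:
  assumes "R \<subseteq> power_set germs k"
  shows "{concat xs | xs ks. ks \<in> R \<and> list_all2 (\<in>) xs ks} = {bs \<in> B_power k. germs_of k bs \<in> R}"
proof (intro set_eqI iffI)
  fix e assume "e \<in> {concat xs | xs ks. ks \<in> R \<and> list_all2 (\<in>) xs ks}"
  then obtain xs ks where e: "e = concat xs" "ks \<in> R" "list_all2 (\<in>) xs ks" by blast
  then have l: "length ks = k" "length xs = k" "set ks \<subseteq> germs"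
    using assms by (auto simp: power_set_def dest: list_all2_lengthD)
  have x: "xs ! i \<in> B \<and> ks ! i = germ_of (xs ! i)" if "i < k" for i
  proof (rule germs_mem)
    show "ks ! i \<in> germs" using l that by (auto dest!: subsetD[OF _ nth_mem])
    show "xs ! i \<in> ks ! i" using e(3) l that by (simp add: list_all2_conv_all_nth)
  qed
  have ch: "chunk (length us) i e = xs ! i" if "i < k" for i unfolding e(1)
  proof (rule chunk_nth)
    fix a assume "a \<in> set xs"
    then show "length a = length us" using x B_tuples tuples_length l(2) by (metis in_set_conv_nth)
  qed (use that l in simp)
  have "e = concat (map ((!) xs) [0..<k])" unfolding e(1) l(2)[symmetric] map_nth ..
  then have "e \<in> tuples M (reps k us)"
    using tuples_concat_replicate[of k "(!) xs" us] x B_tuples by simp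
  then have "e \<in> B_power k" using ch x by (simp add: B_power_def)
  moreover have "germs_of k e = ks" by (rule nth_equalityI) (use l ch x in auto)
  ultimately show "e \<in> {bs \<in> B_power k. germs_of k bs \<in> R}" using e(2) by simp
next
  fix e assume "e \<in> {bs \<in> B_power k. germs_of k bs \<in> R}"
  then have e: "e \<in> B_power k" "germs_of k e \<in> R" by auto
  have "list_all2 (\<in>) (map (\<lambda>i. chunk (length us) i e) [0..<k]) (germs_of k e)"
    using B_power_chunk[OF e(1)] germ_of_self by (auto simp: list_all2_conv_all_nth)
  moreover have "concat (map (\<lambda>i. chunk (length us) i e) [0..<k]) = e"
    by (rule tuples_concat_chunk[OF B_power_tuples[OF e(1)]])
  ultimately show "e \<in> {concat xs | xs ks. ks \<in> R \<and> list_all2 (\<in>) xs ks}" using e(2)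
    by (intro CollectI exI[of _ "map (\<lambda>i. chunk (length us) i e) [0..<k]"] exI[of _ "germs_of k e"]) simp
qed

lemma definable_relation_iff:
  assumes "R \<subseteq> power_set germs k"
  shows "definable_relation L M C R \<longleftrightarrow> dfn C (reps k us) (\<lambda>bs. bs \<in> B_power k \<and> germs_of k bs \<in> R)"
proof
  assume "definable_relation L M C R"
  then obtain vs where "definable L M C vs {bs \<in> B_power k. germs_of k bs \<in> R}"
    unfolding definable_relation_def preimage_eq[OF assms] by blast
  from dfn_mem_any[OF this] show "dfn C (reps k us) (\<lambda>bs. bs \<in> B_power k \<and> germs_of k bs \<in> R)" by simp
next
  assume d: "dfn C (reps k us) (\<lambda>bs. bs \<in> B_power k \<and> germs_of k bs \<in> R)"
  have "{bs \<in> tuples M (reps k us). bs \<in> B_power k \<and> germs_of k bs \<in> R} = {bs \<in> B_power k. germs_of k bs \<in> R}"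
    using B_power_tuples by blast
  with dfn_imp_definable[OF d] show "definable_relation L M C R"
    unfolding definable_relation_def preimage_eq[OF assms] by (intro exI[of _ "reps k us"]) simp
qed

text \<open>A quantifier over germs becomes one over their representatives in \<open>B\<close>, and the relation symbols name
  \<open>A\<close>-definable relations.\<close>

lemma induced_formula_dfn:
  assumes "wff (induced_language L M A germs) (replicate k ()) \<phi>"
  shows "dfn A (reps k us) (\<lambda>bs. bs \<in> B_power k \<and> sat (induced_structure germs) (germs_of k bs) \<phi>)"
  using assms
proof (induction \<phi> arbitrary: k)
  case Falsum
  show ?case using dfn_const[of A "reps k us" False] by simp
next
  case (Equal t u)
  let ?IL = "induced_language L M A germs"
  have var: "\<exists>i<k. t = Var i" if "term_sort ?IL (replicate k ()) t s" for t s
    using that by cases (auto simp: induced_language_def)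
  from Equal obtain i j where ij: "t = Var i" "i < k" "u = Var j" "j < k"
    using var[of t "()"] var[of u "()"] by auto
  have "dfn A (reps k us) (\<lambda>bs. bs \<in> B_power k \<and> same_germ (chunk (length us) i bs) (chunk (length us) j bs))"
    by (intro dfn_conj B_power_dfn dfn2_sub[OF same_germ_dfn] tm_chunk ij)
  then show ?case
    by (rule dfn_cong)
      (use ij germ_of_eq_iff[OF B_power_chunk[of _ k i] B_power_chunk[of _ k j]] in auto)
next
  case (Rel r ts')
  obtain m R where r: "r = (m, R)" by (cases r)
  let ?IL = "induced_language L M A germs"
  have R: "R \<subseteq> power_set germs m" "definable_relation L M A R"
    and ts': "list_all2 (term_sort ?IL (replicate k ())) ts' (replicate m ())"
    using Rel by (auto simp: r induced_language_def)
  have "\<exists>i<k. t = Var i" if "t \<in> set ts'" for t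
  proof -
    from ts' that have "term_sort ?IL (replicate k ()) t ()" unfolding list_all2_replicate by blast
    then show ?thesis by cases (auto simp: induced_language_def)
  qed
  moreover have l: "length ts' = m" using ts' unfolding list_all2_replicate by blast
  ultimately have "\<forall>j. \<exists>i. j < m \<longrightarrow> i < k \<and> ts' ! j = Var i" by (metis nth_mem)
  from choice[OF this] obtain i where i: "\<forall>j<m. i j < k \<and> ts' ! j = Var (i j)" ..
  define t where "t bs = concat (map (\<lambda>j. chunk (length us) (i j) bs) [0..<m])" for bs :: "'m list"
  have "tm A (reps k us) t (concat (map (\<lambda>_. us) [0..<m]))" unfolding t_def
    by (rule tm_concat, rule tm_chunk) (use i in blast)
  then have tt: "tm A (reps k us) t (reps m us)" by (simp only: concat_map_const)
  have "dfn A (reps k us) (\<lambda>bs. bs \<in> B_power k \<and> (t bs \<in> B_power m \<and> germs_of m (t bs) \<in> R))"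
    by (rule dfn_conj[OF B_power_dfn dfn_tm[OF definable_relation_iff[OF R(1), THEN iffD1, OF R(2)] tt]])
  then show ?case
  proof (rule dfn_cong)
    fix bs assume bsT: "bs \<in> tuples M (reps k us)"
    show "(bs \<in> B_power k \<and> (t bs \<in> B_power m \<and> germs_of m (t bs) \<in> R)) \<longleftrightarrow>
      (bs \<in> B_power k \<and> sat (induced_structure germs) (germs_of k bs) (Rel r ts'))"
    proof (cases "bs \<in> B_power k")
      case True
      have ch: "chunk (length us) j (t bs) = chunk (length us) (i j) bs" if "j < m" for j
        unfolding t_def by (rule chunk_concat[OF _ that])
          (use i True B_power_chunk B_tuples tuples_length in blast)
      have "t bs \<in> B_power m" using tm_range[OF tt bsT] ch i B_power_chunk[OF True] by (simp add: B_power_def)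
      moreover have "map (eval_term (induced_structure germs) (germs_of k bs)) ts' = germs_of m (t bs)"
        by (rule nth_equalityI) (use l i ch in auto)
      ultimately show ?thesis using True by (simp add: r induced_structure_def)
    qed simp
  qed
next
  case (Neg \<phi>)
  then have "wff (induced_language L M A germs) (replicate k ()) \<phi>" by simp
  from dfn_conj[OF B_power_dfn dfn_neg[OF Neg.IH[OF this]]] show ?case by (rule dfn_cong) auto
next
  case (Conj \<phi> \<psi>)
  then have "wff (induced_language L M A germs) (replicate k ()) \<phi>"
    "wff (induced_language L M A germs) (replicate k ()) \<psi>" by simp_all
  from dfn_conj[OF Conj.IH(1)[OF this(1)] Conj.IH(2)[OF this(2)]] show ?case by (rule dfn_cong) auto
next
  case (Exists s \<phi>)
  have "wff (induced_language L M A germs) (replicate (Suc k) ()) \<phi>" using Exists.prems by simp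
  from Exists.IH[OF this] have IH: "dfn A (us @ reps k us) (\<lambda>e. e \<in> B_power (Suc k) \<and>
    sat (induced_structure germs) (germs_of (Suc k) e) \<phi>)" by simp
  have "dfn A (reps k us) (\<lambda>bs. bs \<in> B_power k \<and> (\<exists>b\<in>tuples M us. b @ bs \<in> B_power (Suc k) \<and>
    sat (induced_structure germs) (germs_of (Suc k) (b @ bs)) \<phi>))"
    by (rule dfn_conj[OF B_power_dfn dfn_ex]) (simp only: append_take_drop_id IH)
  then show ?case
  proof (rule dfn_cong)
    fix bs assume bsT: "bs \<in> tuples M (reps k us)"
    have app: "chunk (length us) 0 (b @ bs) = b"
      "chunk (length us) (Suc i) (b @ bs) = chunk (length us) i bs" if "b \<in> tuples M us" for b i
      using tuples_length[OF that] by (simp_all add: chunk_def)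
    have c: "germs_of (Suc k) (b @ bs) = germ_of b # germs_of k bs" if "b \<in> tuples M us" for b
      by (rule nth_equalityI) (use app[OF that] in \<open>auto simp: nth_Cons simp del: upt_Suc split: nat.splits\<close>)
    have m: "b @ bs \<in> B_power (Suc k) \<longleftrightarrow> b \<in> B \<and> bs \<in> B_power k" if "b \<in> tuples M us" for b
      using app[OF that] tuples_append[OF that bsT] bsT by (auto simp: B_power_def less_Suc_eq_0_disj)
    show "(bs \<in> B_power k \<and> (\<exists>b\<in>tuples M us. b @ bs \<in> B_power (Suc k) \<and>
      sat (induced_structure germs) (germs_of (Suc k) (b @ bs)) \<phi>)) \<longleftrightarrow>
      (bs \<in> B_power k \<and> sat (induced_structure germs) (germs_of k bs) (Exists s \<phi>))"
      using c m B_tuples by (auto simp: induced_structure_def germs_def)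
  qed
qed

lemma chunk_append:
  assumes "bs \<in> tuples M (reps k us)"
  shows "i < k \<Longrightarrow> chunk (length us) i (bs @ cs) = chunk (length us) i bs"
    and "chunk (length us) (k + i) (bs @ cs) = chunk (length us) i cs"
proof -
  have lb: "length bs = k * length us"
    using tuples_length[OF assms] by (simp add: length_concat sum_list_replicate)
  show "chunk (length us) i (bs @ cs) = chunk (length us) i bs" if "i < k"
  proof -
    have "Suc i * length us \<le> k * length us" using that by (intro mult_le_mono1) simp
    then show ?thesis using lb by (simp add: chunk_def)
  qed
  show "chunk (length us) (k + i) (bs @ cs) = chunk (length us) i cs"
    using lb by (simp add: chunk_def add_mult_distrib)
qed

lemma germs_of_append:
  assumes "bs \<in> tuples M (reps k us)" "cs \<in> tuples M (reps l us)"
  shows "germs_of (k + l) (bs @ cs) = germs_of k bs @ germs_of l cs"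
proof (rule nth_equalityI)
  fix i assume "i < length (germs_of (k + l) (bs @ cs))"
  then have i: "i < k + l" by simp
  show "germs_of (k + l) (bs @ cs) ! i = (germs_of k bs @ germs_of l cs) ! i"
  proof (cases "i < k")
    case True
    then show ?thesis using chunk_append(1)[OF assms(1) True] by (simp add: nth_append)
  next
    case False
    then obtain j where j: "i = k + j" by (metis le_add_diff_inverse not_less)
    show ?thesis using i chunk_append(2)[OF assms(1)] by (simp add: j nth_append)
  qed
qed simp

lemma B_power_append:
  assumes "bs \<in> tuples M (reps k us)" "cs \<in> tuples M (reps l us)"
  shows "bs @ cs \<in> B_power (k + l) \<longleftrightarrow> bs \<in> B_power k \<and> cs \<in> B_power l"
proof -
  have "(\<forall>i<k + l. Q i) \<longleftrightarrow> (\<forall>i<k. Q i) \<and> (\<forall>i<l. Q (k + i))" for Q :: "nat \<Rightarrow> bool"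
    by (metis add_less_cancel_left le_add_diff_inverse not_less trans_less_add1)
  from this[of "\<lambda>i. chunk (length us) i (bs @ cs) \<in> B"] show ?thesis
    using chunk_append[OF assms(1)] tuples_append[OF assms] assms concat_replicate_add[of k l us]
    by (simp add: B_power_def)
qed

text \<open>Choosing representatives turns a half graph of the induced structure into one of a germ-invariant
  relation on indices.\<close>

lemma germs_stable: "stable_set L M A germs"
  unfolding stable_set_def stable_structure_def
proof (intro allI impI)
  fix ss1 ts1 :: "unit list" and \<phi>
  let ?IL = "induced_language L M A germs" and ?IM = "induced_structure germs"
  assume w: "wff ?IL (ss1 @ ts1) \<phi>"
  define k l where "k = length ss1" and "l = length ts1"
  have un: "xs = replicate (length xs) ()" for xs :: "unit list" by (induction xs) auto
  have w': "wff ?IL (replicate (k + l) ()) \<phi>" using w un[of "ss1 @ ts1"] by (simp add: k_def l_def)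
  define P where "P bs cs \<longleftrightarrow> cs \<in> B_power l \<and> bs \<in> B_power k \<and> sat ?IM (germs_of k bs @ germs_of l cs) \<phi>" for bs cs
  have "dfn A (reps k us @ reps l us) (\<lambda>e. e \<in> B_power (k + l) \<and> sat ?IM (germs_of (k + l) e) \<phi>)"
    using induced_formula_dfn[OF w'] by (simp add: concat_replicate_add)
  then have "dfn2 A (reps k us) (reps l us) P" unfolding dfn2_def
  proof (rule dfn_cong)
    fix e assume e: "e \<in> tuples M (reps k us @ reps l us)"
    show "(e \<in> B_power (k + l) \<and> sat ?IM (germs_of (k + l) e) \<phi>) \<longleftrightarrow>
      P (take (length (reps k us)) e) (drop (length (reps k us)) e)"
      using B_power_append[OF tuples_take[OF e] tuples_drop[OF e]]
        germs_of_append[OF tuples_take[OF e] tuples_drop[OF e]] unfolding P_def by auto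
  qed
  moreover have "germ_invariant k P" unfolding germ_invariant_def
  proof (intro ballI allI impI)
    fix bs bs' z assume "bs \<in> B_power k" "bs' \<in> B_power k"
      "\<forall>i<k. same_germ (chunk (length us) i bs) (chunk (length us) i bs')"
    with germs_of_eq_iff show "P bs z \<longleftrightarrow> P bs' z" unfolding P_def by metis
  qed
  ultimately obtain h where h: "\<not> tree h (tuples M (reps l us)) P (B_power k)"
    using germ_trees_bounded by blast
  show "\<exists>n::nat. \<not> (\<exists>a b. (\<forall>i<n. a i \<in> tuples ?IM ss1 \<and> b i \<in> tuples ?IM ts1) \<and>
    (\<forall>i<n. \<forall>j<n. sat ?IM (a i @ b j) \<phi> \<longleftrightarrow> i < j))"
  proof (rule exI[of _ "2 ^ h"], clarify)
    fix a b :: "nat \<Rightarrow> 'm list set list"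
    assume ab: "\<forall>i<2 ^ h. a i \<in> tuples ?IM ss1 \<and> b i \<in> tuples ?IM ts1"
      and lad: "\<forall>i<2 ^ h. \<forall>j<2 ^ h. sat ?IM (a i @ b j) \<phi> \<longleftrightarrow> i < j"
    have pow: "x \<in> power_set germs (length vs)" if "x \<in> tuples ?IM vs" for x and vs :: "unit list"
    proof -
      have "list_all2 (\<lambda>x _. x \<in> germs) x (replicate (length vs) ())"
        using that un[of vs] unfolding tuples_def induced_structure_def by simp
      then show ?thesis unfolding list_all2_replicate power_set_def by blast
    qed
    have "\<forall>i. \<exists>bs. i < 2 ^ h \<longrightarrow> bs \<in> B_power k \<and> germs_of k bs = a i"
      using representatives[OF pow] ab unfolding k_def by blast
    from choice[OF this] obtain bs where bs: "\<forall>i<2 ^ h. bs i \<in> B_power k \<and> germs_of k (bs i) = a i" ..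
    have "\<forall>i. \<exists>cs. i < 2 ^ h \<longrightarrow> cs \<in> B_power l \<and> germs_of l cs = b i"
      using representatives[OF pow] ab unfolding l_def by blast
    from choice[OF this] obtain cs where cs: "\<forall>i<2 ^ h. cs i \<in> B_power l \<and> germs_of l (cs i) = b i" ..
    have "tree h (tuples M (reps l us)) P (B_power k)"
      by (rule ladder_imp_tree[of h bs _ cs]) (use bs cs lad B_power_tuples in \<open>auto simp: P_def\<close>)
    with h show False by blast
  qed
qed

text \<open>A relation on germs defined with a parameter \<open>z\<close> is the trace of \<open>z\<close> on the index tuples.  The dual of
  its relation \<open>\<phi>\<close> has bounded trees too, so the trace is definable from finitely many index tuples, and
  from these only their germs matter.\<close>

lemma germs_stably_embedded: "stably_embedded L M A germs"
  unfolding stably_embedded_def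
proof (intro allI impI, elim conjE)
  fix n R assume R: "R \<subseteq> power_set germs n" and "definable_relation L M (points M) R"
  then have "dfn (points M) (reps n us) (\<lambda>bs. bs \<in> B_power n \<and> germs_of n bs \<in> R)"
    using definable_relation_iff by blast
  from dfn_finite_params[OF this] obtain Q zs z where Q: "z \<in> tuples M zs"
    "dfn {} (reps n us @ zs) Q"
    "\<forall>bs\<in>tuples M (reps n us). (bs \<in> B_power n \<and> germs_of n bs \<in> R) \<longleftrightarrow> Q (bs @ z)" by blast
  let ?lu = "length us" and ?ln = "length (reps n us)"
  \<comment> \<open>closing \<open>Q\<close> under equality of germs makes it invariant also for parameters other than \<open>z\<close>\<close>
  define \<phi> where "\<phi> bs z \<longleftrightarrow> (\<exists>bs'\<in>tuples M (reps n us). bs' \<in> B_power n \<and>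
    (\<forall>i<n. same_germ (chunk ?lu i bs) (chunk ?lu i bs')) \<and> Q (bs' @ z))" for bs z
  have \<phi>d: "dfn2 A (reps n us) zs \<phi>"
  proof -
    let ?c = "reps n us @ reps n us @ zs"
    have t: "tm A ?c (take ?ln) (reps n us)" "tm A ?c (\<lambda>e. take ?ln (drop ?ln e)) (reps n us)"
      "tm A ?c (\<lambda>e. drop ?ln (drop ?ln e)) zs"
      by (rule tm_take, rule tm_drop[OF tm_take], rule tm_drop[OF tm_drop_id])
    have "dfn A ?c (\<lambda>e. take ?ln e \<in> B_power n \<and>
      (\<forall>i<n. same_germ (chunk ?lu i (take ?ln (drop ?ln e))) (chunk ?lu i (take ?ln e))) \<and>
      Q (take ?ln e @ drop ?ln (drop ?ln e)))"
      by (intro dfn_conj dfn_tm[OF B_power_dfn t(1)] dfn_all_less dfn2_sub[OF same_germ_dfn]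
          tm_chunk_comp[OF t(1)] tm_chunk_comp[OF t(2)] dfn_tm[OF dfn_mono[OF Q(2)]] tm_append t) simp_all
    then show ?thesis unfolding dfn2_def \<phi>_def by (rule dfn_ex)
  qed
  have ref: "same_germ b b" if "b \<in> B" for b using germ_of_eq_iff[OF that that] by simp
  have \<phi>_R: "\<phi> bs z \<longleftrightarrow> germs_of n bs \<in> R" if bs: "bs \<in> B_power n" for bs
  proof
    assume "\<phi> bs z"
    then obtain bs' where bs': "bs' \<in> B_power n" "\<forall>i<n. same_germ (chunk ?lu i bs) (chunk ?lu i bs')" "Q (bs' @ z)"
      unfolding \<phi>_def by blast
    with Q(3) B_power_tuples have "germs_of n bs' \<in> R" by blast
    moreover have "germs_of n bs = germs_of n bs'" unfolding germs_of_eq_iff[OF bs bs'(1)] by (rule bs'(2))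
    ultimately show "germs_of n bs \<in> R" by (simp only:)
  next
    assume "germs_of n bs \<in> R"
    with Q(3) bs B_power_tuples have "Q (bs @ z)" by blast
    with bs B_power_tuples B_power_chunk ref show "\<phi> bs z" unfolding \<phi>_def by blast
  qed
  have inv': "\<phi> bs z' \<longleftrightarrow> \<phi> bs' z'" if "bs \<in> B_power n" "bs' \<in> B_power n" "germs_of n bs = germs_of n bs'" for bs bs' z'
  proof -
    have "(\<forall>i<n. same_germ (chunk ?lu i bs) (chunk ?lu i x)) \<longleftrightarrow> (\<forall>i<n. same_germ (chunk ?lu i bs') (chunk ?lu i x))"
      if "x \<in> B_power n" for x
      using germs_of_eq_iff[OF \<open>bs \<in> B_power n\<close> that] germs_of_eq_iff[OF \<open>bs' \<in> B_power n\<close> that] \<open>germs_of n bs = germs_of n bs'\<close> by simp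
    then show ?thesis unfolding \<phi>_def by blast
  qed
  have "germ_invariant n \<phi>" unfolding germ_invariant_def using inv' germs_of_eq_iff by blast
  from germ_trees_bounded[OF \<phi>d this] obtain h0 where "\<not> tree h0 (tuples M zs) \<phi> (B_power n)" ..
  from tree_dual[OF this] obtain h where "\<not> tree h (B_power n) (\<lambda>z bs. \<phi> bs z) (tuples M zs)" ..
  from trace_definable[OF this Q(1) order_refl] obtain qs k where qs: "fst ` set qs \<subseteq> B_power n"
    "\<forall>bs\<in>B_power n. \<phi> bs z \<longleftrightarrow> tree k (B_power n) (\<lambda>z bs. \<phi> bs z)
      {z' \<in> tuples M zs. (\<forall>(q, s)\<in>set qs. \<phi> q z' \<longleftrightarrow> s) \<and> \<phi> bs z'}" by blast
  define r where "r = length qs"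
  define W where "W bs e = {z' \<in> tuples M zs. (\<forall>t<r. \<phi> (chunk ?ln t e) z' \<longleftrightarrow> snd (qs ! t)) \<and> \<phi> bs z'}"
    for bs e
  have chunk_chunk: "chunk ?lu i (chunk ?ln t e) = chunk ?lu (t * n + i) e" if "i < n" for i t and e :: "'m list"
  proof -
    have ln: "?ln = n * ?lu" by (simp add: length_concat sum_list_replicate)
    have "Suc i * ?lu \<le> n * ?lu" using that by (intro mult_le_mono1) simp
    then have "min ?lu (n * ?lu - i * ?lu) = ?lu" by simp
    then show ?thesis unfolding ln
      by (simp add: chunk_def drop_take add_mult_distrib mult.assoc add.commute)
  qed
  have idx: "t * n + i < r * n" if "t < r" "i < n" for t i
  proof -
    have "t * n + i < Suc t * n" using that(2) by simp
    also have "\<dots> \<le> r * n" using that(1) by (intro mult_le_mono1) simp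
    finally show ?thesis .
  qed
  have rn: "reps r (reps n us) = reps (r * n) us"
    by (induction r) (simp_all add: concat_replicate_add)
  define P where "P bs e \<longleftrightarrow> bs \<in> B_power n \<and> e \<in> B_power (r * n) \<and>
    tree k (B_power n) (\<lambda>z bs. \<phi> bs z) (W bs e)" for bs e
  have Pd: "dfn2 A (reps n us) (reps (r * n) us) P"
  proof -
    let ?c = "reps n us @ reps (r * n) us"
    have tree_bounded: "tm A ?c (take ?ln) (reps n us)" and te: "tm A ?c (drop ?ln) (reps (r * n) us)"
      by (rule tm_take, rule tm_drop_id)
    have te': "tm A ?c (drop ?ln) (reps r (reps n us))" unfolding rn by (rule te)
    define \<phi>B where "\<phi>B z' bs e \<longleftrightarrow> \<phi> bs z'" for z' bs and e :: "'m list"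
    define W' where "W' z' e \<longleftrightarrow> (\<forall>t<r. \<phi> (chunk ?ln t (drop ?ln e)) z' \<longleftrightarrow> snd (qs ! t)) \<and>
      \<phi> (take ?ln e) z'" for z' e
    have W'd: "dfn2 A zs ?c W'" unfolding dfn2_def W'_def
    proof (intro dfn_conj dfn_all_less dfn_iff dfn_const dfn2_sub[OF \<phi>d] tm_take)
      show "tm A (zs @ ?c) (\<lambda>e. take ?ln (drop (length zs) e)) (reps n us)"
        by (rule tm_drop[OF tree_bounded])
      fix t assume "t < r"
      then show "tm A (zs @ ?c) (\<lambda>e. chunk ?ln t (drop ?ln (drop (length zs) e))) (reps n us)"
        by (rule tm_chunk_comp[OF tm_drop[OF te']])
    qed
    have \<phi>d': "dfn3 A zs (reps n us) ?c \<phi>B" unfolding dfn3_def \<phi>B_def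
      by (rule dfn2_sub[OF \<phi>d tm_drop[OF tm_take] tm_take])
    \<comment> \<open>nodes outside \<open>B_power n\<close> are related to no \<open>z\<close>, so they split nothing\<close>
    have nodes: "tree j (tuples M (reps n us)) (\<lambda>z' bs. \<phi> bs z') V \<longleftrightarrow>
      tree j (B_power n) (\<lambda>z' bs. \<phi> bs z') V" for j V
    proof (induction j arbitrary: V)
      case (Suc j)
      have "bs \<in> B_power n" if "bs \<in> tuples M (reps n us)" "tree j (B_power n) (\<lambda>z' bs. \<phi> bs z') {z' \<in> V. \<phi> bs z'}" for bs
      proof -
        from tree_nonempty[OF that(2)] obtain z' where "\<phi> bs z'" by blast
        then have "\<forall>i<n. chunk ?lu i bs \<in> B" unfolding \<phi>_def same_germ_def by blast
        with that(1) show ?thesis by (simp add: B_power_def)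
      qed
      then show ?case using Suc.IH B_power_tuples by auto
    qed simp
    have "dfn A ?c (\<lambda>e. take ?ln e \<in> B_power n \<and> drop ?ln e \<in> B_power (r * n) \<and>
      tree k (tuples M (reps n us)) (\<lambda>z' bs. \<phi>B z' bs e) {z' \<in> tuples M zs. W' z' e})"
      by (intro dfn_conj dfn_tm[OF B_power_dfn] tree_bounded te dfn_tree[OF W'd \<phi>d'])
    then show ?thesis unfolding dfn2_def
      by (rule dfn_cong) (simp add: P_def W_def W'_def \<phi>B_def nodes)
  qed
  have inv_e: "P bs e \<longleftrightarrow> P bs' e'"
    if m: "bs \<in> B_power n" "bs' \<in> B_power n" "e \<in> B_power (r * n)" "e' \<in> B_power (r * n)"
      and c: "germs_of n bs = germs_of n bs'" "germs_of (r * n) e = germs_of (r * n) e'" for bs bs' e e'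
  proof -
    have ch: "chunk ?ln t x \<in> B_power n" if "t < r" "x \<in> B_power (r * n)" for t x
      using that(2) tuples_chunk[of x r "reps n us" t] B_power_chunk[OF that(2) idx[OF that(1)]]
        chunk_chunk that(1) unfolding B_power_def rn by auto
    have "germs_of n (chunk ?ln t e) = germs_of n (chunk ?ln t e')" if t: "t < r" for t
      unfolding germs_of_eq_iff[OF ch[OF t m(3)] ch[OF t m(4)]]
      using germs_of_eq_iff[OF m(3,4)] c(2) idx[OF t] chunk_chunk by simp
    then have "W bs e = W bs' e'" unfolding W_def
      using inv'[OF m(1,2) c(1)] inv'[OF ch[OF _ m(3)] ch[OF _ m(4)]] by (intro Collect_cong) auto
    with m show ?thesis unfolding P_def by simp
  qed
  define e0 where "e0 = concat (map (\<lambda>t. fst (qs ! t)) [0..<r])"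
  have q: "fst (qs ! t) \<in> B_power n" if "t < r" for t using qs(1) that unfolding r_def by auto
  have e0ch: "chunk ?ln t e0 = fst (qs ! t)" if "t < r" for t
    unfolding e0_def by (rule chunk_concat[OF _ that]) (use q B_power_tuples tuples_length in blast)
  have e0: "e0 \<in> B_power (r * n)" unfolding B_power_def
  proof (intro CollectI conjI allI impI)
    show "e0 \<in> tuples M (reps (r * n) us)" unfolding rn[symmetric] e0_def
      by (rule tuples_concat_replicate) (use q B_power_tuples in blast)
    fix i assume i: "i < r * n"
    then have n0: "0 < n" by (cases n) auto
    have "i div n < r" using i by (rule less_mult_imp_div_less)
    then show "chunk ?lu i e0 \<in> B"
      using chunk_chunk[of "i mod n" "i div n" e0] e0ch B_power_chunk[OF q, of "i div n" "i mod n"] n0 by simp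
  qed
  have W0: "W bs e0 = {z' \<in> tuples M zs. (\<forall>(q, s)\<in>set qs. \<phi> q z' \<longleftrightarrow> s) \<and> \<phi> bs z'}" for bs
    unfolding W_def using e0ch by (auto simp: r_def all_set_conv_all_nth split_beta)
  have P0: "P bs e0 \<longleftrightarrow> germs_of n bs \<in> R" if "bs \<in> B_power n" for bs
    using qs(2) \<phi>_R[OF that] that e0 unfolding P_def W0 by simp
  define S where "S = {germs_of n bs @ germs_of (r * n) e | bs e. bs \<in> B_power n \<and> e \<in> B_power (r * n) \<and> P bs e}"
  have S_iff: "germs_of n bs @ germs_of (r * n) e \<in> S \<longleftrightarrow> P bs e" if "bs \<in> B_power n" "e \<in> B_power (r * n)" for bs e
  proof
    assume "germs_of n bs @ germs_of (r * n) e \<in> S"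
    then obtain bs' e' where x: "germs_of n bs @ germs_of (r * n) e = germs_of n bs' @ germs_of (r * n) e'"
      "bs' \<in> B_power n" "e' \<in> B_power (r * n)" "P bs' e'" unfolding S_def by blast
    then have "germs_of n bs = germs_of n bs'" "germs_of (r * n) e = germs_of (r * n) e'" by simp_all
    from inv_e[OF that(1) x(2) that(2) x(3) this] x(4) show "P bs e" by blast
  qed (use that in \<open>auto simp: S_def\<close>)
  have S_pow: "S \<subseteq> power_set germs (n + r * n)"
    unfolding S_def using germs_of_power_set[of _ n] germs_of_power_set[of _ "r * n"]
    by (force simp: power_set_def)
  have S_dfn: "definable_relation L M A S" unfolding definable_relation_iff[OF S_pow] concat_replicate_add
  proof (rule dfn_cong[OF Pd[unfolded dfn2_def]])
    fix x assume x: "x \<in> tuples M (reps n us @ reps (r * n) us)"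
    let ?b = "take ?ln x" and ?e = "drop ?ln x"
    have xe: "x = ?b @ ?e" by simp
    have mem: "x \<in> B_power (n + r * n) \<longleftrightarrow> ?b \<in> B_power n \<and> ?e \<in> B_power (r * n)"
      and germ_of: "germs_of (n + r * n) x = germs_of n ?b @ germs_of (r * n) ?e"
      using B_power_append[OF tuples_take[OF x] tuples_drop[OF x]]
        germs_of_append[OF tuples_take[OF x] tuples_drop[OF x]] by simp_all
    show "P ?b ?e \<longleftrightarrow> x \<in> B_power (n + r * n) \<and> germs_of (n + r * n) x \<in> S"
      unfolding mem germ_of using S_iff unfolding P_def by blast
  qed
  have "R = {rs \<in> power_set germs n. rs @ germs_of (r * n) e0 \<in> S}"
  proof (intro set_eqI iffI)
    fix rs assume rs: "rs \<in> R"
    then obtain bs where bs: "bs \<in> B_power n" "germs_of n bs = rs" using representatives R by blast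
    with rs P0 S_iff[OF bs(1) e0] R show "rs \<in> {rs \<in> power_set germs n. rs @ germs_of (r * n) e0 \<in> S}" by auto
  next
    fix rs assume rs: "rs \<in> {rs \<in> power_set germs n. rs @ germs_of (r * n) e0 \<in> S}"
    then obtain bs where bs: "bs \<in> B_power n" "germs_of n bs = rs" using representatives by blast
    with rs P0[OF bs(1)] S_iff[OF bs(1) e0] show "rs \<in> R" by auto
  qed
  then show "\<exists>m. \<exists>ks\<in>power_set germs m. \<exists>S\<subseteq>power_set germs (n + m).
    definable_relation L M A S \<and> R = {rs \<in> power_set germs n. rs @ ks \<in> S}"
    using S_pow S_dfn germs_of_power_set[OF e0] by blast
qed

end

theorem proposition3p10:
  fixes \<kappa> :: "'k rel"
    and L :: "('s, 'f, 'r) language"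
    and T :: "('s, 'f, 'r) formula set"
    and M :: "('s, 'f, 'r, 'm) struct"
    and A :: "'m set"
    and p :: "(('s, 'f, 'r) formula \<times> 'm list) set"
    and us ss ts :: "'s list"
    and B :: "'m list set"
    and f :: "'m list \<Rightarrow> 'm list \<rightharpoonup> 'm list"
  assumes "complete_theory L T"
    and "monster_model \<kappa> L T M"
    and "eliminates_imaginaries L M"
    and "NIP L M"
    and "A \<subseteq> points M" and "small \<kappa> A"
    and "global_type L M ss p" and "definable_type L M A ss p"
    and "definable_family_on L M A us ss ts p B f"
    and "\<forall>b\<in>B. \<forall>a. realizes M ss a (restrict_type p A) \<longrightarrow>
           (\<exists>y. f b a = Some y \<and> {y} \<in> St L M (A \<union> set a))"
  defines "\<Theta> \<equiv> germ M ss p B f ` B"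
  shows "imaginary_set L M A \<Theta> \<and> stable_set L M A \<Theta> \<and> stably_embedded L M A \<Theta> \<and>
         (\<forall>b\<in>B. germ M ss p B f b \<in> St L M A)"
proof -
  interpret stable_valued_family L M \<kappa> A ss p us ts B f
    using assms(2,4-10) by unfold_locales (auto simp: monster_model_def)
  have eq: "germs = germ M ss p B f ` B" unfolding germs_def germ_of_def ..
  have "imaginary_set L M A \<Theta>" "stable_set L M A \<Theta>" "stably_embedded L M A \<Theta>"
    using germs_imaginary germs_stable germs_stably_embedded unfolding eq assms(11) by auto
  moreover from this have "germ M ss p B f b \<in> St L M A" if "b \<in> B" for b
    using that unfolding St_def assms(11) by blast
  ultimately show ?thesis by blast
qed

end
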